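(* Let $n\ge 1$ and let $F_n=\langle a_1,\ldots,a_{n-1},a_n\rangle$ be the free group with free basis $a_1,\dots,a_n$. Let $H<\mathsf{Aut}(F_n)$ be the natural subgroup isomorphic to $\mathsf{Aut}(F_{n-1})$, consisting of all automorphisms of $F_n$ which preserve the free factor $\langle a_1,\ldots,a_{n-1}\rangle$ and fix the element $a_n$. There is a Lipschitz retraction from $\mathsf{Aut}(F_n)$ to $H$, which is therefore undistorted in $\mathsf{Aut}(F_n)$.
   Context: Finitely generated groups are equipped with the word metric of any finite generating set. For a finitely generated group $G$ and a finitely generated subgroup $H<G$: a Lipschitz retraction from $G$ to $H$ is a function $\pi\colon G\to H$ (not necessarily a homomorphism) that restricts to the identity on $H$ and for which there is a constant $K\ge 1$ such that $d_H(\pi(a),\pi(b))\le K\,d_G(a,b)$ for all $a,b\in G$; $H$ is undistorted in $G$ if the inclusion $H\hookrightarrow G$ is a quasi-isometric embedding with respect to word metrics. *)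

theory Defs
  imports Complex_Main "HOL-Algebra.Bij" "HOL-Algebra.Generated_Groups"
begin

section \<open>Free bases\<close>

text \<open>A word is a list of letters \<open>(i, e)\<close>; the letter \<open>(i, True)\<close> stands for \<open>a i\<close> and
  \<open>(i, False)\<close> for its inverse.\<close>

definition letter_val :: "('a, 'b) monoid_scheme \<Rightarrow> ('i \<Rightarrow> 'a) \<Rightarrow> 'i \<times> bool \<Rightarrow> 'a" where
  "letter_val F a l = (if snd l then a (fst l) else inv\<^bsub>F\<^esub> (a (fst l)))"

definition list_prod :: "('a, 'b) monoid_scheme \<Rightarrow> 'a list \<Rightarrow> 'a" where
  "list_prod G ws = foldr (\<lambda>x y. x \<otimes>\<^bsub>G\<^esub> y) ws \<one>\<^bsub>G\<^esub>"

definition reduced_word :: "('i \<times> bool) list \<Rightarrow> bool" where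
  "reduced_word w \<longleftrightarrow> successively (\<lambda>l m. \<not> (fst l = fst m \<and> snd l \<noteq> snd m)) w"

text \<open>The family \<open>(a i)\<close>, \<open>i \<in> I\<close>, is a free basis of \<open>F\<close>: it generates \<open>F\<close>, and no nonempty
  reduced word in it is trivial. In particular \<open>a\<close> is injective on \<open>I\<close>, since for distinct
  \<open>i\<close>, \<open>j\<close> the word \<open>[(i, True), (j, False)]\<close> is reduced.\<close>

definition free_basis :: "('a, 'b) monoid_scheme \<Rightarrow> ('i \<Rightarrow> 'a) \<Rightarrow> 'i set \<Rightarrow> bool" where
  "free_basis F a I \<longleftrightarrow>
     a ` I \<subseteq> carrier F \<and> generate F (a ` I) = carrier F \<and>
     (\<forall>w. w \<noteq> [] \<longrightarrow> fst ` set w \<subseteq> I \<longrightarrow> reduced_word w \<longrightarrow>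
        list_prod F (map (letter_val F a) w) \<noteq> \<one>\<^bsub>F\<^esub>)"

section \<open>Word metrics\<close>

definition finite_generating_set :: "('a, 'b) monoid_scheme \<Rightarrow> 'a set \<Rightarrow> bool" where
  "finite_generating_set G S \<longleftrightarrow> finite S \<and> S \<subseteq> carrier G \<and> generate G S = carrier G"

definition finitely_generated :: "('a, 'b) monoid_scheme \<Rightarrow> bool" where
  "finitely_generated G \<longleftrightarrow> (\<exists>S. finite_generating_set G S)"

text \<open>Meaningful for \<open>g\<close> in the subgroup generated by \<open>S\<close>.\<close>

definition word_norm :: "('a, 'b) monoid_scheme \<Rightarrow> 'a set \<Rightarrow> 'a \<Rightarrow> nat" where
  "word_norm G S g =
     (LEAST k. \<exists>ws. length ws = k \<and> set ws \<subseteq> S \<union> m_inv G ` S \<and> list_prod G ws = g)"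

definition word_dist :: "('a, 'b) monoid_scheme \<Rightarrow> 'a set \<Rightarrow> 'a \<Rightarrow> 'a \<Rightarrow> real" where
  "word_dist G S g h = real (word_norm G S (inv\<^bsub>G\<^esub> g \<otimes>\<^bsub>G\<^esub> h))"

section \<open>Lipschitz retractions and undistorted subgroups\<close>

text \<open>Both notions concern a finitely generated subgroup of a finitely generated group, so finite
  generation of the two groups is part of them rather than a guard that could hold vacuously. The
  constants may depend on the finite generating sets, the retraction may not.\<close>

definition fg_subgroup :: "'a set \<Rightarrow> ('a, 'b) monoid_scheme \<Rightarrow> bool" where
  "fg_subgroup H G \<longleftrightarrow>
     group G \<and> finitely_generated G \<and> subgroup H G \<and> finitely_generated (G\<lparr>carrier := H\<rparr>)"

definition lipschitz_retraction ::
  "('a, 'b) monoid_scheme \<Rightarrow> 'a set \<Rightarrow> ('a \<Rightarrow> 'a) \<Rightarrow> bool" where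
  "lipschitz_retraction G H \<pi> \<longleftrightarrow>
     fg_subgroup H G \<and> \<pi> \<in> carrier G \<rightarrow> H \<and> (\<forall>h\<in>H. \<pi> h = h) \<and>
     (\<forall>S T. finite_generating_set G S \<longrightarrow> finite_generating_set (G\<lparr>carrier := H\<rparr>) T \<longrightarrow>
        (\<exists>K\<ge>1. \<forall>x\<in>carrier G. \<forall>y\<in>carrier G.
           word_dist (G\<lparr>carrier := H\<rparr>) T (\<pi> x) (\<pi> y) \<le> K * word_dist G S x y))"

definition quasi_isometric_embedding ::
  "'a set \<Rightarrow> ('a \<Rightarrow> 'a \<Rightarrow> real) \<Rightarrow> ('c \<Rightarrow> 'c \<Rightarrow> real) \<Rightarrow> ('a \<Rightarrow> 'c) \<Rightarrow> bool" where
  "quasi_isometric_embedding X d e f \<longleftrightarrow>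
     (\<exists>K\<ge>1. \<exists>C\<ge>0. \<forall>x\<in>X. \<forall>y\<in>X.
        d x y / K - C \<le> e (f x) (f y) \<and> e (f x) (f y) \<le> K * d x y + C)"

definition undistorted :: "('a, 'b) monoid_scheme \<Rightarrow> 'a set \<Rightarrow> bool" where
  "undistorted G H \<longleftrightarrow>
     fg_subgroup H G \<and>
     (\<forall>S T. finite_generating_set G S \<longrightarrow> finite_generating_set (G\<lparr>carrier := H\<rparr>) T \<longrightarrow>
        quasi_isometric_embedding H (word_dist (G\<lparr>carrier := H\<rparr>) T) (word_dist G S) (\<lambda>h. h))"

section \<open>The subgroup of automorphisms\<close>

definition factor_stabilizer ::
  "('a, 'b) monoid_scheme \<Rightarrow> (nat \<Rightarrow> 'a) \<Rightarrow> nat \<Rightarrow> ('a \<Rightarrow> 'a) set" where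
  "factor_stabilizer F a n =
     {\<phi> \<in> carrier (AutoGroup F).
        \<phi> ` generate F (a ` {1..<n}) = generate F (a ` {1..<n}) \<and> \<phi> (a n) = a n}"

end

theory Submission
  imports Defs
begin

text \<open>
  Write \<open>A\<close> for the factor \<open>\<langle>a\<^sub>1, \<dots>, a\<^sub>n\<^sub>-\<^sub>1\<rangle>\<close> of \<open>F\<close> and \<open>H\<close> for its stabilizer. For an automorphism \<open>\<phi>\<close>
  put \<open>B = \<phi>\<inverse>(A)\<close>. A spanning tree of the Schreier coset graph of \<open>B\<close> with respect to \<open>a\<^sub>1, \<dots>, a\<^sub>n\<close>
  gives a basis \<open>b\<^sub>1, \<dots>, b\<^sub>n\<^sub>-\<^sub>1\<close> of \<open>B\<close>, one element for each edge outside the tree, and the retraction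
  sends \<open>\<phi>\<close> to the automorphism \<open>a\<^sub>j \<mapsto> \<phi>(b\<^sub>j)\<close>, \<open>a\<^sub>n \<mapsto> a\<^sub>n\<close>. If \<open>\<phi>\<close> is in \<open>H\<close>, then \<open>B = A\<close>, the edges
  outside the tree are the loops at the base vertex, \<open>b\<^sub>j = a\<^sub>j\<close> up to order, and \<open>\<phi>\<close> may be sent to itself.

  The point is that the choices do not matter. An element of \<open>B\<close>, written in the tree basis, is as long
  as the number of times its loop crosses the \<open>n - 1\<close> edges outside the tree, and the loop of a basis
  element crosses every edge at most three times. An automorphism \<open>\<sigma>\<close> maps the cosets of \<open>\<sigma>\<inverse>(B)\<close>
  bijectively to those of \<open>B\<close> and edges to walks of bounded length, so the images under \<open>\<sigma>\<close> of all edges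
  of the first graph together cross an edge of the second a bounded number of times. Hence \<open>\<sigma>\<close> maps the
  tree basis of \<open>\<sigma>\<inverse>(B)\<close> to words of bounded length in the tree basis of \<open>B\<close>, and the increment
  \<open>\<pi>(\<phi>)\<inverse> \<pi>(\<phi> \<sigma>)\<close> sends every \<open>a\<^sub>j\<close> to a word of length bounded in terms of \<open>\<sigma>\<close> alone
  (\<open>shadow_increments_bounded\<close>). There are finitely many such automorphisms, no matter which \<open>\<phi>\<close>
  and which trees; this finiteness makes \<open>\<pi>\<close> Lipschitz and \<open>H\<close> finitely generated
  (\<open>lipschitz_retraction_finite_increments\<close>), and it replaces any explicit calculation with
  Nielsen moves.

  The same counting shows that \<open>Aut(F)\<close> is finitely generated (\<open>finitely_generated_AutoGroup\<close>). Fold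
  the subdivided rose whose petals spell \<open>\<phi>(a\<^sub>1), \<dots>, \<phi>(a\<^sub>n)\<close> to a graph with \<open>n\<close> loops at its base
  vertex, identifying two vertices at a time. A fold has at most four edges in each fibre, so the loops
  of a spanning tree before the fold are bounded words in those after it; consecutive bases thus differ
  by an automorphism from one fixed finite set.

  Two facts about free groups enter. A generating tuple of the right size is a basis
  (\<open>generating_tuple_automorphism\<close>, the Hopf property), so it suffices to produce generators. And a
  coset graph of a subgroup with \<open>k\<close> generators has at most \<open>k\<close> edges outside a spanning tree
  (\<open>coset_graph_rank_le\<close>), by counting crossings modulo 2.
\<close>

section \<open>Words in a group\<close>

definition word_val :: "('a, 'b) monoid_scheme \<Rightarrow> ('i \<Rightarrow> 'a) \<Rightarrow> ('i \<times> bool) list \<Rightarrow> 'a" where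
  "word_val G x w = list_prod G (map (letter_val G x) w)"

definition inv_word :: "('i \<times> bool) list \<Rightarrow> ('i \<times> bool) list" where
  "inv_word w = rev (map (\<lambda>(i, e). (i, \<not> e)) w)"

lemma inv_word_simps [simp]:
  "inv_word [] = []" "inv_word ((i, e) # w) = inv_word w @ [(i, \<not> e)]"
  "inv_word (u @ v) = inv_word v @ inv_word u"
  by (simp_all add: inv_word_def)

lemma fst_set_inv_word [simp]: "fst ` set (inv_word w) = fst ` set w"
  by (force simp: inv_word_def image_image split: prod.splits)

lemma map_fst_inv_word: "map fst (inv_word w) = rev (map fst w)"
  by (simp add: inv_word_def rev_map split_def)

lemma list_prod_simps [simp]:
  "list_prod G [] = \<one>\<^bsub>G\<^esub>" "list_prod G (x # xs) = x \<otimes>\<^bsub>G\<^esub> list_prod G xs"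
  by (simp_all add: list_prod_def)

lemma word_val_simps [simp]:
  "word_val G x [] = \<one>\<^bsub>G\<^esub>"
  "word_val G x ((i, True) # w) = x i \<otimes>\<^bsub>G\<^esub> word_val G x w"
  "word_val G x ((i, False) # w) = inv\<^bsub>G\<^esub> (x i) \<otimes>\<^bsub>G\<^esub> word_val G x w"
  by (simp_all add: word_val_def letter_val_def)

lemma word_val_Cons:
  "word_val G x (l # w) = letter_val G x l \<otimes>\<^bsub>G\<^esub> word_val G x w"
  by (simp add: word_val_def)

lemma word_val_map:
  "word_val G x (map (\<lambda>(i, e). (f i, e)) w) = word_val G (x \<circ> f) w"
  by (induction w) (auto simp: word_val_Cons letter_val_def)

lemma word_val_cong:
  assumes "\<And>i. i \<in> fst ` set w \<Longrightarrow> x i = y i"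
  shows "word_val G x w = word_val G y w"
  unfolding word_val_def letter_val_def
  by (rule arg_cong[where f = "list_prod G"], rule map_cong) (use assms in auto)

context group
begin

lemma letter_val_closed [simp, intro]:
  "x (fst l) \<in> carrier G \<Longrightarrow> letter_val G x l \<in> carrier G"
  by (simp add: letter_val_def)

lemma list_prod_closed: "set ws \<subseteq> carrier G \<Longrightarrow> list_prod G ws \<in> carrier G"
  by (induction ws) auto

lemma list_prod_append:
  "set us \<subseteq> carrier G \<Longrightarrow> set vs \<subseteq> carrier G \<Longrightarrow>
    list_prod G (us @ vs) = list_prod G us \<otimes> list_prod G vs"
  by (induction us) (auto simp: m_assoc list_prod_closed)

lemma word_val_closed:
  "x ` fst ` set w \<subseteq> carrier G \<Longrightarrow> word_val G x w \<in> carrier G"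
  unfolding word_val_def by (rule list_prod_closed) (auto intro!: letter_val_closed)

lemma word_val_append:
  "x ` fst ` set u \<subseteq> carrier G \<Longrightarrow> x ` fst ` set v \<subseteq> carrier G \<Longrightarrow>
    word_val G x (u @ v) = word_val G x u \<otimes> word_val G x v"
  unfolding word_val_def map_append
  by (rule list_prod_append) (force intro!: letter_val_closed)+

lemma word_val_inv_word:
  "x ` fst ` set w \<subseteq> carrier G \<Longrightarrow> word_val G x (inv_word w) = inv (word_val G x w)"
proof (induction w)
  case (Cons l w)
  obtain i e where l: "l = (i, e)" by fastforce
  have x: "x i \<in> carrier G" and w: "x ` fst ` set w \<subseteq> carrier G"
    using Cons.prems l by auto
  have v: "word_val G x w \<in> carrier G" using w by (rule word_val_closed)
  have "word_val G x (inv_word (l # w)) = inv (word_val G x w) \<otimes> word_val G x [(i, \<not> e)]"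
    using Cons.IH[OF w] x w by (simp add: l word_val_append)
  also have "\<dots> = inv (word_val G x (l # w))"
    using x v by (cases e) (auto simp: l inv_mult_group)
  finally show ?case .
qed simp

lemma word_val_filter:
  assumes "x ` fst ` set w \<subseteq> carrier G"
    and "\<And>i. i \<in> fst ` set w \<Longrightarrow> i \<notin> N \<Longrightarrow> x i = \<one>"
  shows "word_val G x (filter (\<lambda>l. fst l \<in> N) w) = word_val G x w"
  using assms
proof (induction w)
  case (Cons l w)
  obtain i e where l: "l = (i, e)" by fastforce
  have w: "x ` fst ` set w \<subseteq> carrier G" using Cons.prems by auto
  have IH: "word_val G x (filter (\<lambda>l. fst l \<in> N) w) = word_val G x w"
    using Cons by auto
  show ?case
  proof (cases "i \<in> N")
    case True
    then show ?thesis using IH by (simp add: l word_val_Cons)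
  next
    case False
    then have "x i = \<one>" using Cons.prems(2)[of i] l by simp
    then show ?thesis
      using IH False word_val_closed[OF w] by (cases e) (simp_all add: l)
  qed
qed simp

lemma generate_list_prod:
  assumes "S \<subseteq> carrier G"
  shows "g \<in> generate G S \<longleftrightarrow> (\<exists>ws. set ws \<subseteq> S \<union> m_inv G ` S \<and> list_prod G ws = g)"
proof
  assume "g \<in> generate G S"
  then show "\<exists>ws. set ws \<subseteq> S \<union> m_inv G ` S \<and> list_prod G ws = g"
  proof induction
    case one
    show ?case by (rule exI[of _ "[]"]) simp
  next
    case (incl h)
    then show ?case using assms by (intro exI[of _ "[h]"]) auto
  next
    case (inv h)
    then show ?case using assms by (intro exI[of _ "[inv h]"]) auto
  next
    case (eng h1 h2)
    then obtain u v where "set u \<subseteq> S \<union> m_inv G ` S" "list_prod G u = h1"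
      "set v \<subseteq> S \<union> m_inv G ` S" "list_prod G v = h2" by blast
    moreover have "S \<union> m_inv G ` S \<subseteq> carrier G" using assms by auto
    ultimately show ?case
      by (intro exI[of _ "u @ v"]) (auto intro!: list_prod_append simp del: Un_subset_iff)
  qed
next
  assume "\<exists>ws. set ws \<subseteq> S \<union> m_inv G ` S \<and> list_prod G ws = g"
  then obtain ws where "set ws \<subseteq> S \<union> m_inv G ` S" "list_prod G ws = g" by blast
  then show "g \<in> generate G S"
    by (induction ws arbitrary: g) (auto intro: generate.intros)
qed

lemma word_val_in_generate:
  "fst ` set w \<subseteq> I \<Longrightarrow> word_val G x w \<in> generate G (x ` I)"
proof (induction w)
  case (Cons l w)
  then have "x (fst l) \<in> x ` I" "word_val G x w \<in> generate G (x ` I)" by auto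
  then have "letter_val G x l \<in> generate G (x ` I)"
    by (auto simp: letter_val_def intro: generate.incl generate.inv)
  then show ?case
    using \<open>word_val G x w \<in> generate G (x ` I)\<close> by (simp add: word_val_Cons generate.eng)
qed (simp add: generate.one)

lemma generate_word_val:
  assumes "x ` I \<subseteq> carrier G"
  shows "g \<in> generate G (x ` I) \<longleftrightarrow> (\<exists>w. fst ` set w \<subseteq> I \<and> word_val G x w = g)"
proof
  assume "g \<in> generate G (x ` I)"
  then obtain ws where "set ws \<subseteq> x ` I \<union> m_inv G ` x ` I" "list_prod G ws = g"
    using generate_list_prod[OF assms] by auto
  then show "\<exists>w. fst ` set w \<subseteq> I \<and> word_val G x w = g"
  proof (induction ws arbitrary: g)
    case Nil
    then show ?case by (intro exI[of _ "[]"]) simp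
  next
    case (Cons y ws)
    then obtain w where w: "fst ` set w \<subseteq> I" "word_val G x w = list_prod G ws" by auto
    obtain l where "fst l \<in> I" "letter_val G x l = y"
    proof -
      from Cons.prems consider i where "i \<in> I" "y = x i" | i where "i \<in> I" "y = inv x i"
        by auto
      then show ?thesis
        by cases (auto intro: that[of "(_, True)"] that[of "(_, False)"] simp: letter_val_def)
    qed
    then show ?case using w Cons.prems by (intro exI[of _ "l # w"]) (auto simp: word_val_Cons)
  qed
qed (auto intro: word_val_in_generate)

end

lemma hom_word_val:
  assumes "group G" "group K" "h \<in> hom G K" "x ` fst ` set w \<subseteq> carrier G"
  shows "h (word_val G x w) = word_val K (h \<circ> x) w"
proof -
  interpret group_hom G K h
    using assms by (simp add: group_hom_def group_hom_axioms_def)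
  show ?thesis using assms(4)
  proof (induction w)
    case (Cons l w)
    then have "word_val G x w \<in> carrier G" "x (fst l) \<in> carrier G"
      by (auto intro: G.word_val_closed)
    then show ?case using Cons by (cases l; cases "snd l") auto
  qed simp
qed

lemma homs_agree_on_generate:
  assumes "group G" "group K" "h \<in> hom G K" "k \<in> hom G K" "S \<subseteq> carrier G"
    and "\<And>s. s \<in> S \<Longrightarrow> h s = k s" and "g \<in> generate G S"
  shows "h g = k g"
proof -
  obtain w where w: "fst ` set w \<subseteq> S" "word_val G (\<lambda>s. s) w = g"
    using group.generate_word_val[OF assms(1), of "\<lambda>s. s" S g] assms by auto
  have "h g = word_val K (h \<circ> (\<lambda>s. s)) w"
    using hom_word_val[OF assms(1-3)] w assms(5) by fastforce
  also have "\<dots> = word_val K (k \<circ> (\<lambda>s. s)) w"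
    using w assms(6) by (intro word_val_cong) auto
  also have "\<dots> = k g"
    using hom_word_val[OF assms(1,2,4)] w assms(5) by fastforce
  finally show ?thesis .
qed

section \<open>The universal property of a free basis\<close>

locale free_group = group F for F (structure) +
  fixes a :: "'i \<Rightarrow> 'a" and I :: "'i set"
  assumes basis: "free_basis F a I"
begin

lemma basis_closed: "a ` I \<subseteq> carrier F"
  and generate_basis: "generate F (a ` I) = carrier F"
  using basis by (auto simp: free_basis_def)

lemma basis_in_carrier [simp, intro]: "i \<in> I \<Longrightarrow> a i \<in> carrier F"
  using basis_closed by auto

lemma reduced_word_val_neq_one:
  "w \<noteq> [] \<Longrightarrow> fst ` set w \<subseteq> I \<Longrightarrow> reduced_word w \<Longrightarrow> word_val F a w \<noteq> \<one>"
  using basis by (auto simp: free_basis_def word_val_def)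

lemma basis_neq_one: "i \<in> I \<Longrightarrow> a i \<noteq> \<one>"
  using reduced_word_val_neq_one[of "[(i, True)]"] by (auto simp: reduced_word_def)

lemma word_val_basis_closed [simp, intro]: "fst ` set w \<subseteq> I \<Longrightarrow> word_val F a w \<in> carrier F"
  by (intro word_val_closed) auto

lemma ex_word_val: "g \<in> carrier F \<Longrightarrow> \<exists>w. fst ` set w \<subseteq> I \<and> word_val F a w = g"
  using generate_word_val[OF basis_closed] generate_basis by auto

end

lemma not_reduced_wordE:
  assumes "\<not> reduced_word w"
  obtains u i e v where "w = u @ [(i, e), (i, \<not> e)] @ v"
proof -
  have "\<exists>u i e v. w = u @ [(i, e), (i, \<not> e)] @ v"
    using assms unfolding reduced_word_def
  proof (induction w rule: induct_list012)
    case (3 l m w)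
    show ?case
    proof (cases "fst l = fst m \<and> snd l \<noteq> snd m")
      case True
      then have "l # m # w = [] @ [(fst l, snd l), (fst l, \<not> snd l)] @ w"
        by (auto simp: prod_eq_iff)
      then show ?thesis by blast
    next
      case False
      then have "\<exists>u i e v. m # w = u @ [(i, e), (i, \<not> e)] @ v"
        using 3 by auto
      then obtain u i e v where "m # w = u @ [(i, e), (i, \<not> e)] @ v" by blast
      then have "l # m # w = (l # u) @ [(i, e), (i, \<not> e)] @ v" by simp
      then show ?thesis by blast
    qed
  qed auto
  then show ?thesis using that by blast
qed

lemma (in group) word_val_cancel:
  assumes "x ` fst ` set (u @ [(i, e), (i, \<not> e)] @ v) \<subseteq> carrier G"
  shows "word_val G x (u @ [(i, e), (i, \<not> e)] @ v) = word_val G x (u @ v)"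
proof -
  have "x i \<in> carrier G" "word_val G x v \<in> carrier G"
    using assms by (auto intro!: word_val_closed)
  then have "word_val G x ([(i, e), (i, \<not> e)] @ v) = word_val G x v"
    by (cases e) (simp_all add: m_assoc[symmetric])
  moreover have "word_val G x (u @ [(i, e), (i, \<not> e)] @ v)
      = word_val G x u \<otimes> word_val G x ([(i, e), (i, \<not> e)] @ v)"
    using assms by (intro word_val_append) auto
  moreover have "word_val G x (u @ v) = word_val G x u \<otimes> word_val G x v"
    using assms by (intro word_val_append) auto
  ultimately show ?thesis by simp
qed

text \<open>A nonempty word with trivial value is not reduced, and a cancelling pair of letters can be removed
  in both groups at once.\<close>

lemma (in free_group) relations_hold_everywhere:
  assumes "group X" and "y ` I \<subseteq> carrier X" and "fst ` set w \<subseteq> I" and "word_val F a w = \<one>"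
  shows "word_val X y w = \<one>\<^bsub>X\<^esub>"
  using assms(3,4)
proof (induction "length w" arbitrary: w rule: less_induct)
  case less
  show ?case
  proof (cases "w = []")
    case False
    then have "\<not> reduced_word w" using reduced_word_val_neq_one less.prems by blast
    then obtain u i e v where w: "w = u @ [(i, e), (i, \<not> e)] @ v" by (rule not_reduced_wordE)
    have uv: "fst ` set (u @ v) \<subseteq> I" using less.prems(1) w by auto
    have ax: "a ` fst ` set w \<subseteq> carrier F" "y ` fst ` set w \<subseteq> carrier X"
      using less.prems(1) assms(2) basis_closed by blast+
    have "word_val F a (u @ v) = \<one>"
      using word_val_cancel[of a u i e v] ax(1) less.prems(2) w by simp
    then have "word_val X y (u @ v) = \<one>\<^bsub>X\<^esub>" using less.hyps[of "u @ v"] uv w by simp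
    then show ?thesis using group.word_val_cancel[OF assms(1), of y u i e v] ax(2) w by simp
  qed simp
qed

theorem (in free_group) hom_extension:
  assumes "group X" and y: "y ` I \<subseteq> carrier X"
  obtains h where "h \<in> hom F X" and "\<And>i. i \<in> I \<Longrightarrow> h (a i) = y i"
    and "\<And>w. fst ` set w \<subseteq> I \<Longrightarrow> h (word_val F a w) = word_val X y w"
proof -
  interpret X: group X by fact
  have ycl: "y ` fst ` set w \<subseteq> carrier X" if "fst ` set w \<subseteq> I" for w
    using that y by blast
  have acl: "a ` fst ` set w \<subseteq> carrier F" if "fst ` set w \<subseteq> I" for w
    using that basis_closed by blast
  have well_defined: "word_val X y u = word_val X y v"
    if u: "fst ` set u \<subseteq> I" and v: "fst ` set v \<subseteq> I" and eq: "word_val F a u = word_val F a v" for u v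
  proof -
    have uv: "fst ` set (u @ inv_word v) \<subseteq> I"
      using u v by (simp add: image_Un)
    have "word_val F a (u @ inv_word v) = \<one>"
      using acl u v eq by (subst word_val_append) (auto simp: word_val_inv_word simp del: set_append)
    then have "word_val X y (u @ inv_word v) = \<one>\<^bsub>X\<^esub>"
      by (rule relations_hold_everywhere[OF assms uv])
    moreover have "word_val X y (u @ inv_word v) = word_val X y u \<otimes>\<^bsub>X\<^esub> inv\<^bsub>X\<^esub> word_val X y v"
      using ycl u v by (subst X.word_val_append) (auto simp: X.word_val_inv_word)
    ultimately show ?thesis
      using X.word_val_closed[OF ycl[OF u]] X.word_val_closed[OF ycl[OF v]]
      by (metis X.inv_closed X.inv_equality X.inv_inv)
  qed
  define h where "h g = word_val X y (SOME w. fst ` set w \<subseteq> I \<and> word_val F a w = g)" for g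
  have h: "h (word_val F a w) = word_val X y w" if "fst ` set w \<subseteq> I" for w
  proof -
    let ?v = "SOME v. fst ` set v \<subseteq> I \<and> word_val F a v = word_val F a w"
    have "fst ` set ?v \<subseteq> I \<and> word_val F a ?v = word_val F a w"
      by (rule someI) (use that in blast)
    then show ?thesis unfolding h_def using that by (intro well_defined) auto
  qed
  have "h \<in> hom F X"
  proof (rule homI)
    fix g assume "g \<in> carrier F"
    then show "h g \<in> carrier X" using ex_word_val[of g] h ycl X.word_val_closed by metis
  next
    fix g k assume "g \<in> carrier F" "k \<in> carrier F"
    then obtain u v where u: "fst ` set u \<subseteq> I" "word_val F a u = g"
      and v: "fst ` set v \<subseteq> I" "word_val F a v = k"
      using ex_word_val by meson
    have "h (g \<otimes> k) = word_val X y (u @ v)"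
      using h[of "u @ v"] u v acl[of u] acl[of v] by (simp add: word_val_append image_Un)
    then show "h (g \<otimes> k) = h g \<otimes>\<^bsub>X\<^esub> h k"
      using h u v ycl[of u] ycl[of v] by (auto simp: X.word_val_append)
  qed
  moreover have "h (a i) = y i" if "i \<in> I" for i
    using h[of "[(i, True)]"] that y by auto
  ultimately show ?thesis using that h by blast
qed

section \<open>Labelled graphs and spanning trees\<close>

type_synonym ('v, 'i) edge = "'v \<times> 'i \<times> 'v"

abbreviation source :: "('v, 'i) edge \<Rightarrow> 'v" where "source e \<equiv> fst e"
abbreviation lab :: "('v, 'i) edge \<Rightarrow> 'i" where "lab e \<equiv> fst (snd e)"
abbreviation target :: "('v, 'i) edge \<Rightarrow> 'v" where "target e \<equiv> snd (snd e)"

definition step_from :: "('v, 'i) edge \<times> bool \<Rightarrow> 'v" where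
  "step_from s = (if snd s then source (fst s) else target (fst s))"

definition step_to :: "('v, 'i) edge \<times> bool \<Rightarrow> 'v" where
  "step_to s = (if snd s then target (fst s) else source (fst s))"

text \<open>A step \<open>(e, True)\<close> crosses the edge \<open>e\<close> forwards, \<open>(e, False)\<close> backwards. So a walk is
  also a word in the alphabet of edges, and \<open>word_val\<close> applies to it as it stands.\<close>

fun walk :: "('v, 'i) edge set \<Rightarrow> 'v \<Rightarrow> (('v, 'i) edge \<times> bool) list \<Rightarrow> 'v \<Rightarrow> bool" where
  "walk E u [] v \<longleftrightarrow> u = v"
| "walk E u (s # c) v \<longleftrightarrow> fst s \<in> E \<and> step_from s = u \<and> walk E (step_to s) c v"

definition reachable :: "('v, 'i) edge set \<Rightarrow> 'v \<Rightarrow> 'v set" where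
  "reachable E u = {v. \<exists>c. walk E u c v}"

lemma step_simps [simp]:
  "step_from (e, True) = source e" "step_from (e, False) = target e"
  "step_to (e, True) = target e" "step_to (e, False) = source e"
  by (simp_all add: step_from_def step_to_def)

lemma walk_append: "walk E u (c @ d) v \<longleftrightarrow> (\<exists>m. walk E u c m \<and> walk E m d v)"
  by (induction c arbitrary: u) auto

lemma walk_inv_word: "walk E u c v \<Longrightarrow> walk E v (inv_word c) u"
proof (induction c arbitrary: u)
  case (Cons s c)
  obtain e b where "s = (e, b)" by fastforce
  then show ?case using Cons by (cases b) (auto simp: walk_append)
qed simp

lemma walk_edges: "walk E u c v \<Longrightarrow> fst ` set c \<subseteq> E"
  by (induction c arbitrary: u) auto

lemma reachable_refl: "u \<in> reachable E u"
  unfolding reachable_def by (auto intro: exI[of _ "[]"])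

lemma reachable_walk: "u \<in> reachable E v0 \<Longrightarrow> walk E u c v \<Longrightarrow> v \<in> reachable E v0"
  unfolding reachable_def using walk_append by fastforce

lemma reachable_ends:
  assumes "(p, i, q) \<in> E"
  shows "p \<in> reachable E v0 \<longleftrightarrow> q \<in> reachable E v0"
  using reachable_walk[of p E v0 "[((p, i, q), True)]" q]
    reachable_walk[of q E v0 "[((p, i, q), False)]" p] assms by auto

text \<open>\<open>P\<close> is the edge set of a spanning tree of the component of \<open>v0\<close>, and \<open>T v\<close> is the walk in
  it from \<open>v0\<close> to \<open>v\<close>. The bijection assigns to a vertex the edge by which its walk arrives; it is
  there to count the tree edges. No finiteness is assumed, because coset graphs are infinite.\<close>

definition spanning_tree ::
  "('v, 'i) edge set \<Rightarrow> 'v \<Rightarrow> ('v, 'i) edge set \<Rightarrow> ('v \<Rightarrow> (('v, 'i) edge \<times> bool) list) \<Rightarrow> bool" where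
  "spanning_tree E v0 P T \<longleftrightarrow>
     P \<subseteq> E \<and> T v0 = [] \<and>
     (\<forall>v\<in>reachable E v0. walk E v0 (T v) v \<and> distinct (map fst (T v)) \<and> fst ` set (T v) \<subseteq> P) \<and>
     (\<forall>e\<in>P. \<exists>b. T (step_to (e, b)) = T (step_from (e, b)) @ [(e, b)]) \<and>
     (\<exists>arrival. bij_betw arrival (reachable E v0 - {v0}) P)"

text \<open>Breadth-first search: every vertex chooses a last step of a shortest walk to it. Along the
  resulting walks the distance from \<open>v0\<close> increases, so they repeat no edge.\<close>

theorem ex_spanning_tree: "\<exists>P T. spanning_tree E v0 P T"
proof -
  let ?R = "reachable E v0"
  define d where "d v = (LEAST k. \<exists>c. walk E v0 c v \<and> length c = k)" for v
  have shortest: "\<exists>c. walk E v0 c v \<and> length c = d v" if "v \<in> ?R" for v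
    unfolding d_def by (rule LeastI_ex) (use that in \<open>auto simp: reachable_def\<close>)
  have d_le: "d v \<le> length c" if "walk E v0 c v" for v c
    unfolding d_def by (rule Least_le) (use that in auto)
  have d_zero: "v = v0" if "v \<in> ?R" "d v = 0" for v
    using shortest[OF that(1)] that(2) by auto
  have "d v0 = 0" using d_le[of "[]"] by auto
  have "\<exists>s. fst s \<in> E \<and> step_to s = v \<and> step_from s \<in> ?R \<and> d v = Suc (d (step_from s))"
    if v: "v \<in> ?R - {v0}" for v
  proof -
    obtain c where c: "walk E v0 c v" "length c = d v" using shortest v by blast
    with v have "c \<noteq> []" by auto
    then obtain c' s where cs: "c = c' @ [s]" by (metis append_butlast_last_id)
    then have s: "walk E v0 c' (step_from s)" "fst s \<in> E" "step_to s = v"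
      using c by (auto simp: walk_append)
    then have r: "step_from s \<in> ?R" by (auto simp: reachable_def)
    obtain c'' where c'': "walk E v0 c'' (step_from s)" "length c'' = d (step_from s)"
      using shortest r by blast
    have "walk E v0 (c'' @ [s]) v" using c'' s by (auto simp: walk_append)
    then have "d v \<le> Suc (d (step_from s))" using d_le c'' by fastforce
    moreover have "Suc (d (step_from s)) \<le> d v" using d_le[OF s(1)] c(2) cs by simp
    ultimately show ?thesis using s r by (intro exI[of _ s]) auto
  qed
  then obtain par where par: "\<And>v. v \<in> ?R - {v0} \<Longrightarrow>
      fst (par v) \<in> E \<and> step_to (par v) = v \<and> step_from (par v) \<in> ?R \<and>
      d v = Suc (d (step_from (par v)))"
    by metis
  define Tn where "Tn = rec_nat (\<lambda>v. []) (\<lambda>m f v. f (step_from (par v)) @ [par v])"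
  have Tn: "Tn 0 v = []" "Tn (Suc m) v = Tn m (step_from (par v)) @ [par v]" for m v
    by (simp_all add: Tn_def)
  define T where "T v = Tn (d v) v" for v
  have T_v0: "T v0 = []" by (simp add: T_def \<open>d v0 = 0\<close> Tn)
  have T_par: "T v = T (step_from (par v)) @ [par v]" if "v \<in> ?R - {v0}" for v
    using par[OF that] by (simp add: T_def Tn)
  \<comment> \<open>An edge determines its pair of ends, hence the distance of the further one.\<close>
  have ends_eq: "{step_from s, step_to s} = {step_from s', step_to s'}" if "fst s = fst s'" for s s' :: "('a, 'b) edge \<times> bool"
    using that by (auto simp: step_from_def step_to_def)
  let ?P = "(fst \<circ> par) ` (?R - {v0})"
  have T: "walk E v0 (T v) v \<and> distinct (map fst (T v)) \<and> fst ` set (T v) \<subseteq> ?P \<and>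
      (\<forall>s\<in>set (T v). d (step_to s) \<le> d v \<and> d (step_from s) < d (step_to s))" if "v \<in> ?R" for v
    using that
  proof (induction "d v" arbitrary: v)
    case 0
    then have "v = v0" using d_zero by simp
    then show ?case using T_v0 by simp
  next
    case (Suc k)
    then have v: "v \<in> ?R - {v0}" using \<open>d v0 = 0\<close> by auto
    let ?u = "step_from (par v)"
    have u: "?u \<in> ?R" "d ?u = k" using par[OF v] Suc.hyps by auto
    note IH = Suc.hyps(1)[OF u(2)[symmetric] u(1)]
    have "fst s \<noteq> fst (par v)" if s: "s \<in> set (T ?u)" for s
    proof
      assume "fst s = fst (par v)"
      then have "v \<in> {step_from s, step_to s}" using ends_eq[of s "par v"] par[OF v] by auto
      then have "d v \<le> d (step_to s)" using IH s by auto
      then show False using IH s u(2) Suc.hyps(2) by auto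
    qed
    then have "fst (par v) \<notin> set (map fst (T ?u))" by (metis imageE list.set_map)
    then have "distinct (map fst (T v))" using IH T_par[OF v] by simp
    moreover have "walk E v0 (T v) v" using IH T_par[OF v] par[OF v] by (auto simp: walk_append)
    moreover have "\<forall>s\<in>set (T v). d (step_to s) \<le> d v \<and> d (step_from s) < d (step_to s)"
      using IH T_par[OF v] par[OF v] u(2) Suc.hyps(2) by fastforce
    moreover have "fst (par v) \<in> ?P" using v by (metis comp_apply imageI)
    then have "fst ` set (T v) \<subseteq> ?P" using IH T_par[OF v] by simp
    ultimately show ?case by blast
  qed
  have "inj_on (fst \<circ> par) (?R - {v0})"
  proof (rule inj_onI)
    fix v w assume vw: "v \<in> ?R - {v0}" "w \<in> ?R - {v0}" "(fst \<circ> par) v = (fst \<circ> par) w"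
    then have "{step_from (par v), step_to (par v)} = {step_from (par w), step_to (par w)}"
      using ends_eq[of "par v" "par w"] by simp
    then have "{step_from (par v), v} = {step_from (par w), w}"
      using par[OF vw(1)] par[OF vw(2)] by simp
    moreover have "d (step_from (par v)) < d v" "d (step_from (par w)) < d w"
      using par[OF vw(1)] par[OF vw(2)] by auto
    ultimately show "v = w" by (metis doubleton_eq_iff less_asym)
  qed
  then have bij: "bij_betw (fst \<circ> par) (?R - {v0}) ?P" by (simp add: bij_betw_def)
  have "\<exists>b. T (step_to (e, b)) = T (step_from (e, b)) @ [(e, b)]" if e: "e \<in> ?P" for e
  proof -
    obtain v where v: "v \<in> ?R - {v0}" "e = fst (par v)" using e by auto
    then have "par v = (e, snd (par v))" by (simp add: prod_eq_iff)
    then show ?thesis using T_par[OF v(1)] par[OF v(1)] by metis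
  qed
  moreover have "?P \<subseteq> E" using par by (simp add: image_subset_iff)
  ultimately have "spanning_tree E v0 ?P T"
    unfolding spanning_tree_def using bij T T_v0 by blast
  then show ?thesis by blast
qed

definition tree_loop ::
  "('v \<Rightarrow> (('v, 'i) edge \<times> bool) list) \<Rightarrow> ('v, 'i) edge \<Rightarrow> (('v, 'i) edge \<times> bool) list" where
  "tree_loop T e = T (source e) @ [(e, True)] @ inv_word (T (target e))"

lemma walk_tree_loop:
  assumes "spanning_tree E v0 P T" and "e \<in> E" and "source e \<in> reachable E v0"
  shows "walk E v0 (tree_loop T e) v0"
proof -
  have "target e \<in> reachable E v0"
    using assms reachable_ends[of "source e" "lab e" "target e" E v0] by simp
  then have "walk E v0 (T (source e)) (source e)" "walk E v0 (T (target e)) (target e)"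
    using assms by (auto simp: spanning_tree_def)
  then show ?thesis
    using assms(2) walk_inv_word unfolding tree_loop_def walk_append by fastforce
qed

lemma distinct_count_list_le: "distinct xs \<Longrightarrow> count_list xs x \<le> 1"
  by (induction xs) auto

lemma count_tree_loop:
  assumes "spanning_tree E v0 P T" and "e \<in> E" and "source e \<in> reachable E v0"
  shows "count_list (map fst (tree_loop T e)) e' \<le> 3"
proof -
  have "target e \<in> reachable E v0"
    using assms reachable_ends[of "source e" "lab e" "target e" E v0] by simp
  then have "distinct (map fst (T (source e)))" "distinct (map fst (T (target e)))"
    using assms by (auto simp: spanning_tree_def)
  then have "count_list (map fst (T (source e))) e' \<le> 1" "count_list (map fst (T (target e))) e' \<le> 1"
    by (simp_all only: distinct_count_list_le)
  then show ?thesis by (auto simp: tree_loop_def map_fst_inv_word)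
qed

lemma card_spanning_tree:
  assumes "spanning_tree E v0 P T" and "finite (reachable E v0)"
  shows "Suc (card P) = card (reachable E v0)" "finite P"
proof -
  obtain f where f: "bij_betw f (reachable E v0 - {v0}) P"
    using assms by (auto simp: spanning_tree_def)
  then have "card P = card (reachable E v0 - {v0})" by (simp add: bij_betw_same_card)
  then show "Suc (card P) = card (reachable E v0)"
    using assms(2) reachable_refl[of v0 E]
    by (metis card_Suc_Diff1)
  show "finite P" using f assms(2) bij_betw_finite by blast
qed

lemma tree_edge_not_loop: "spanning_tree E v0 P T \<Longrightarrow> e \<in> P \<Longrightarrow> source e \<noteq> target e"
  unfolding spanning_tree_def step_from_def step_to_def
  by (metis append_self_conv fst_conv not_Cons_self2)

context free_group
begin

abbreviation walk_val :: "(('v, 'i) edge \<times> bool) list \<Rightarrow> 'a" where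
  "walk_val c \<equiv> word_val F (\<lambda>e. a (lab e)) c"

definition tree_gen :: "('v \<Rightarrow> (('v, 'i) edge \<times> bool) list) \<Rightarrow> ('v, 'i) edge \<Rightarrow> 'a" where
  "tree_gen T e = walk_val (tree_loop T e)"

lemma walk_labels_closed:
  "walk E u c v \<Longrightarrow> lab ` E \<subseteq> I \<Longrightarrow> (\<lambda>e. a (lab e)) ` fst ` set c \<subseteq> carrier F"
  using walk_edges[of E u c v] by blast

lemma walk_val_closed: "walk E u c v \<Longrightarrow> lab ` E \<subseteq> I \<Longrightarrow> walk_val c \<in> carrier F"
  by (rule word_val_closed) (rule walk_labels_closed)

lemma walk_val_append:
  assumes "walk E u c m" "walk E m d v" "lab ` E \<subseteq> I"
  shows "walk_val (c @ d) = walk_val c \<otimes> walk_val d"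
  by (rule word_val_append[OF walk_labels_closed[OF assms(1,3)] walk_labels_closed[OF assms(2,3)]])

lemma walk_val_inv_word:
  assumes "walk E u c v" "lab ` E \<subseteq> I"
  shows "walk_val (inv_word c) = inv (walk_val c)"
  by (rule word_val_inv_word[OF walk_labels_closed[OF assms]])

lemma tree_gen_eq:
  assumes "spanning_tree E v0 P T" and "e \<in> E" and "source e \<in> reachable E v0" and "lab ` E \<subseteq> I"
  shows "tree_gen T e = walk_val (T (source e)) \<otimes> a (lab e) \<otimes> inv (walk_val (T (target e)))"
proof -
  have "target e \<in> reachable E v0"
    using assms reachable_ends[of "source e" "lab e" "target e" E v0] by simp
  then have T: "walk E v0 (T (source e)) (source e)" "walk E v0 (T (target e)) (target e)"
    using assms by (auto simp: spanning_tree_def)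
  have e: "walk E (source e) [(e, True)] (target e)" using assms(2) by simp
  have "a (lab e) \<in> carrier F" using assms by auto
  moreover have "tree_gen T e = walk_val (T (source e)) \<otimes> (walk_val [(e, True)] \<otimes> inv (walk_val (T (target e))))"
    unfolding tree_gen_def tree_loop_def
    using T e assms(4) walk_inv_word[OF T(2)]
    by (subst walk_val_append[of E v0 _ "source e" _ v0])
       (auto simp: walk_append walk_val_append[of E "source e" _ "target e" _ v0]
         walk_val_inv_word[of E v0 _ "target e"] simp del: append.simps)
  ultimately show ?thesis
    using walk_val_closed[OF T(1) assms(4)] walk_val_closed[OF T(2) assms(4)] by (simp add: m_assoc)
qed

lemma tree_gen_closed:
  assumes "spanning_tree E v0 P T" and "e \<in> E" and "source e \<in> reachable E v0" and "lab ` E \<subseteq> I"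
  shows "tree_gen T e \<in> carrier F"
  unfolding tree_gen_def by (rule walk_val_closed[OF walk_tree_loop[OF assms(1-3)] assms(4)])

lemma tree_gen_tree_edge:
  assumes st: "spanning_tree E v0 P T" and "e \<in> P" and "source e \<in> reachable E v0" and l: "lab ` E \<subseteq> I"
  shows "tree_gen T e = \<one>"
proof -
  have e: "e \<in> E" using assms by (auto simp: spanning_tree_def)
  have tr: "target e \<in> reachable E v0"
    using assms e reachable_ends[of "source e" "lab e" "target e" E v0] by simp
  then have T: "walk E v0 (T (source e)) (source e)" "walk E v0 (T (target e)) (target e)"
    using assms by (auto simp: spanning_tree_def)
  note cl = walk_val_closed[OF T(1) l] walk_val_closed[OF T(2) l]
  have ai: "a (lab e) \<in> carrier F" using e l by auto
  obtain b where b: "T (step_to (e, b)) = T (step_from (e, b)) @ [(e, b)]"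
    using st \<open>e \<in> P\<close> by (auto simp: spanning_tree_def)
  have "walk_val (T (source e)) \<otimes> a (lab e) = walk_val (T (target e))"
  proof (cases b)
    case True
    then have "walk_val (T (target e)) = walk_val (T (source e)) \<otimes> walk_val [(e, True)]"
      using b T e walk_val_append[OF T(1), of "[(e, True)]" "target e"] l by simp
    then show ?thesis using ai by simp
  next
    case False
    then have "walk_val (T (source e)) = walk_val (T (target e)) \<otimes> walk_val [(e, False)]"
      using b T e walk_val_append[OF T(2), of "[(e, False)]" "source e"] l by simp
    then show ?thesis using ai cl by (simp add: m_assoc)
  qed
  then show ?thesis using tree_gen_eq[OF st e assms(3) l] cl by simp
qed

text \<open>The tree walks telescope: each step \<open>e\<close> of the walk contributes
  \<open>t(source e) \<cdot> a(lab e) \<cdot> t(target e)\<inverse>\<close>, where \<open>t(v)\<close> is the value of the tree walk to \<open>v\<close>.\<close>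

lemma walk_val_tree_gens:
  assumes st: "spanning_tree E v0 P T" and l: "lab ` E \<subseteq> I"
    and "walk E u c v" and "u \<in> reachable E v0"
  shows "walk_val (T u) \<otimes> walk_val c = word_val F (tree_gen T) c \<otimes> walk_val (T v)"
  using assms(3,4)
proof (induction c arbitrary: u)
  case Nil
  then have "walk E v0 (T u) u" using st by (auto simp: spanning_tree_def)
  then show ?case using Nil walk_val_closed[OF _ l] by simp
next
  case (Cons s c)
  obtain e b where s: "s = (e, b)" by fastforce
  have e: "e \<in> E" and u: "u = step_from s" and c: "walk E (step_to s) c v" using Cons.prems s by auto
  have rr: "source e \<in> reachable E v0 \<longleftrightarrow> target e \<in> reachable E v0"
    using e reachable_ends[of "source e" "lab e" "target e" E v0] by simp
  then have r: "source e \<in> reachable E v0" "target e \<in> reachable E v0"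
    using Cons.prems u s by (cases b; simp)+
  then have m: "step_to s \<in> reachable E v0" using s by (cases b) auto
  have T: "walk_val (T (source e)) \<in> carrier F" "walk_val (T (target e)) \<in> carrier F"
    using st r walk_val_closed[OF _ l] by (auto simp: spanning_tree_def)
  have v: "v \<in> reachable E v0" using reachable_walk[OF m c] .
  have Tv: "walk_val (T v) \<in> carrier F" using st v walk_val_closed[OF _ l] by (auto simp: spanning_tree_def)
  have g: "tree_gen T e \<in> carrier F" using tree_gen_closed[OF st e r(1) l] .
  have gc: "word_val F (tree_gen T) c \<in> carrier F"
  proof (rule word_val_closed, rule image_subsetI)
    fix e' assume "e' \<in> fst ` set c"
    then obtain b' where "(e', b') \<in> set c" by force
    then obtain c1 c2 where "c = c1 @ (e', b') # c2" by (meson split_list)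
    then have "walk E (step_to s) c1 (step_from (e', b'))" "e' \<in> E" using c by (auto simp: walk_append)
    then have "step_from (e', b') \<in> reachable E v0" using reachable_walk m by metis
    then have "source e' \<in> reachable E v0"
      using reachable_ends[of "source e'" "lab e'" "target e'" E v0] \<open>e' \<in> E\<close> by (cases b') auto
    then show "tree_gen T e' \<in> carrier F" using tree_gen_closed[OF st \<open>e' \<in> E\<close> _ l] by simp
  qed
  have ai: "a (lab e) \<in> carrier F" using e l by auto
  have wc: "walk_val c \<in> carrier F" using walk_val_closed[OF c l] .
  note IH = Cons.IH[OF c m]
  have step: "walk_val (T u) \<otimes> letter_val F (\<lambda>e. a (lab e)) s
      = letter_val F (tree_gen T) s \<otimes> walk_val (T (step_to s))"
  proof (cases b)
    case True
    then show ?thesis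
      using T ai s u tree_gen_eq[OF st e r(1) l] by (simp add: letter_val_def m_assoc)
  next
    case False
    then show ?thesis
      using T ai s u tree_gen_eq[OF st e r(1) l]
      by (simp add: letter_val_def m_assoc inv_mult_group)
  qed
  have ls: "letter_val F (\<lambda>e. a (lab e)) s \<in> carrier F" "letter_val F (tree_gen T) s \<in> carrier F"
    using s ai g by (auto intro: letter_val_closed)
  have Tu: "walk_val (T u) \<in> carrier F" "walk_val (T (step_to s)) \<in> carrier F"
    using u s T by (cases b; simp)+
  have "walk_val (T u) \<otimes> walk_val (s # c) = (walk_val (T u) \<otimes> letter_val F (\<lambda>e. a (lab e)) s) \<otimes> walk_val c"
    using Tu ls wc by (simp add: word_val_Cons m_assoc)
  also have "\<dots> = letter_val F (tree_gen T) s \<otimes> (walk_val (T (step_to s)) \<otimes> walk_val c)"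
    unfolding step using Tu ls wc by (simp add: m_assoc)
  also have "\<dots> = word_val F (tree_gen T) (s # c) \<otimes> walk_val (T v)"
    unfolding IH using Tv ls gc by (simp add: word_val_Cons m_assoc)
  finally show ?case .
qed

text \<open>Since the generators of tree edges are trivial, the length of a closed walk in the tree
  generators is its number of crossings of edges outside the tree. All length bounds below come from
  this formula.\<close>

theorem closed_walk_val:
  assumes st: "spanning_tree E v0 P T" and l: "lab ` E \<subseteq> I"
    and E: "source ` E \<subseteq> reachable E v0"
    and "walk E v0 c v0"
  shows "walk_val c = word_val F (tree_gen T) (filter (\<lambda>s. fst s \<in> E - P) c)"
proof -
  have c: "fst ` set c \<subseteq> E" using walk_edges[OF assms(4)] .
  have g: "tree_gen T ` fst ` set c \<subseteq> carrier F" using tree_gen_closed[OF st _ _ l] c E by blast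
  have "word_val F (tree_gen T) (filter (\<lambda>s. fst s \<in> E - P) c) = word_val F (tree_gen T) c"
  proof (rule word_val_filter[OF g])
    fix e assume "e \<in> fst ` set c" "e \<notin> E - P"
    then show "tree_gen T e = \<one>" using c E tree_gen_tree_edge[OF st _ _ l] by blast
  qed
  moreover have "T v0 = []" using st by (simp add: spanning_tree_def)
  ultimately show ?thesis
    using walk_val_tree_gens[OF st l assms(4) reachable_refl] walk_val_closed[OF assms(4) l]
      word_val_closed[OF g] by simp
qed

end

section \<open>Generating tuples of a free group of the same size are bases\<close>

text \<open>Stallings' condition: every label acts on the vertices by a partial bijection.\<close>

definition folded :: "('v, 'i) edge set \<Rightarrow> bool" where
  "folded E \<longleftrightarrow>
     (\<forall>p i q q'. (p, i, q) \<in> E \<longrightarrow> (p, i, q') \<in> E \<longrightarrow> q = q') \<and>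
     (\<forall>p p' i q. (p, i, q) \<in> E \<longrightarrow> (p', i, q) \<in> E \<longrightarrow> p = p')"

lemma Bij_extends_inj_on:
  assumes "finite V" "A \<subseteq> V" "f ` A \<subseteq> V" "inj_on f A"
  obtains g where "g \<in> Bij V" "\<And>x. x \<in> A \<Longrightarrow> g x = f x"
proof -
  have fin: "finite A" "finite (f ` A)" using assms finite_subset by blast+
  have "card (V - A) = card (V - f ` A)"
    using assms fin by (simp add: card_Diff_subset card_image)
  then obtain h where h: "bij_betw h (V - A) (V - f ` A)"
    using assms(1) finite_same_card_bij by (metis finite_Diff)
  define g where "g = (\<lambda>x\<in>V. if x \<in> A then f x else h x)"
  have "bij_betw g A (f ` A)"
    using assms(2,4) by (auto simp: g_def bij_betw_def inj_on_def)
  moreover have "bij_betw g (V - A) (V - f ` A)"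
    using h by (subst bij_betw_cong[where g = h]) (auto simp: g_def)
  ultimately have "bij_betw g (A \<union> (V - A)) (f ` A \<union> (V - f ` A))"
    by (rule bij_betw_combine) auto
  moreover have "A \<union> (V - A) = V" "f ` A \<union> (V - f ` A) = V" using assms by auto
  ultimately have "g \<in> Bij V" by (simp add: Bij_def g_def)
  moreover have "g x = f x" if "x \<in> A" for x using that assms(2) by (auto simp: g_def)
  ultimately show ?thesis using that by blast
qed

lemma mult_BijGroup: "g \<in> Bij S \<Longrightarrow> f \<in> Bij S \<Longrightarrow> g \<otimes>\<^bsub>BijGroup S\<^esub> f = compose S g f"
  and carrier_BijGroup: "carrier (BijGroup S) = Bij S"
  and one_BijGroup: "\<one>\<^bsub>BijGroup S\<^esub> = (\<lambda>x\<in>S. x)"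
  by (simp_all add: BijGroup_def)

lemma finite_Bij: "finite S \<Longrightarrow> finite (Bij S)"
proof (rule finite_subset)
  show "Bij S \<subseteq> (S \<rightarrow>\<^sub>E S)"
    using Bij_imp_funcset Bij_imp_extensional by (auto simp: PiE_def)
qed (simp add: finite_PiE)

lemma walk_end_in:
  assumes "walk E u c v" "u \<in> V" "E \<subseteq> V \<times> I \<times> V"
  shows "v \<in> V"
  using assms(1,2)
proof (induction c arbitrary: u)
  case (Cons s c)
  then have "fst s \<in> E" "walk E (step_to s) c v" by auto
  moreover have "step_to s \<in> V" using \<open>fst s \<in> E\<close> assms(3) by (auto simp: step_to_def)
  ultimately show ?case using Cons.IH by blast
qed simp

context free_group
begin

text \<open>Letters act as functions on the left, so a walk is traced backwards: its value takes its end
  to its beginning.\<close>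

lemma walk_val_acts:
  assumes h: "h \<in> hom F (BijGroup V)" and E: "E \<subseteq> V \<times> I \<times> V"
    and act: "\<And>p i q. (p, i, q) \<in> E \<Longrightarrow> h (a i) q = p"
    and "walk E u c v" "u \<in> V"
  shows "h (walk_val c) v = u"
  using assms(4,5)
proof (induction c arbitrary: u)
  case Nil
  then show ?case
    using hom_one[OF h _ group_BijGroup] is_group by (simp add: one_BijGroup)
next
  case (Cons s c)
  obtain e b where s: "s = (e, b)" by fastforce
  obtain p i q where e: "e = (p, i, q)" by (cases e)
  have E': "(p, i, q) \<in> E" and u: "u = step_from s" and c: "walk E (step_to s) c v"
    using Cons.prems s e by auto
  have pq: "p \<in> V" "i \<in> I" "q \<in> V" using E' E by auto
  then have m: "step_to s \<in> V" using s e by (cases b) auto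
  have l: "lab ` E \<subseteq> I" using E by auto
  have cl: "walk_val c \<in> carrier F" using walk_val_closed[OF c l] .
  have v: "v \<in> V" using walk_end_in[OF c m E] .
  have hB: "h x \<in> Bij V" if "x \<in> carrier F" for x
    using hom_carrier[OF h] that by (auto simp: carrier_BijGroup)
  have hm: "h (x \<otimes> y) w = h x (h y w)" if "x \<in> carrier F" "y \<in> carrier F" "w \<in> V" for x y w
    using hom_mult[OF h that(1,2)] hB that by (simp add: mult_BijGroup compose_eq)
  have ai: "a i \<in> carrier F" using pq by simp
  note IH = Cons.IH[OF c m]
  show ?case
  proof (cases b)
    case True
    then show ?thesis using IH hm[OF ai cl v] s e u act[OF E'] by simp
  next
    case False
    have "h (inv (a i)) p = h (inv (a i) \<otimes> a i) q"
      using hm[of "inv (a i)" "a i" q] ai pq act[OF E'] by simp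
    also have "\<dots> = q"
      using ai pq hom_one[OF h is_group group_BijGroup] by (simp add: one_BijGroup)
    finally show ?thesis using False IH hm[of "inv (a i)", OF _ cl v] ai s e u by simp
  qed
qed

text \<open>A finite folded graph is a partial permutation representation; completing the partial
  permutations arbitrarily gives an action of the free group that traces its walks.\<close>

lemma folded_graph_action:
  assumes "finite V" "E \<subseteq> V \<times> I \<times> V" "folded E"
  obtains h where "h \<in> hom F (BijGroup V)"
    "\<And>u c v. walk E u c v \<Longrightarrow> u \<in> V \<Longrightarrow> h (walk_val c) v = u"
    "\<And>p i q. (p, i, q) \<in> E \<Longrightarrow> h (a i) q = p"
proof -
  have "\<exists>g. g \<in> Bij V \<and> (\<forall>p q. (p, i, q) \<in> E \<longrightarrow> g q = p)" for i
  proof -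
    let ?A = "{q. \<exists>p. (p, i, q) \<in> E}"
    define f where "f q = (THE p. (p, i, q) \<in> E)" for q
    have f: "f q = p" if "(p, i, q) \<in> E" for p q
      unfolding f_def by (rule the_equality) (use that assms(3) in \<open>auto simp: folded_def\<close>)
    have "inj_on f ?A"
    proof (rule inj_onI)
      fix x y assume "x \<in> ?A" "y \<in> ?A" "f x = f y"
      then obtain p where "(p, i, x) \<in> E" "(p, i, y) \<in> E" using f by fastforce
      then show "x = y" using assms(3) by (auto simp: folded_def)
    qed
    moreover have "?A \<subseteq> V" "f ` ?A \<subseteq> V" using assms(2) f by fastforce+
    ultimately obtain g where "g \<in> Bij V" "\<And>x. x \<in> ?A \<Longrightarrow> g x = f x"
      using Bij_extends_inj_on[OF assms(1), of ?A f] by blast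
    then show ?thesis using f by blast
  qed
  then obtain g where g: "\<And>i. g i \<in> Bij V" "\<And>i p q. (p, i, q) \<in> E \<Longrightarrow> g i q = p" by metis
  have "g ` I \<subseteq> carrier (BijGroup V)" using g(1) by (auto simp: carrier_BijGroup)
  then obtain h where h: "h \<in> hom F (BijGroup V)" "\<And>i. i \<in> I \<Longrightarrow> h (a i) = g i"
    using hom_extension[OF group_BijGroup] by metis
  have act: "h (a i) q = p" if "(p, i, q) \<in> E" for p i q
    using h(2) g(2) that assms(2) by auto
  show ?thesis
    using that[OF h(1)] walk_val_acts[OF h(1) assms(2) act] act by blast
qed

text \<open>Residual finiteness: a reduced word, drawn as a segment, is a folded graph, and its value
  moves one end of the segment to the other.\<close>

theorem residually_finite:
  assumes "x \<in> carrier F" "x \<noteq> \<one>"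
  obtains m :: nat and h where "h \<in> hom F (BijGroup {..m})" "h x \<noteq> \<one>\<^bsub>BijGroup {..m}\<^esub>"
proof -
  obtain w where w: "fst ` set w \<subseteq> I" "word_val F a w = x"
    and shortest: "\<And>w'. fst ` set w' \<subseteq> I \<Longrightarrow> word_val F a w' = x \<Longrightarrow> length w \<le> length w'"
  proof -
    obtain w0 where w0: "fst ` set w0 \<subseteq> I \<and> word_val F a w0 = x"
      using ex_word_val assms(1) by blast
    from that show ?thesis
      using ex_has_least_nat[of "\<lambda>w. fst ` set w \<subseteq> I \<and> word_val F a w = x", OF w0, of length] by blast
  qed
  have red: "reduced_word w"
  proof (rule ccontr)
    assume "\<not> reduced_word w"
    then obtain u i e v where uv: "w = u @ [(i, e), (i, \<not> e)] @ v" by (rule not_reduced_wordE)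
    then have "a ` fst ` set w \<subseteq> carrier F" using w(1) basis_closed by blast
    then have "word_val F a (u @ v) = x" using word_val_cancel[of a u i e v] w uv by simp
    then have "length w \<le> length (u @ v)" using w(1) uv by (intro shortest) auto
    then show False using uv by simp
  qed
  let ?m = "length w"
  define edge where "edge p = (if snd (w ! p) then (p, fst (w ! p), Suc p) else (Suc p, fst (w ! p), p))" for p
  let ?E = "edge ` {..<?m}"
  have no_cancel: "\<not> (fst (w ! p) = fst (w ! Suc p) \<and> snd (w ! p) \<noteq> snd (w ! Suc p))"
    if "Suc p < ?m" for p
    using successively_nth[OF red[unfolded reduced_word_def] that] .
  have fold: "folded ?E"
    unfolding folded_def
  proof (intro conjI allI impI)
    fix p i q q' assume "(p, i, q) \<in> ?E" "(p, i, q') \<in> ?E"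
    then show "q = q'" using no_cancel by (auto simp: edge_def split: if_splits)
  next
    fix p p' i q assume "(p, i, q) \<in> ?E" "(p', i, q) \<in> ?E"
    then show "p = p'" using no_cancel by (auto simp: edge_def split: if_splits)
  qed
  have E: "?E \<subseteq> {..?m} \<times> I \<times> {..?m}"
  proof -
    have "fst (w ! p) \<in> I" if "p < ?m" for p using w(1) nth_mem[OF that] by blast
    then show ?thesis by (auto simp: edge_def)
  qed
  obtain h where h: "h \<in> hom F (BijGroup {..?m})"
    "\<And>u c v. walk ?E u c v \<Longrightarrow> u \<in> {..?m} \<Longrightarrow> h (walk_val c) v = u"
    by (rule folded_graph_action[OF finite_atMost E fold]) (rule that)
  define c where "c = map (\<lambda>p. (edge p, snd (w ! p))) [0..<?m]"
  have "walk ?E 0 (take k c) k" if "k \<le> ?m" for k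
    using that
  proof (induction k)
    case (Suc k)
    have "walk ?E k [c ! k] (Suc k)"
      using Suc.prems by (auto simp: c_def edge_def step_from_def step_to_def)
    then show ?case using Suc by (simp add: c_def take_Suc_conv_app_nth walk_append del: walk.simps) blast
  qed simp
  then have c: "walk ?E 0 c ?m" by (metis c_def order_refl length_map length_upt minus_nat.diff_0 take_all)
  have "map (\<lambda>(e, b). (lab e, b)) c = w"
    by (rule nth_equalityI) (auto simp: c_def edge_def prod_eq_iff)
  then have "walk_val c = x" using word_val_map[of F a lab c] w(2) by (simp add: comp_def)
  then have "h x ?m = 0" using h(2)[OF c] by simp
  moreover have "?m \<noteq> 0" using w assms(2) by auto
  ultimately have "h x \<noteq> \<one>\<^bsub>BijGroup {..?m}\<^esub>" by (auto simp: one_BijGroup)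
  then show ?thesis using that h(1) by blast
qed

lemma automorphism_closed [simp, intro]: "\<alpha> \<in> auto F \<Longrightarrow> x \<in> carrier F \<Longrightarrow> \<alpha> x \<in> carrier F"
  unfolding auto_def using hom_in_carrier by fastforce

lemma automorphisms_eqI:
  assumes "\<alpha> \<in> auto F" "\<beta> \<in> auto F" "\<And>i. i \<in> I \<Longrightarrow> \<alpha> (a i) = \<beta> (a i)"
  shows "\<alpha> = \<beta>"
proof (rule extensionalityI[of _ "carrier F"])
  show "\<alpha> \<in> extensional (carrier F)" "\<beta> \<in> extensional (carrier F)"
    using assms by (auto simp: auto_def Bij_def)
  fix x assume "x \<in> carrier F"
  then show "\<alpha> x = \<beta> x"
    using homs_agree_on_generate[OF is_group is_group, of \<alpha> \<beta> "a ` I" x] assms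
      generate_basis basis_closed by (auto simp: auto_def)
qed

text \<open>Free groups of finite rank are Hopfian. An epimorphism pulls back homomorphisms into a finite
  group injectively, hence surjectively since there are only finitely many of them; so every
  finite quotient of \<open>F\<close> kills its kernel, which is trivial by residual finiteness.\<close>

theorem generating_tuple_automorphism:
  assumes "finite I" and g: "g ` I \<subseteq> carrier F" and gen: "generate F (g ` I) = carrier F"
  obtains \<alpha> where "\<alpha> \<in> auto F" "\<And>i. i \<in> I \<Longrightarrow> \<alpha> (a i) = g i"
proof -
  obtain \<epsilon> where eps: "\<epsilon> \<in> hom F F" "\<And>i. i \<in> I \<Longrightarrow> \<epsilon> (a i) = g i"
    and epsw: "\<And>w. fst ` set w \<subseteq> I \<Longrightarrow> \<epsilon> (word_val F a w) = word_val F g w"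
    using hom_extension[OF is_group g] by blast
  interpret eps: group_hom F F \<epsilon>
    using eps by (simp add: group_hom_def group_hom_axioms_def)
  have surj: "\<epsilon> ` carrier F = carrier F"
  proof
    show "carrier F \<subseteq> \<epsilon> ` carrier F"
    proof
      fix x assume "x \<in> carrier F"
      then obtain w where "fst ` set w \<subseteq> I" "word_val F g w = x"
        using gen generate_word_val[OF g] by auto
      then show "x \<in> \<epsilon> ` carrier F" using epsw by (metis imageI word_val_basis_closed)
    qed
  qed auto
  have "x = \<one>" if x: "x \<in> carrier F" "\<epsilon> x = \<one>" for x
  proof (rule ccontr)
    assume "x \<noteq> \<one>"
    then obtain m :: nat and \<rho> where rho: "\<rho> \<in> hom F (BijGroup {..m})" "\<rho> x \<noteq> \<one>\<^bsub>BijGroup {..m}\<^esub>"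
      using residually_finite x by blast
    let ?Q = "BijGroup {..m}"
    interpret Q: group ?Q by (rule group_BijGroup)
    let ?Tuples = "I \<rightarrow>\<^sub>E carrier ?Q"
    have "\<exists>h. h \<in> hom F ?Q \<and> (\<forall>i\<in>I. h (a i) = s i)" if "s \<in> ?Tuples" for s
    proof -
      have "s ` I \<subseteq> carrier ?Q" using that by auto
      then show ?thesis using hom_extension[OF group_BijGroup] by metis
    qed
    then obtain ext where ext: "\<And>s. s \<in> ?Tuples \<Longrightarrow> ext s \<in> hom F ?Q"
      "\<And>s i. s \<in> ?Tuples \<Longrightarrow> i \<in> I \<Longrightarrow> ext s (a i) = s i" by metis
    define pull where "pull s = (\<lambda>i\<in>I. ext s (g i))" for s
    have fin: "finite ?Tuples"
      using assms(1) by (simp add: finite_PiE carrier_BijGroup finite_Bij)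
    have into: "pull ` ?Tuples \<subseteq> ?Tuples"
    proof (rule image_subsetI)
      fix s assume s: "s \<in> ?Tuples"
      have "ext s (g i) \<in> carrier ?Q" if "i \<in> I" for i
        by (rule hom_in_carrier[OF ext(1)[OF s]]) (use that g in auto)
      then show "pull s \<in> ?Tuples" by (simp add: pull_def)
    qed
    have "inj_on pull ?Tuples"
    proof (rule inj_onI)
      fix s t assume st: "s \<in> ?Tuples" "t \<in> ?Tuples" "pull s = pull t"
      have "ext s y = ext t y" if "y \<in> carrier F" for y
      proof (rule homs_agree_on_generate[OF is_group group_BijGroup ext(1)[OF st(1)] ext(1)[OF st(2)] g])
        show "y \<in> generate F (g ` I)" using gen that by simp
        fix z assume "z \<in> g ` I"
        then obtain i where "i \<in> I" "z = g i" by blast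
        then show "ext s z = ext t z" using fun_cong[OF st(3), of i] by (simp add: pull_def)
      qed
      then have "s i = t i" if "i \<in> I" for i using ext(2) st that by (metis basis_in_carrier)
      then show "s = t" using st by (meson PiE_ext)
    qed
    then have "pull ` ?Tuples = ?Tuples" using fin into by (simp add: endo_inj_surj)
    moreover have "(\<lambda>i\<in>I. \<rho> (a i)) \<in> ?Tuples" using hom_in_carrier[OF rho(1)] by simp
    ultimately obtain s where s: "s \<in> ?Tuples" "(\<lambda>i\<in>I. \<rho> (a i)) = pull s" by blast
    have "(ext s \<circ> \<epsilon>) x = \<rho> x"
    proof (rule homs_agree_on_generate[OF is_group group_BijGroup _ rho(1) basis_closed])
      show "ext s \<circ> \<epsilon> \<in> hom F ?Q" 
        using eps(1) ext(1)[OF s(1)] by (auto simp: hom_def Pi_iff)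
      show "x \<in> generate F (a ` I)" using x generate_basis by simp
      fix z assume "z \<in> a ` I"
      then obtain i where "i \<in> I" "z = a i" by blast
      then show "(ext s \<circ> \<epsilon>) z = \<rho> z" using fun_cong[OF s(2), of i] eps(2) by (simp add: pull_def)
    qed
    then show False using x rho(2) hom_one[OF ext(1)[OF s(1)] is_group group_BijGroup] by simp
  qed
  then have "inj_on \<epsilon> (carrier F)" using eps.inj_on_one_iff by blast
  then have "bij_betw \<epsilon> (carrier F) (carrier F)" using surj by (simp add: bij_betw_def)
  then have "bij_betw (restrict \<epsilon> (carrier F)) (carrier F) (carrier F)"
    by (subst bij_betw_cong[where g = \<epsilon>]) auto
  moreover have "restrict \<epsilon> (carrier F) \<in> hom F F"
    by (rule homI) auto
  ultimately have "restrict \<epsilon> (carrier F) \<in> auto F"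
    by (simp add: auto_def Bij_def)
  then show ?thesis using that eps(2) by simp
qed

section \<open>Automorphisms of bounded length\<close>

definition bounded_autos :: "nat \<Rightarrow> ('a \<Rightarrow> 'a) set" where
  "bounded_autos M =
     {\<psi> \<in> auto F. \<forall>i\<in>I. \<exists>w. length w \<le> M \<and> fst ` set w \<subseteq> I \<and> word_val F a w = \<psi> (a i)}"

lemma finite_bounded_autos:
  assumes "finite I"
  shows "finite (bounded_autos M)"
proof -
  let ?W = "{w. set w \<subseteq> I \<times> (UNIV :: bool set) \<and> length w \<le> M}"
  have fin: "finite ?W" using assms by (intro finite_lists_length_le finite_cartesian_product) auto
  let ?X = "word_val F a ` ?W"
  have "inj_on (\<lambda>\<psi>. \<lambda>i\<in>I. \<psi> (a i)) (bounded_autos M)"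
  proof (rule inj_onI)
    fix \<psi> \<chi> assume "\<psi> \<in> bounded_autos M" "\<chi> \<in> bounded_autos M"
      "(\<lambda>i\<in>I. \<psi> (a i)) = (\<lambda>i\<in>I. \<chi> (a i))"
    then show "\<psi> = \<chi>" by (intro automorphisms_eqI) (auto simp: bounded_autos_def dest: fun_cong split: if_splits)
  qed
  moreover have "(\<lambda>\<psi>. \<lambda>i\<in>I. \<psi> (a i)) ` bounded_autos M \<subseteq> I \<rightarrow>\<^sub>E ?X"
  proof -
    have "\<psi> (a i) \<in> ?X" if psi: "\<psi> \<in> bounded_autos M" and i: "i \<in> I" for \<psi> i
    proof -
      obtain w where w: "length w \<le> M" "fst ` set w \<subseteq> I" "word_val F a w = \<psi> (a i)"
        using psi i by (auto simp: bounded_autos_def)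
      have "w \<in> ?W" using w(1,2) by (auto simp: subset_iff image_iff)
      then have "word_val F a w \<in> ?X" by (rule imageI)
      then show ?thesis by (simp only: w(3))
    qed
    then show ?thesis by auto
  qed
  moreover have "finite (I \<rightarrow>\<^sub>E ?X)" using assms fin by (simp add: finite_PiE)
  ultimately show ?thesis by (rule inj_on_finite)
qed

end

section \<open>Word metrics and Lipschitz retractions\<close>

context group
begin

lemma mult_inv_cancel_left: "x \<in> carrier G \<Longrightarrow> y \<in> carrier G \<Longrightarrow> x \<otimes> (inv x \<otimes> y) = y"
  by (simp add: m_assoc[symmetric])

lemma symmetrized_closed: "S \<subseteq> carrier G \<Longrightarrow> S \<union> m_inv G ` S \<subseteq> carrier G"
  by auto

lemma word_norm_le_length:
  "set ws \<subseteq> S \<union> m_inv G ` S \<Longrightarrow> word_norm G S (list_prod G ws) \<le> length ws"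
  unfolding word_norm_def by (rule Least_le) blast

lemma word_norm_attained:
  assumes "finite_generating_set G S" "g \<in> carrier G"
  obtains ws where "set ws \<subseteq> S \<union> m_inv G ` S" "list_prod G ws = g" "length ws = word_norm G S g"
proof -
  have "S \<subseteq> carrier G" "g \<in> generate G S" using assms by (auto simp: finite_generating_set_def)
  then have "\<exists>k ws. length ws = k \<and> set ws \<subseteq> S \<union> m_inv G ` S \<and> list_prod G ws = g"
    using generate_list_prod by blast
  then have "\<exists>ws. length ws = word_norm G S g \<and> set ws \<subseteq> S \<union> m_inv G ` S \<and> list_prod G ws = g"
    unfolding word_norm_def by (rule LeastI_ex)
  then show ?thesis using that by blast
qed

lemma word_norm_mult_le:
  assumes S: "finite_generating_set G S" and "g \<in> carrier G" "h \<in> carrier G"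
  shows "word_norm G S (g \<otimes> h) \<le> word_norm G S g + word_norm G S h"
proof -
  obtain us where us: "set us \<subseteq> S \<union> m_inv G ` S" "list_prod G us = g" "length us = word_norm G S g"
    using word_norm_attained[OF S assms(2)] .
  obtain vs where vs: "set vs \<subseteq> S \<union> m_inv G ` S" "list_prod G vs = h" "length vs = word_norm G S h"
    using word_norm_attained[OF S assms(3)] .
  have sub: "S \<union> m_inv G ` S \<subseteq> carrier G" using S by (auto simp: finite_generating_set_def)
  have "list_prod G (us @ vs) = g \<otimes> h"
    using list_prod_append[OF order_trans[OF us(1) sub] order_trans[OF vs(1) sub]] us vs by simp
  moreover have "set (us @ vs) \<subseteq> S \<union> m_inv G ` S" using us vs by simp
  ultimately show ?thesis using word_norm_le_length[of "us @ vs" S] us vs by simp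
qed

lemma word_norm_one: "word_norm G S \<one> = 0"
  using word_norm_le_length[of "[]" S] by simp

lemma word_norm_list_prod_le:
  assumes S: "finite_generating_set G S" and "set vs \<subseteq> carrier G"
    and "\<And>v. v \<in> set vs \<Longrightarrow> word_norm G S v \<le> k"
  shows "word_norm G S (list_prod G vs) \<le> k * length vs"
  using assms(2,3)
proof (induction vs)
  case (Cons v vs)
  have "word_norm G S (list_prod G (v # vs)) \<le> word_norm G S v + word_norm G S (list_prod G vs)"
    using Cons.prems word_norm_mult_le[OF S, of v "list_prod G vs"] list_prod_closed[of vs] by simp
  also have "\<dots> \<le> k + k * length vs" using Cons by (intro add_mono) auto
  finally show ?case by simp
qed (simp add: word_norm_one)

text \<open>The image under \<open>\<pi>\<close> of the path from \<open>x\<close> to \<open>x s\<^sub>1 \<cdots> s\<^sub>m\<close> is a telescoping product of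
  increments.\<close>

lemma increments_along_word:
  assumes \<pi>: "\<pi> \<in> carrier G \<rightarrow> carrier G" and "x \<in> carrier G" "set ws \<subseteq> B" and B: "B \<subseteq> carrier G"
  obtains vs where "length vs = length ws" "list_prod G vs = inv \<pi> x \<otimes> \<pi> (x \<otimes> list_prod G ws)"
    "set vs \<subseteq> {inv \<pi> y \<otimes> \<pi> (y \<otimes> s) | y s. y \<in> carrier G \<and> s \<in> B}"
proof -
  let ?D = "{inv \<pi> y \<otimes> \<pi> (y \<otimes> s) | y s. y \<in> carrier G \<and> s \<in> B}"
  have "\<exists>vs. length vs = length ws \<and> list_prod G vs = inv \<pi> x \<otimes> \<pi> (x \<otimes> list_prod G ws) \<and> set vs \<subseteq> ?D"
    using assms(2,3)
  proof (induction ws arbitrary: x)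
    case Nil
    then have "\<pi> x \<in> carrier G" using \<pi> by auto
    then show ?case using Nil by simp
  next
    case (Cons s ws)
    have "set ws \<subseteq> carrier G" using Cons.prems B by auto
    then have ws: "list_prod G ws \<in> carrier G" by (rule list_prod_closed)
    have s: "s \<in> carrier G" using Cons.prems B by auto
    have c: "\<pi> x \<in> carrier G" "\<pi> (x \<otimes> s) \<in> carrier G" "\<pi> (x \<otimes> s \<otimes> list_prod G ws) \<in> carrier G"
      using \<pi> Cons.prems s ws by auto
    obtain vs where vs: "length vs = length ws" "set vs \<subseteq> ?D"
      "list_prod G vs = inv \<pi> (x \<otimes> s) \<otimes> \<pi> (x \<otimes> s \<otimes> list_prod G ws)"
      using Cons.IH[of "x \<otimes> s"] Cons.prems s by auto
    have "list_prod G ((inv \<pi> x \<otimes> \<pi> (x \<otimes> s)) # vs) = inv \<pi> x \<otimes> \<pi> (x \<otimes> list_prod G (s # ws))"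
      using c s ws Cons.prems vs(3) by (simp add: m_assoc mult_inv_cancel_left)
    moreover have "inv \<pi> x \<otimes> \<pi> (x \<otimes> s) \<in> ?D" using Cons.prems by auto
    ultimately show ?case using vs(1,2)
      by (intro exI[of _ "(inv \<pi> x \<otimes> \<pi> (x \<otimes> s)) # vs"]) simp
  qed
  then show ?thesis using that by blast
qed

end

lemma list_prod_subgroup: "list_prod (G\<lparr>carrier := H\<rparr>) ws = list_prod G ws"
  by (simp add: list_prod_def)

text \<open>The increments along a finite generating set are finitely many elements of \<open>H\<close>, so their word
  norms are bounded, whatever generating set of \<open>H\<close> is used; the telescoping product gives the
  Lipschitz estimate. The same product for a path from \<open>1\<close> to an element \<open>h\<close> of \<open>H\<close> has the value
  \<open>h\<close>, so the increments generate \<open>H\<close>.\<close>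

theorem lipschitz_retraction_finite_increments:
  assumes G: "group G" "finitely_generated G" and H: "subgroup H G"
    and \<pi>: "\<pi> \<in> carrier G \<rightarrow> H" and id: "\<And>h. h \<in> H \<Longrightarrow> \<pi> h = h"
    and fin: "\<And>s. s \<in> carrier G \<Longrightarrow>
      finite {inv\<^bsub>G\<^esub> \<pi> x \<otimes>\<^bsub>G\<^esub> \<pi> (x \<otimes>\<^bsub>G\<^esub> s) | x. x \<in> carrier G}"
  shows "lipschitz_retraction G H \<pi>"
proof -
  interpret group G by fact
  let ?H = "G\<lparr>carrier := H\<rparr>"
  interpret GH: group ?H using H by (simp add: subgroup.subgroup_is_group G)
  note HG = subgroup.subset[OF H]
  define incr where "incr S = {inv\<^bsub>G\<^esub> \<pi> x \<otimes>\<^bsub>G\<^esub> \<pi> (x \<otimes>\<^bsub>G\<^esub> s) | x s. x \<in> carrier G \<and> s \<in> S \<union> m_inv G ` S}" for S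
  have fin_incr: "finite (incr S)" if "finite S" "S \<subseteq> carrier G" for S
  proof -
    have "incr S = (\<Union>s\<in>S \<union> m_inv G ` S. {inv\<^bsub>G\<^esub> \<pi> x \<otimes>\<^bsub>G\<^esub> \<pi> (x \<otimes>\<^bsub>G\<^esub> s) | x. x \<in> carrier G})"
      by (auto simp: incr_def)
    then show ?thesis using that fin by auto
  qed
  have piH: "\<pi> x \<in> H" if "x \<in> carrier G" for x using that \<pi> by auto
  have incr_H: "incr S \<subseteq> H" if "S \<subseteq> carrier G" for S
    using that H piH by (auto simp: incr_def intro!: subgroup.m_closed[OF H] subgroup.m_inv_closed[OF H])
  have incr_G: "incr S \<subseteq> carrier G" if "S \<subseteq> carrier G" for S
    using incr_H[OF that] HG by blast
  have piG: "\<pi> \<in> carrier G \<rightarrow> carrier G" using piH HG by auto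
  have "finitely_generated ?H"
  proof -
    obtain S where S: "finite_generating_set G S" using G by (auto simp: finitely_generated_def)
    then have S': "finite S" "S \<subseteq> carrier G" "generate G S = carrier G"
      by (auto simp: finite_generating_set_def)
    have "h \<in> generate G (incr S)" if "h \<in> H" for h
    proof -
      have "h \<in> generate G S" using that HG S' by auto
      then obtain ws where ws: "set ws \<subseteq> S \<union> m_inv G ` S" "list_prod G ws = h"
        using generate_list_prod S'(2) by blast
      have "h \<in> carrier G" "\<one>\<^bsub>G\<^esub> \<in> H" using that HG H by (auto simp: subgroup.one_closed)
      moreover obtain vs where "set vs \<subseteq> incr S"
        "list_prod G vs = inv\<^bsub>G\<^esub> \<pi> \<one>\<^bsub>G\<^esub> \<otimes>\<^bsub>G\<^esub> \<pi> (\<one>\<^bsub>G\<^esub> \<otimes>\<^bsub>G\<^esub> list_prod G ws)"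
        by (rule increments_along_word[OF piG one_closed ws(1) symmetrized_closed[OF S'(2)], folded incr_def])
      ultimately have "list_prod G vs = h" "set vs \<subseteq> incr S" using ws(2) id that by auto
      then show ?thesis using generate_list_prod[OF incr_G[OF S'(2)]] by blast
    qed
    moreover have "generate G (incr S) \<subseteq> H"
      by (rule generate_subgroup_incl[OF incr_H[OF S'(2)] H])
    ultimately have "generate ?H (incr S) = H"
      using generate_consistent[OF incr_H[OF S'(2)] H] by auto
    then show ?thesis
      using fin_incr[OF S'(1,2)] incr_H[OF S'(2)]
      by (auto simp: finitely_generated_def finite_generating_set_def)
  qed
  then have fg: "fg_subgroup H G" using G H by (simp add: fg_subgroup_def)
  have "\<exists>K\<ge>1. \<forall>x\<in>carrier G. \<forall>y\<in>carrier G. word_dist ?H T (\<pi> x) (\<pi> y) \<le> K * word_dist G S x y"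
    if S: "finite_generating_set G S" and T: "finite_generating_set ?H T" for S T
  proof -
    have S': "finite S" "S \<subseteq> carrier G" using S by (auto simp: finite_generating_set_def)
    define k where "k = Max (insert 1 (word_norm ?H T ` incr S))"
    have k: "1 \<le> k" "\<And>z. z \<in> incr S \<Longrightarrow> word_norm ?H T z \<le> k"
      unfolding k_def using fin_incr[OF S'] by (auto intro: Max_ge)
    have "word_dist ?H T (\<pi> x) (\<pi> y) \<le> real k * word_dist G S x y"
      if xy: "x \<in> carrier G" "y \<in> carrier G" for x y
    proof -
      obtain ws where ws: "set ws \<subseteq> S \<union> m_inv G ` S" "list_prod G ws = inv\<^bsub>G\<^esub> x \<otimes>\<^bsub>G\<^esub> y"
        "length ws = word_norm G S (inv\<^bsub>G\<^esub> x \<otimes>\<^bsub>G\<^esub> y)"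
        using word_norm_attained[OF S, of "inv\<^bsub>G\<^esub> x \<otimes>\<^bsub>G\<^esub> y"] xy by auto
      have "x \<otimes>\<^bsub>G\<^esub> list_prod G ws = y" using ws(2) xy by (simp add: m_assoc[symmetric])
      moreover obtain vs where vs: "set vs \<subseteq> incr S" "length vs = length ws"
        "list_prod G vs = inv\<^bsub>G\<^esub> \<pi> x \<otimes>\<^bsub>G\<^esub> \<pi> (x \<otimes>\<^bsub>G\<^esub> list_prod G ws)"
        by (rule increments_along_word[OF piG xy(1) ws(1) symmetrized_closed[OF S'(2)], folded incr_def])
      moreover have "word_norm ?H T (list_prod ?H vs) \<le> k * length vs"
        using vs(1) incr_H[OF S'(2)] k(2) by (intro GH.word_norm_list_prod_le[OF T]) auto
      ultimately show ?thesis
        using ws(3) m_inv_consistent[OF H piH[OF xy(1)]]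
        by (simp add: word_dist_def list_prod_subgroup flip: of_nat_mult)
    qed
    then show ?thesis using k(1) by (intro exI[of _ "real k"]) auto
  qed
  then show ?thesis unfolding lipschitz_retraction_def using fg \<pi> id by blast
qed

text \<open>The inclusion of a finitely generated subgroup is always Lipschitz, and a Lipschitz
  retraction bounds the metric of the subgroup by the ambient one.\<close>

theorem lipschitz_retract_undistorted:
  assumes "lipschitz_retraction G H \<pi>"
  shows "undistorted G H"
proof -
  have fg: "fg_subgroup H G" and id: "\<And>h. h \<in> H \<Longrightarrow> \<pi> h = h"
    and lip: "\<And>S T. finite_generating_set G S \<Longrightarrow> finite_generating_set (G\<lparr>carrier := H\<rparr>) T \<Longrightarrow>
        (\<exists>K\<ge>1. \<forall>x\<in>carrier G. \<forall>y\<in>carrier G.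
           word_dist (G\<lparr>carrier := H\<rparr>) T (\<pi> x) (\<pi> y) \<le> K * word_dist G S x y)"
    using assms by (auto simp: lipschitz_retraction_def)
  have G: "group G" and H: "subgroup H G" using fg by (auto simp: fg_subgroup_def)
  interpret group G by fact
  let ?H = "G\<lparr>carrier := H\<rparr>"
  interpret GH: group ?H using H by (simp add: subgroup.subgroup_is_group G)
  note HG = subgroup.subset[OF H]
  have "quasi_isometric_embedding H (word_dist ?H T) (word_dist G S) (\<lambda>h. h)"
    if S: "finite_generating_set G S" and T: "finite_generating_set ?H T" for S T
  proof -
    obtain K where K: "K \<ge> 1" "\<And>x y. x \<in> carrier G \<Longrightarrow> y \<in> carrier G \<Longrightarrow>
        word_dist ?H T (\<pi> x) (\<pi> y) \<le> K * word_dist G S x y"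
      using lip[OF S T] by blast
    have T': "finite T" "T \<subseteq> H" using T by (auto simp: finite_generating_set_def)
    define k where "k = Max (insert 1 (word_norm G S ` (T \<union> m_inv G ` T)))"
    have k: "1 \<le> k" "\<And>z. z \<in> T \<union> m_inv G ` T \<Longrightarrow> word_norm G S z \<le> k"
      unfolding k_def using T' by (auto intro: Max_ge)
    have inclusion: "word_dist G S x y \<le> real k * word_dist ?H T x y" if xy: "x \<in> H" "y \<in> H" for x y
    proof -
      have "m_inv ?H ` T = m_inv G ` T" using T' m_inv_consistent[OF H] by (auto intro!: image_cong)
      moreover have "inv\<^bsub>?H\<^esub> x = inv\<^bsub>G\<^esub> x" using m_inv_consistent[OF H xy(1)] .
      moreover have "inv\<^bsub>G\<^esub> x \<otimes>\<^bsub>G\<^esub> y \<in> H" using xy H by (simp add: subgroup.m_closed subgroup.m_inv_closed)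
      moreover obtain ws where "set ws \<subseteq> T \<union> m_inv ?H ` T" "list_prod ?H ws = inv\<^bsub>G\<^esub> x \<otimes>\<^bsub>G\<^esub> y"
        "length ws = word_norm ?H T (inv\<^bsub>G\<^esub> x \<otimes>\<^bsub>G\<^esub> y)"
        by (rule GH.word_norm_attained[OF T]) (use calculation in auto)
      ultimately have ws: "set ws \<subseteq> T \<union> m_inv G ` T" "list_prod G ws = inv\<^bsub>G\<^esub> x \<otimes>\<^bsub>G\<^esub> y"
        "length ws = word_norm ?H T (inv\<^bsub>?H\<^esub> x \<otimes>\<^bsub>?H\<^esub> y)"
        by (simp_all add: list_prod_subgroup)
      have "word_norm G S (list_prod G ws) \<le> k * length ws"
      proof (rule word_norm_list_prod_le[OF S])
        have "T \<subseteq> carrier G" using T' HG by blast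
        then show "set ws \<subseteq> carrier G" using ws(1) symmetrized_closed by blast
        show "word_norm G S v \<le> k" if "v \<in> set ws" for v using that ws(1) k(2) by blast
      qed
      then show ?thesis using ws(2,3) by (simp add: word_dist_def flip: of_nat_mult)
    qed
    define L where "L = max K (real k)"
    have nonneg: "0 \<le> word_dist A B u v" for A :: "('x, 'y) monoid_scheme" and B u v
      by (simp add: word_dist_def)
    have "word_dist ?H T x y / L - 0 \<le> word_dist G S x y \<and> word_dist G S x y \<le> L * word_dist ?H T x y + 0"
      if xy: "x \<in> H" "y \<in> H" for x y
    proof
      have "word_dist ?H T x y \<le> K * word_dist G S x y"
        using K(2)[of x y] xy HG id by auto
      also have "\<dots> \<le> L * word_dist G S x y"
        by (rule mult_right_mono[OF _ nonneg]) (simp add: L_def)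
      finally show "word_dist ?H T x y / L - 0 \<le> word_dist G S x y"
        using K(1) by (simp add: L_def field_simps)
      have "word_dist G S x y \<le> real k * word_dist ?H T x y" by (rule inclusion[OF xy])
      also have "\<dots> \<le> L * word_dist ?H T x y"
        by (rule mult_right_mono[OF _ nonneg]) (simp add: L_def)
      finally show "word_dist G S x y \<le> L * word_dist ?H T x y + 0" by simp
    qed
    moreover have "L \<ge> 1" using K(1) by (simp add: L_def)
    ultimately show ?thesis
      unfolding quasi_isometric_embedding_def by (intro exI[of _ L] conjI exI[of _ 0]) auto
  qed
  then show ?thesis unfolding undistorted_def using fg by blast
qed

section \<open>Short tuples of loops\<close>

lemma length_filter_in_le:
  assumes "finite D" and "\<And>e. count_list xs e \<le> m"
  shows "length (filter (\<lambda>x. x \<in> D) xs) \<le> m * card D"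
proof -
  have "length (filter (\<lambda>x. x \<in> D) xs) = (\<Sum>d\<in>D. count_list xs d)"
    using assms(1)
  proof (induction xs)
    case (Cons x xs)
    have "(\<Sum>d\<in>D. count_list (x # xs) d) = (\<Sum>d\<in>D. count_list xs d + (if d = x then 1 else 0))"
      by (rule sum.cong) auto
    also have "\<dots> = (\<Sum>d\<in>D. count_list xs d) + (if x \<in> D then 1 else 0)"
      using Cons.prems by (simp add: sum.distrib)
    finally show ?case using Cons by simp
  qed simp
  also have "\<dots> \<le> (\<Sum>d\<in>D. m)" by (rule sum_mono) (rule assms(2))
  finally show ?thesis by (simp add: mult.commute)
qed

text \<open>\<open>f\<close> replaces every step of \<open>c\<close> by a walk in another graph; only the steps over edges in \<open>D\<close>
  contribute crossings of \<open>N\<close>.\<close>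

lemma crossings_of_image:
  assumes count: "\<And>e. count_list (map fst c) e \<le> m" and D: "finite D"
    and off: "\<And>s t. s \<in> set c \<Longrightarrow> fst s \<notin> D \<Longrightarrow> t \<in> set (f s) \<Longrightarrow> fst t \<notin> N"
    and len: "\<And>s. s \<in> set c \<Longrightarrow> length (f s) \<le> L"
  shows "length (filter (\<lambda>t. fst t \<in> N) (concat (map f c))) \<le> m * card D * L"
proof -
  have "length (filter (\<lambda>t. fst t \<in> N) (concat (map f c))) \<le> length (filter (\<lambda>e. e \<in> D) (map fst c)) * L"
    using off len
  proof (induction c)
    case (Cons s c)
    let ?n = "\<lambda>xs. length (filter (\<lambda>t. fst t \<in> N) xs)"
    have IH: "?n (concat (map f c)) \<le> length (filter (\<lambda>e. e \<in> D) (map fst c)) * L"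
      using Cons.prems by (intro Cons.IH) auto
    show ?case
    proof (cases "fst s \<in> D")
      case True
      have "?n (f s) \<le> L" 
        using Cons.prems(2)[of s] by (intro order_trans[OF length_filter_le]) simp
      then show ?thesis using IH True by simp
    next
      case False
      then have "filter (\<lambda>t. fst t \<in> N) (f s) = []" using Cons.prems(1)[of s] by (auto simp: filter_empty_conv)
      then show ?thesis using IH False by simp
    qed
  qed simp
  also have "\<dots> \<le> m * card D * L"
    using length_filter_in_le[OF D count] by simp
  finally show ?thesis .
qed

text \<open>Reindexes a family by a set that may be larger, filling up with the default value \<open>z\<close>. It turns
  tree generators into tuples of a prescribed size, the surplus entries being trivial.\<close>

lemma enumerate_family:
  assumes "finite N" "finite J" "card N \<le> card J"
  obtains \<beta> nu where "nu ` N \<subseteq> J" "\<And>e. e \<in> N \<Longrightarrow> \<beta> (nu e) = g e"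
    "\<And>j. \<beta> j = z \<or> \<beta> j \<in> g ` N"
proof -
  obtain nu where nu: "nu ` N \<subseteq> J" "inj_on nu N" using card_le_inj[OF assms] by blast
  show ?thesis
    by (rule that[of nu "\<lambda>j. if j \<in> nu ` N then g (inv_into N nu j) else z"])
       (use nu in \<open>auto intro: inv_into_into\<close>)
qed

definition subst_walk ::
  "('j \<Rightarrow> (('v, 'i) edge \<times> bool) list) \<Rightarrow> ('j \<times> bool) list \<Rightarrow> (('v, 'i) edge \<times> bool) list" where
  "subst_walk c w = concat (map (\<lambda>(j, b). if b then c j else inv_word (c j)) w)"

context free_group
begin

text \<open>The bound three suits the loops of a spanning tree, which run through the tree to an edge, across
  it, and back through the tree.\<close>

definition short_loop :: "('v, 'i) edge set \<Rightarrow> 'v \<Rightarrow> 'a \<Rightarrow> bool" where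
  "short_loop E v0 x \<longleftrightarrow>
     (\<exists>c. walk E v0 c v0 \<and> (\<forall>e. count_list (map fst c) e \<le> 3) \<and> walk_val c = x)"

text \<open>What remains of a spanning tree once the tree is forgotten: \<open>N\<close> stands for its complement, and \<open>\<beta>\<close>
  for the generators that it gives. The first part bounds the entries when they are expressed through
  another such tuple, the second part is what that other tuple must provide.\<close>

definition short_tuple :: "('v, 'i) edge set \<Rightarrow> 'v \<Rightarrow> 'j set \<Rightarrow> ('j \<Rightarrow> 'a) \<Rightarrow> bool" where
  "short_tuple E v0 J \<beta> \<longleftrightarrow>
     (\<forall>j\<in>J. short_loop E v0 (\<beta> j)) \<and>
     (\<exists>N\<subseteq>E. finite N \<and> card N \<le> card J \<and>
        (\<forall>c. walk E v0 c v0 \<longrightarrow>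
           (\<exists>w. length w = length (filter (\<lambda>s. fst s \<in> N) c) \<and> fst ` set w \<subseteq> J \<and>
                word_val F \<beta> w = walk_val c)))"

lemma ex_short_tuple:
  assumes st: "spanning_tree E v0 P T" and l: "lab ` E \<subseteq> I" and E: "source ` E \<subseteq> reachable E v0"
    and fin: "finite (E - P)" "finite J" "card (E - P) \<le> card J"
  obtains \<beta> where "short_tuple E v0 J \<beta>"
proof -
  obtain \<beta> nu where nu: "nu ` (E - P) \<subseteq> J" "\<And>e. e \<in> E - P \<Longrightarrow> \<beta> (nu e) = tree_gen T e"
    and beta: "\<And>j. \<beta> j = \<one> \<or> \<beta> j \<in> tree_gen T ` (E - P)"
    by (rule enumerate_family[OF fin, of "tree_gen T" \<one>]) (rule that)
  have "short_loop E v0 (\<beta> j)" for j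
  proof (cases "\<beta> j = \<one>")
    case True
    then show ?thesis unfolding short_loop_def by (intro exI[of _ "[]"]) simp
  next
    case False
    then obtain e where e: "e \<in> E" "\<beta> j = tree_gen T e" using beta by blast
    then have "source e \<in> reachable E v0" using E by auto
    then show ?thesis unfolding short_loop_def
      using walk_tree_loop[OF st e(1)] count_tree_loop[OF st e(1)] e(2) tree_gen_def by metis
  qed
  moreover have "\<exists>w. length w = length (filter (\<lambda>s. fst s \<in> E - P) c) \<and> fst ` set w \<subseteq> J \<and>
      word_val F \<beta> w = walk_val c" if c: "walk E v0 c v0" for c
  proof (intro exI conjI)
    let ?c = "filter (\<lambda>s. fst s \<in> E - P) c"
    let ?w = "map (\<lambda>(e, b). (nu e, b)) ?c"
    show "length ?w = length ?c" by simp
    show "fst ` set ?w \<subseteq> J" using nu(1) walk_edges[OF c] by fastforce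
    have "word_val F \<beta> ?w = word_val F (\<beta> \<circ> nu) ?c" by (rule word_val_map)
    also have "\<dots> = word_val F (tree_gen T) ?c"
      using nu(2) by (intro word_val_cong) auto
    finally show "word_val F \<beta> ?w = walk_val c" using closed_walk_val[OF st l E c] by simp
  qed
  ultimately have "short_tuple E v0 J \<beta>"
    unfolding short_tuple_def using fin by (intro conjI ballI exI[of _ "E - P"]) auto
  then show ?thesis using that by blast
qed

text \<open>If there are loops of length one at the base point, as many as there are edges outside a
  spanning tree, then there is nothing else outside the tree.\<close>

lemma short_tuple_loops:
  assumes st: "spanning_tree E v0 P T" and l: "lab ` E \<subseteq> I" and E: "source ` E \<subseteq> reachable E v0"
    and fin: "finite (E - P)" "card (E - P) \<le> card J" and J: "J \<subseteq> I" "(\<lambda>j. (v0, j, v0)) ` J \<subseteq> E"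
  shows "short_tuple E v0 J a"
proof -
  let ?L = "(\<lambda>j. (v0, j, v0)) ` J"
  have "?L \<subseteq> E - P" using J(2) tree_edge_not_loop[OF st] by fastforce
  moreover have "card ?L = card J" by (rule card_image) (auto simp: inj_on_def)
  ultimately have N: "?L = E - P" using fin card_subset_eq by (metis card_mono le_antisym)
  have T0: "T v0 = []" using st by (simp add: spanning_tree_def)
  have gen: "tree_gen T (v0, j, v0) = a j" if "j \<in> J" for j
    using that J by (auto simp: tree_gen_def tree_loop_def T0)
  have "short_loop E v0 (a j)" if "j \<in> J" for j
    unfolding short_loop_def
    by (rule exI[of _ "[((v0, j, v0), True)]"]) (use that J in auto)
  moreover have "\<exists>w. length w = length (filter (\<lambda>s. fst s \<in> ?L) c) \<and> fst ` set w \<subseteq> J \<and>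
      word_val F a w = walk_val c" if c: "walk E v0 c v0" for c
  proof (intro exI conjI)
    let ?c = "filter (\<lambda>s. fst s \<in> ?L) c"
    let ?w = "map (\<lambda>(e, b). (lab e, b)) ?c"
    show "length ?w = length ?c" by simp
    show "fst ` set ?w \<subseteq> J" by fastforce
    have "word_val F a ?w = word_val F (a \<circ> lab) ?c" by (rule word_val_map)
    also have "\<dots> = word_val F (tree_gen T) ?c"
      using gen by (intro word_val_cong) auto
    finally show "word_val F a ?w = walk_val c" using closed_walk_val[OF st l E c] N by simp
  qed
  moreover have "finite ?L" "card ?L \<le> card J" using N fin by auto
  ultimately show ?thesis
    unfolding short_tuple_def using J(2) by (intro conjI ballI exI[of _ ?L]) auto
qed

section \<open>The automorphism group\<close>

lemma group_AutoGroup: "group (AutoGroup F)"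
  by (rule AutoGroup)

lemma carrier_AutoGroup: "carrier (AutoGroup F) = auto F"
  by (simp add: AutoGroup_def)

lemma AutoGroup_mult_apply:
  "\<alpha> \<in> auto F \<Longrightarrow> \<beta> \<in> auto F \<Longrightarrow> x \<in> carrier F \<Longrightarrow> (\<alpha> \<otimes>\<^bsub>AutoGroup F\<^esub> \<beta>) x = \<alpha> (\<beta> x)"
  by (simp add: AutoGroup_def mult_BijGroup auto_def compose_eq)

lemma AutoGroup_one_apply: "x \<in> carrier F \<Longrightarrow> \<one>\<^bsub>AutoGroup F\<^esub> x = x"
  by (simp add: AutoGroup_def one_BijGroup)

lemma AutoGroup_inv_closed [simp, intro]: "\<alpha> \<in> auto F \<Longrightarrow> inv\<^bsub>AutoGroup F\<^esub> \<alpha> \<in> auto F"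
  using group.inv_closed[OF group_AutoGroup] by (simp add: carrier_AutoGroup)

lemma AutoGroup_mult_closed [simp, intro]:
  "\<alpha> \<in> auto F \<Longrightarrow> \<beta> \<in> auto F \<Longrightarrow> \<alpha> \<otimes>\<^bsub>AutoGroup F\<^esub> \<beta> \<in> auto F"
  using monoid.m_closed[OF group.is_monoid[OF group_AutoGroup]] by (simp add: carrier_AutoGroup)

lemma AutoGroup_inv_apply:
  assumes "\<alpha> \<in> auto F" "x \<in> carrier F"
  shows "(inv\<^bsub>AutoGroup F\<^esub> \<alpha>) (\<alpha> x) = x" "\<alpha> ((inv\<^bsub>AutoGroup F\<^esub> \<alpha>) x) = x"
proof -
  have "inv\<^bsub>AutoGroup F\<^esub> \<alpha> \<otimes>\<^bsub>AutoGroup F\<^esub> \<alpha> = \<one>\<^bsub>AutoGroup F\<^esub>"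
    "\<alpha> \<otimes>\<^bsub>AutoGroup F\<^esub> inv\<^bsub>AutoGroup F\<^esub> \<alpha> = \<one>\<^bsub>AutoGroup F\<^esub>"
    using group.l_inv[OF group_AutoGroup] group.r_inv[OF group_AutoGroup] assms
    by (auto simp: carrier_AutoGroup)
  then show "(inv\<^bsub>AutoGroup F\<^esub> \<alpha>) (\<alpha> x) = x" "\<alpha> ((inv\<^bsub>AutoGroup F\<^esub> \<alpha>) x) = x"
    using AutoGroup_mult_apply AutoGroup_one_apply assms AutoGroup_inv_closed by metis+
qed

lemma automorphism_word_val:
  assumes "\<alpha> \<in> auto F" "x ` fst ` set w \<subseteq> carrier F"
  shows "\<alpha> (word_val F x w) = word_val F (\<alpha> \<circ> x) w"
  using hom_word_val[OF is_group is_group _ assms(2), of \<alpha>] assms(1) by (simp add: auto_def)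

lemma automorphism_basis_words:
  assumes "\<alpha> \<in> auto F" "x \<in> carrier F"
  obtains w where "fst ` set w \<subseteq> I" "word_val F (\<lambda>i. \<alpha> (a i)) w = x"
proof -
  obtain w where w: "fst ` set w \<subseteq> I" "word_val F a w = (inv\<^bsub>AutoGroup F\<^esub> \<alpha>) x"
    using ex_word_val assms by blast
  then have "a ` fst ` set w \<subseteq> carrier F" using basis_closed by blast
  then have "word_val F (\<lambda>i. \<alpha> (a i)) w = x"
    using automorphism_word_val[OF assms(1), of a w] AutoGroup_inv_apply(2)[OF assms] w(2)
    by (simp add: comp_def)
  then show ?thesis using that w(1) by blast
qed

text \<open>Applying \<open>\<beta>\<inverse>\<close> turns words in the images of the basis under \<open>\<beta>\<close> into words in the basis.\<close>

lemma relatively_bounded: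
  assumes \<alpha>: "\<alpha> \<in> auto F" and \<beta>: "\<beta> \<in> auto F"
    and short: "\<And>i. i \<in> I \<Longrightarrow>
      \<exists>w. length w \<le> M \<and> fst ` set w \<subseteq> I \<and> word_val F (\<lambda>i. \<beta> (a i)) w = \<alpha> (a i)"
  shows "inv\<^bsub>AutoGroup F\<^esub> \<beta> \<otimes>\<^bsub>AutoGroup F\<^esub> \<alpha> \<in> bounded_autos M"
proof -
  have "\<exists>w. length w \<le> M \<and> fst ` set w \<subseteq> I \<and>
      word_val F a w = (inv\<^bsub>AutoGroup F\<^esub> \<beta> \<otimes>\<^bsub>AutoGroup F\<^esub> \<alpha>) (a i)" if i: "i \<in> I" for i
  proof -
    obtain w where w: "length w \<le> M" "fst ` set w \<subseteq> I" "word_val F (\<lambda>i. \<beta> (a i)) w = \<alpha> (a i)"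
      using short[OF i] by blast
    then have "a ` fst ` set w \<subseteq> carrier F" using basis_closed by blast
    then have "\<beta> (word_val F a w) = \<alpha> (a i)"
      using automorphism_word_val[OF \<beta>, of a w] w(3) by (simp add: comp_def)
    then have "(inv\<^bsub>AutoGroup F\<^esub> \<beta> \<otimes>\<^bsub>AutoGroup F\<^esub> \<alpha>) (a i) = word_val F a w"
      using AutoGroup_mult_apply[of "inv\<^bsub>AutoGroup F\<^esub> \<beta>" \<alpha> "a i"] AutoGroup_inv_apply(1)[OF \<beta>, of "word_val F a w"]
        i \<alpha> \<beta> w(2) by (metis AutoGroup_inv_closed basis_in_carrier word_val_basis_closed)
    then show ?thesis using w by auto
  qed
  then show ?thesis using \<alpha> \<beta> by (simp add: bounded_autos_def)
qed

lemma subst_walk_closed: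
  assumes l: "lab ` E \<subseteq> I" and c: "\<And>j. j \<in> J \<Longrightarrow> walk E v0 (c j) v0" and "fst ` set w \<subseteq> J"
  shows "walk E v0 (subst_walk c w) v0"
    and "walk_val (subst_walk c w) = word_val F (\<lambda>j. walk_val (c j)) w"
proof -
  have "walk E v0 (subst_walk c w) v0 \<and> walk_val (subst_walk c w) = word_val F (\<lambda>j. walk_val (c j)) w"
    using assms(3)
  proof (induction w)
    case (Cons l w)
    then have IH: "walk E v0 (subst_walk c w) v0"
      "walk_val (subst_walk c w) = word_val F (\<lambda>j. walk_val (c j)) w" by auto
    obtain j b where jb: "l = (j, b)" by fastforce
    have cj: "walk E v0 (c j) v0" using c Cons.prems jb by simp
    define d where "d = (if b then c j else inv_word (c j))"
    have d: "walk E v0 d v0" "walk_val d = letter_val F (\<lambda>j. walk_val (c j)) l"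
      using cj walk_inv_word[OF cj] walk_val_inv_word[OF cj assms(1)]
      by (auto simp: d_def letter_val_def jb)
    have "subst_walk c (l # w) = d @ subst_walk c w" by (simp add: subst_walk_def d_def jb)
    then show ?case
      using d IH walk_val_append[OF d(1) IH(1) assms(1)] by (auto simp: walk_append word_val_Cons)
  qed (simp add: subst_walk_def)
  then show "walk E v0 (subst_walk c w) v0"
    "walk_val (subst_walk c w) = word_val F (\<lambda>j. walk_val (c j)) w" by auto
qed

section \<open>Finite generation of the automorphism group by folding\<close>

definition map_edge :: "('v \<Rightarrow> 'w) \<Rightarrow> ('v, 'i) edge \<Rightarrow> ('w, 'i) edge" where
  "map_edge f e = (f (source e), lab e, f (target e))"

lemma walk_map_edge:
  "walk E u c v \<Longrightarrow> walk (map_edge f ` E) (f u) (map (\<lambda>(e, b). (map_edge f e, b)) c) (f v)"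
proof (induction c arbitrary: u)
  case (Cons s c)
  obtain e b where s: "s = (e, b)" by fastforce
  have "step_from (map_edge f e, b) = f (step_from s)" "step_to (map_edge f e, b) = f (step_to s)"
    using s by (cases b; simp add: map_edge_def)+
  then show ?case using Cons s by auto
qed simp

lemma walk_val_map_edge: "walk_val (map (\<lambda>(e, b). (map_edge f e, b)) c) = walk_val c"
  using word_val_map[of F "\<lambda>e. a (lab e)" "map_edge f" c] by (simp add: comp_def map_edge_def)

lemma short_tuple_automorphism:
  assumes "finite I" and l: "lab ` E \<subseteq> I" and \<beta>: "short_tuple E v0 I \<beta>"
    and cl: "\<And>i. i \<in> I \<Longrightarrow> \<exists>c. walk E v0 c v0 \<and> walk_val c = a i"
  obtains \<gamma> where "\<gamma> \<in> auto F" "\<And>i. i \<in> I \<Longrightarrow> \<gamma> (a i) = \<beta> i"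
proof -
  have b: "\<beta> ` I \<subseteq> carrier F"
  proof (rule image_subsetI)
    fix i assume "i \<in> I"
    then obtain c where "walk E v0 c v0" "walk_val c = \<beta> i"
      using \<beta> unfolding short_tuple_def short_loop_def by blast
    then show "\<beta> i \<in> carrier F" using walk_val_closed[OF _ l] by metis
  qed
  have "a i \<in> generate F (\<beta> ` I)" if "i \<in> I" for i
    using cl[OF that] \<beta> generate_word_val[OF b] unfolding short_tuple_def by metis
  then have "generate F (a ` I) \<subseteq> generate F (\<beta> ` I)"
    by (intro generate_subgroup_incl[OF _ generate_is_subgroup[OF b]]) auto
  then have "generate F (\<beta> ` I) = carrier F"
    using generate_basis generate_incl[OF b] by auto
  then show ?thesis using generating_tuple_automorphism[OF assms(1) b] that by blast
qed

text \<open>A closed walk at \<open>v0\<close> with value \<open>a i\<close> makes \<open>a i\<close> fix \<open>v0\<close> under any completion of the partial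
  permutations. If the label \<open>i\<close> did not lead from \<open>v0\<close> back to \<open>v0\<close>, some completion would move
  \<open>v0\<close>.\<close>

lemma loops_in_folded_graph:
  fixes E :: "('v, 'i) edge set"
  assumes inf: "infinite (UNIV :: 'v set)" and E: "finite E" "lab ` E \<subseteq> I" "folded E"
    and c: "walk E v0 c v0" "walk_val c = a i" and i: "i \<in> I"
  shows "(v0, i, v0) \<in> E"
proof -
  let ?V = "insert v0 (source ` E \<union> target ` E)"
  have finV: "finite ?V" using E by simp
  then obtain z where z: "z \<notin> ?V" using ex_new_if_finite[OF inf] by blast
  \<comment> \<open>A missing edge at \<open>v0\<close> is added with a new vertex at its other end.\<close>
  define E' where "E' = (if \<exists>v. (v0, i, v) \<in> E then E else insert (v0, i, z) E)"
  have z': "(p, k, z) \<notin> E" for p k using z by force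
  have fold: "folded E'"
    using E(3) z' unfolding E'_def folded_def by auto
  have "E \<subseteq> ?V \<times> I \<times> ?V"
  proof
    fix e assume e: "e \<in> E"
    then have "source e \<in> ?V" "lab e \<in> I" "target e \<in> ?V" using E(2) by auto
    then show "e \<in> ?V \<times> I \<times> ?V" by (simp only: mem_Times_iff)
  qed
  then have "E \<subseteq> insert z ?V \<times> I \<times> insert z ?V" by blast
  moreover have "(v0, i, z) \<in> insert z ?V \<times> I \<times> insert z ?V" using i by simp
  ultimately have sub: "E' \<subseteq> insert z ?V \<times> I \<times> insert z ?V" by (simp add: E'_def)
  have mono: "walk E u d v \<Longrightarrow> walk E' u d v" for u d v
    by (induction d arbitrary: u) (auto simp: E'_def)
  obtain h where h: "h \<in> hom F (BijGroup (insert z ?V))"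
    "\<And>u c v. walk E' u c v \<Longrightarrow> u \<in> insert z ?V \<Longrightarrow> h (walk_val c) v = u"
    "\<And>p i q. (p, i, q) \<in> E' \<Longrightarrow> h (a i) q = p"
    by (rule folded_graph_action[OF _ sub fold]) (use finV in simp, rule that)
  obtain v where v: "(v0, i, v) \<in> E'"
    by (cases "\<exists>v. (v0, i, v) \<in> E") (auto simp: E'_def)
  have "h (a i) v = v0" by (rule h(3)[OF v])
  moreover have "h (a i) v0 = v0" using h(2)[OF mono[OF c(1)]] c(2) by simp
  moreover have "h (a i) \<in> Bij (insert z ?V)"
    using hom_in_carrier[OF h(1)] i by (simp add: carrier_BijGroup)
  then have "inj_on (h (a i)) (insert z ?V)" by (simp add: Bij_def bij_betw_def)
  moreover have "v \<in> insert z ?V" using subsetD[OF sub v] by simp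
  ultimately have "v = v0" using inj_onD[of "h (a i)" "insert z ?V" v v0] by simp
  moreover have "v0 \<noteq> z" using z by blast
  ultimately show ?thesis using v by (auto simp: E'_def split: if_splits)
qed

definition merge :: "'v \<Rightarrow> 'v \<Rightarrow> 'v \<Rightarrow> 'v" where
  "merge x y v = (if v = y then x else v)"

text \<open>An edge in the fibre over \<open>e\<close> is determined by \<open>e\<close> and by whether its source and its target
  are \<open>y\<close>.\<close>

lemma card_map_edge_merge_fibres:
  assumes "finite N"
  shows "finite {e. map_edge (merge x y) e \<in> N}" "card {e. map_edge (merge x y) e \<in> N} \<le> 4 * card N"
proof -
  let ?f = "\<lambda>((p, i, q), b, b'). (if b then y else p, i, if b' then y else q)"
  have sub: "{e. map_edge (merge x y) e \<in> N} \<subseteq> ?f ` (N \<times> (UNIV :: bool set) \<times> (UNIV :: bool set))"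
  proof
    fix e assume e: "e \<in> {e. map_edge (merge x y) e \<in> N}"
    then have "e = ?f (map_edge (merge x y) e, source e = y, target e = y)"
      by (cases e) (simp add: map_edge_def merge_def)
    then show "e \<in> ?f ` (N \<times> UNIV \<times> UNIV)" using e by blast
  qed
  have fin: "finite (N \<times> (UNIV :: bool set) \<times> (UNIV :: bool set))" using assms by simp
  show "finite {e. map_edge (merge x y) e \<in> N}" using finite_subset[OF sub] fin by simp
  have "card {e. map_edge (merge x y) e \<in> N} \<le> card (N \<times> (UNIV :: bool set) \<times> (UNIV :: bool set))"
    using card_mono[OF _ sub] card_image_le[OF fin, of ?f] fin by (meson finite_imageI order_trans)
  then show "card {e. map_edge (merge x y) e \<in> N} \<le> 4 * card N"
    by (simp add: card_cartesian_product flip: UNIV_Times_UNIV)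
qed

lemma not_foldedE:
  assumes "\<not> folded E"
  obtains x y e e' where "x \<noteq> y" "e \<in> E" "e' \<in> E" "e \<noteq> e'"
    "map_edge (merge x y) e = map_edge (merge x y) e'" "{x, y} \<subseteq> source ` E \<union> target ` E"
proof -
  from assms consider p i q q' where "(p, i, q) \<in> E" "(p, i, q') \<in> E" "q \<noteq> q'"
    | p p' i q where "(p, i, q) \<in> E" "(p', i, q) \<in> E" "p \<noteq> p'"
    by (auto simp: folded_def)
  then show ?thesis
  proof cases
    case 1
    then show ?thesis
      by (intro that[of q q' "(p, i, q)" "(p, i, q')"]) (force simp: map_edge_def merge_def)+
  next
    case 2
    then show ?thesis
      by (intro that[of p p' "(p, i, q)" "(p', i, q)"]) (force simp: map_edge_def merge_def)+
  qed
qed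

lemma card_outside_tree_le:
  assumes "finite E" and st: "spanning_tree E v0 P T" and "finite (reachable E v0)"
    and "card E + 1 \<le> card (reachable E v0) + n"
  shows "finite (E - P)" "card (E - P) \<le> n"
proof -
  have P: "P \<subseteq> E" "finite P" "Suc (card P) = card (reachable E v0)"
    using st card_spanning_tree[OF st assms(3)] by (auto simp: spanning_tree_def)
  show "finite (E - P)" using assms(1) by simp
  show "card (E - P) \<le> n" using card_Diff_subset[OF P(2,1)] P(3) assms(4) by simp
qed

lemma finite_reachable:
  assumes "finite E"
  shows "finite (reachable E v0)" "reachable E v0 \<subseteq> insert v0 (source ` E \<union> target ` E)"
proof -
  show sub: "reachable E v0 \<subseteq> insert v0 (source ` E \<union> target ` E)"
  proof
    fix v assume "v \<in> reachable E v0"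
    then obtain c where "walk E v0 c v" by (auto simp: reachable_def)
    then show "v \<in> insert v0 (source ` E \<union> target ` E)"
    proof (cases c rule: rev_cases)
      case (snoc c' s)
      then have "fst s \<in> E" "v = step_to s" using \<open>walk E v0 c v\<close> by (auto simp: walk_append)
      then show ?thesis by (auto simp: step_to_def)
    qed auto
  qed
  show "finite (reachable E v0)" using finite_subset[OF sub] assms by simp
qed

text \<open>Stallings folding. A fold loses one vertex and at least one edge, so the bound on the edges outside
  a spanning tree persists, and the folded graph again has a short tuple, which is a basis by the Hopf
  property. By induction this basis is reached from the basis \<open>a\<close> by bounded automorphisms, and one
  more bounded automorphism leads to \<open>\<alpha>\<close>. The constant is \<open>3 \<cdot> 4 \<cdot> card I\<close>: three crossings of each
  edge, four edges in each fibre of a fold, \<open>card I\<close> edges outside the tree. Vertices come from an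
  infinite type so that a finite graph always leaves room for another vertex.\<close>

theorem short_loops_generated:
  fixes E :: "('v, 'i) edge set"
  assumes finI: "finite I" and inf: "infinite (UNIV :: 'v set)"
    and "finite E" "lab ` E \<subseteq> I" "source ` E \<subseteq> reachable E v0"
    and "card E + 1 \<le> card (reachable E v0) + card I"
    and "\<alpha> \<in> auto F" "\<And>i. i \<in> I \<Longrightarrow> short_loop E v0 (\<alpha> (a i))"
  shows "\<alpha> \<in> generate (AutoGroup F) (bounded_autos (12 * card I))"
  using assms(3-8)
proof (induction "card (reachable E v0)" arbitrary: E v0 \<alpha> rule: less_induct)
  case less
  note E = less.prems(1-3) and euler = less.prems(4) and \<alpha> = less.prems(5,6)
  let ?G = "AutoGroup F" and ?\<Psi> = "bounded_autos (12 * card I)"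
  interpret G: group ?G by (rule group_AutoGroup)
  have basis_loops: "\<exists>c. walk E v0 c v0 \<and> walk_val c = a i" if i: "i \<in> I" for i
  proof -
    obtain w where w: "fst ` set w \<subseteq> I" "word_val F (\<lambda>j. \<alpha> (a j)) w = a i"
      by (rule automorphism_basis_words[OF \<alpha>(1) basis_in_carrier[OF i]])
    have "\<forall>j\<in>I. \<exists>c. walk E v0 c v0 \<and> walk_val c = \<alpha> (a j)"
      using \<alpha>(2) unfolding short_loop_def by blast
    then obtain c where c: "\<And>j. j \<in> I \<Longrightarrow> walk E v0 (c j) v0" "\<And>j. j \<in> I \<Longrightarrow> walk_val (c j) = \<alpha> (a j)"
      using bchoice[of I "\<lambda>j c. walk E v0 c v0 \<and> walk_val c = \<alpha> (a j)"] by blast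
    have "word_val F (\<lambda>j. walk_val (c j)) w = word_val F (\<lambda>j. \<alpha> (a j)) w"
      using w(1) c(2) by (intro word_val_cong) auto
    then show ?thesis
      using subst_walk_closed[OF E(2) c(1) w(1)] w(2) by (intro exI[of _ "subst_walk c w"]) simp
  qed
  note fr = finite_reachable[OF E(1), of v0]
  show ?case
  proof (cases "folded E")
    case True
    obtain P T where st: "spanning_tree E v0 P T" using ex_spanning_tree[of E v0] by blast
    have "(\<lambda>i. (v0, i, v0)) ` I \<subseteq> E"
      using loops_in_folded_graph[OF inf E(1,2) True] basis_loops by blast
    then have "short_tuple E v0 I a"
      using short_tuple_loops[OF st E(2,3) card_outside_tree_le[OF E(1) st fr(1) euler]] by simp
    then obtain N where N: "finite N" "card N \<le> card I" "\<And>c. walk E v0 c v0 \<Longrightarrow>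
        \<exists>w. length w = length (filter (\<lambda>s. fst s \<in> N) c) \<and> fst ` set w \<subseteq> I \<and> word_val F a w = walk_val c"
      unfolding short_tuple_def by blast
    have "\<exists>w. length w \<le> 12 * card I \<and> fst ` set w \<subseteq> I \<and> word_val F a w = \<alpha> (a i)" if i: "i \<in> I" for i
    proof -
      obtain c where c: "walk E v0 c v0" "\<And>e. count_list (map fst c) e \<le> 3" "walk_val c = \<alpha> (a i)"
        using \<alpha>(2)[OF i] unfolding short_loop_def by blast
      have "length (filter (\<lambda>s. fst s \<in> N) (concat (map (\<lambda>s. [s]) c))) \<le> 3 * card N * 1"
        using N(1) c(2) by (intro crossings_of_image) auto
      then have "length (filter (\<lambda>s. fst s \<in> N) c) \<le> 12 * card I" using N(2) by simp
      then show ?thesis using N(3)[OF c(1)] c(3) by metis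
    qed
    then show ?thesis using \<alpha>(1) by (intro generate.incl) (simp add: bounded_autos_def)
  next
    case False
    then obtain x y e e' where xy: "x \<noteq> y" "{x, y} \<subseteq> source ` E \<union> target ` E"
      and e: "e \<in> E" "e' \<in> E" "e \<noteq> e'" "map_edge (merge x y) e = map_edge (merge x y) e'"
      by (rule not_foldedE)
    let ?f = "merge x y" and ?R = "reachable E v0"
    let ?E' = "map_edge ?f ` E" and ?v0 = "?f v0"
    let ?R' = "reachable ?E' ?v0"
    have ends: "source ` E \<union> target ` E \<subseteq> ?R"
      using E(3) reachable_ends[of _ _ _ E v0] by fastforce
    have E': "finite ?E'" "lab ` ?E' \<subseteq> I" using E by (auto simp: map_edge_def)
    have img: "?f ` ?R \<subseteq> ?R'"
      using walk_map_edge[of E v0 _ _ ?f] by (auto simp: reachable_def)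
    have E'3: "source ` ?E' \<subseteq> ?R'" using img E(3) by (force simp: map_edge_def)
    note fr' = finite_reachable[OF E'(1), of ?v0]
    have xyR: "x \<in> ?R" "y \<in> ?R" using xy(2) ends by blast+
    have "?f ` ?R = ?R - {y}"
      using xy(1) xyR by (auto simp: merge_def image_iff)
    then have cardf: "Suc (card (?f ` ?R)) = card ?R"
      using card_Suc_Diff1[OF fr(1) xyR(2)] by simp
    have "?R' \<subseteq> ?f ` ?R"
    proof -
      have "source ` ?E' \<union> target ` ?E' = ?f ` (source ` E \<union> target ` E)"
        by (simp add: map_edge_def image_Un image_image)
      then have "source ` ?E' \<union> target ` ?E' \<subseteq> ?f ` ?R" using image_mono[OF ends, of ?f] by (simp only:)
      moreover have "?v0 \<in> ?f ` ?R" using reachable_refl by (rule imageI)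
      ultimately show ?thesis using order_trans[OF fr'(2)] by (simp only: insert_subset simp_thms)
    qed
    then have cardR': "card ?R' = card (?f ` ?R)" using img by (simp add: subset_antisym)
    have "?E' \<subseteq> map_edge ?f ` (E - {e'})"
    proof (rule image_subsetI)
      fix d assume d: "d \<in> E"
      have "map_edge ?f e \<in> map_edge ?f ` (E - {e'})" using e(1,3) by (intro imageI) simp
      then show "map_edge ?f d \<in> map_edge ?f ` (E - {e'})"
        using d e(4) by (cases "d = e'") auto
    qed
    then have "card ?E' \<le> card (E - {e'})" using E(1) surj_card_le[of "E - {e'}"] by blast
    then have "card ?E' < card E" using card_Diff1_less[OF E(1) e(2)] by simp
    then have euler': "card ?E' + 1 \<le> card ?R' + card I" using euler cardf cardR' by simp
    have push: "walk ?E' ?v0 (map (\<lambda>(e, b). (map_edge ?f e, b)) c) ?v0" if "walk E v0 c v0" for c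
      using walk_map_edge[OF that] .
    obtain P T where st: "spanning_tree ?E' ?v0 P T" using ex_spanning_tree[of ?E' ?v0] by blast
    note out = card_outside_tree_le[OF E'(1) st fr'(1) euler']
    obtain b where b: "short_tuple ?E' ?v0 I b"
      by (rule ex_short_tuple[OF st E'(2) E'3 out(1) finI out(2)])
    have "\<exists>c. walk ?E' ?v0 c ?v0 \<and> walk_val c = a i" if "i \<in> I" for i
      using basis_loops[OF that] push walk_val_map_edge by metis
    then obtain \<beta> where \<beta>: "\<beta> \<in> auto F" "\<And>i. i \<in> I \<Longrightarrow> \<beta> (a i) = b i"
      using short_tuple_automorphism[OF finI E'(2) b] by blast
    have IH: "\<beta> \<in> generate ?G ?\<Psi>"
    proof (rule less.hyps[OF _ E' E'3 euler' \<beta>(1)])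
      show "card ?R' < card ?R" using cardR' cardf by simp
      show "short_loop ?E' ?v0 (\<beta> (a i))" if "i \<in> I" for i
        using b \<beta>(2)[OF that] that by (simp add: short_tuple_def)
    qed
    obtain N where N: "finite N" "card N \<le> card I" "\<And>c. walk ?E' ?v0 c ?v0 \<Longrightarrow>
        \<exists>w. length w = length (filter (\<lambda>s. fst s \<in> N) c) \<and> fst ` set w \<subseteq> I \<and> word_val F b w = walk_val c"
      using b unfolding short_tuple_def by blast
    let ?D = "{e. map_edge ?f e \<in> N}"
    note D = card_map_edge_merge_fibres[OF N(1), of x y]
    have "inv\<^bsub>?G\<^esub> \<beta> \<otimes>\<^bsub>?G\<^esub> \<alpha> \<in> ?\<Psi>"
    proof (rule relatively_bounded[OF \<alpha>(1) \<beta>(1)])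
      fix i assume i: "i \<in> I"
      obtain c where c: "walk E v0 c v0" "\<And>e. count_list (map fst c) e \<le> 3" "walk_val c = \<alpha> (a i)"
        using \<alpha>(2)[OF i] unfolding short_loop_def by blast
      let ?fs = "\<lambda>(e, b). (map_edge ?f e, b)"
      have "length (filter (\<lambda>s. fst s \<in> N) (concat (map (\<lambda>s. [?fs s]) c))) \<le> 3 * card ?D * 1"
        using D(1) c(2) by (intro crossings_of_image) auto
      then have short: "length (filter (\<lambda>s. fst s \<in> N) (map ?fs c)) \<le> 12 * card I"
        using D(2) N(2) by (simp del: length_map)
      obtain w where w: "length w = length (filter (\<lambda>s. fst s \<in> N) (map ?fs c))"
        "fst ` set w \<subseteq> I" "word_val F b w = walk_val (map ?fs c)"
        using N(3)[OF push[OF c(1)]] by blast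
      have "word_val F (\<lambda>i. \<beta> (a i)) w = word_val F b w"
        using w(2) \<beta>(2) by (intro word_val_cong) auto
      then have "word_val F (\<lambda>i. \<beta> (a i)) w = \<alpha> (a i)"
        using w(3) c(3) walk_val_map_edge[of ?f c] by simp
      then show "\<exists>w. length w \<le> 12 * card I \<and> fst ` set w \<subseteq> I \<and> word_val F (\<lambda>i. \<beta> (a i)) w = \<alpha> (a i)"
        using w(1,2) short by (intro exI[of _ w]) simp
    qed
    then have "\<beta> \<otimes>\<^bsub>?G\<^esub> (inv\<^bsub>?G\<^esub> \<beta> \<otimes>\<^bsub>?G\<^esub> \<alpha>) \<in> generate ?G ?\<Psi>"
      using generate.eng[OF IH generate.incl] by blast
    moreover have "\<beta> \<otimes>\<^bsub>?G\<^esub> (inv\<^bsub>?G\<^esub> \<beta> \<otimes>\<^bsub>?G\<^esub> \<alpha>) = \<alpha>"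
      using \<alpha>(1) \<beta>(1) by (intro G.mult_inv_cancel_left) (simp_all add: carrier_AutoGroup)
    ultimately show ?thesis by simp
  qed
qed

text \<open>Folding starts from the subdivided rose whose petals spell the images of the basis. It has at most as
  many edges as letters, and each petal has one vertex fewer than letters besides the base vertex, which
  is the count that the folding theorem asks for.\<close>

theorem finitely_generated_AutoGroup:
  assumes finI: "finite I"
  shows "finitely_generated (AutoGroup F)"
proof -
  let ?\<Psi> = "bounded_autos (12 * card I)"
  interpret G: group "AutoGroup F" by (rule group_AutoGroup)
  have "\<alpha> \<in> generate (AutoGroup F) ?\<Psi>" if \<alpha>: "\<alpha> \<in> auto F" for \<alpha>
  proof -
    have "\<exists>w. fst ` set w \<subseteq> I \<and> word_val F a w = \<alpha> (a i)" if "i \<in> I" for i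
      using ex_word_val \<alpha> that by blast
    then obtain w where w: "\<And>i. i \<in> I \<Longrightarrow> fst ` set (w i) \<subseteq> I" "\<And>i. i \<in> I \<Longrightarrow> word_val F a (w i) = \<alpha> (a i)"
      by metis
    have nonempty: "length (w i) > 0" if i: "i \<in> I" for i
    proof (rule ccontr)
      assume "\<not> length (w i) > 0"
      then have "\<alpha> (a i) = \<one>" using w(2)[OF i] by simp
      moreover have "\<alpha> \<one> = \<one>" using \<alpha> hom_one[OF _ is_group is_group] by (auto simp: auto_def)
      moreover have "inj_on \<alpha> (carrier F)" using \<alpha> by (auto simp: auto_def Bij_def bij_betw_def)
      ultimately have "a i = \<one>" using i by (metis basis_in_carrier inj_onD one_closed)
      then show False using basis_neq_one[OF i] by simp
    qed
    \<comment> \<open>\<open>None\<close> is the base vertex, \<open>Some (i, j)\<close> the point after \<open>j\<close> letters on the petal \<open>i\<close>.\<close>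
    define vert where "vert i j = (if j = 0 \<or> j = length (w i) then None else Some (i, j))" for i and j :: nat
    define petal where "petal i j =
      (if snd (w i ! j) then (vert i j, fst (w i ! j), vert i (Suc j))
       else (vert i (Suc j), fst (w i ! j), vert i j))" for i j
    define c where "c i = map (\<lambda>j. (petal i j, snd (w i ! j))) [0..<length (w i)]" for i
    define E where "E = (\<Union>i\<in>I. petal i ` {..<length (w i)})"
    let ?R = "reachable E None"
    have finE: "finite E" using finI by (simp add: E_def)
    have prefix: "walk E None (take k (c i)) (vert i k)" if i: "i \<in> I" and "k \<le> length (w i)" for i k
      using that(2)
    proof (induction k)
      case (Suc k)
      have "walk E (vert i k) [c i ! k] (vert i (Suc k))"
      proof -
        have "petal i k \<in> E" using Suc.prems i unfolding E_def by (intro UN_I[of i] imageI) auto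
        moreover have "step_from (c i ! k) = vert i k" "step_to (c i ! k) = vert i (Suc k)"
          "fst (c i ! k) = petal i k"
          using Suc.prems by (auto simp: c_def petal_def step_from_def step_to_def)
        ultimately show ?thesis by simp
      qed
      moreover have "take (Suc k) (c i) = take k (c i) @ [c i ! k]"
        using Suc.prems by (simp add: c_def take_Suc_conv_app_nth)
      ultimately show ?case using Suc by (auto simp: walk_append simp del: walk.simps)
    qed (simp add: vert_def)
    have closed: "walk E None (c i) None" if i: "i \<in> I" for i
      using prefix[OF i, of "length (w i)"] by (simp add: c_def vert_def)
    have l: "lab ` E \<subseteq> I"
    proof -
      have "fst (w i ! j) \<in> I" if "i \<in> I" "j < length (w i)" for i j
        using w(1)[OF that(1)] nth_mem[OF that(2)] by blast
      then show ?thesis by (auto simp: E_def petal_def)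
    qed
    have vert_reach: "vert i j \<in> ?R" if "i \<in> I" "j \<le> length (w i)" for i j
      using prefix[OF that] by (auto simp: reachable_def)
    have src: "source ` E \<subseteq> ?R"
      using vert_reach by (auto simp: E_def petal_def)
    have euler: "card E + 1 \<le> card ?R + card I"
    proof -
      have "card E \<le> (\<Sum>i\<in>I. card (petal i ` {..<length (w i)}))"
        unfolding E_def by (rule card_UN_le[OF finI])
      also have "\<dots> \<le> (\<Sum>i\<in>I. length (w i))"
        by (rule sum_mono) (metis card_image_le card_lessThan finite_lessThan)
      also have "\<dots> = (\<Sum>i\<in>I. (length (w i) - 1) + 1)"
        using nonempty by (intro sum.cong) auto
      also have "\<dots> = (\<Sum>i\<in>I. length (w i) - 1) + card I" by (simp only: sum.distrib) simp
      finally have E_le: "card E \<le> (\<Sum>i\<in>I. length (w i) - 1) + card I" .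
      let ?inner = "Some ` (SIGMA i:I. {1..<length (w i)})"
      have "card (insert None ?inner) = Suc (\<Sum>i\<in>I. length (w i) - 1)"
        using finI by (subst card_insert_disjoint) (auto simp: card_image)
      moreover have "insert None ?inner \<subseteq> ?R"
      proof -
        have "Some (i, j) \<in> ?R" if "i \<in> I" "1 \<le> j" "j < length (w i)" for i j
          using vert_reach[of i j] that by (simp add: vert_def)
        then show ?thesis using reachable_refl[of None E] by auto
      qed
      ultimately have "Suc (\<Sum>i\<in>I. length (w i) - 1) \<le> card ?R"
        using card_mono[OF finite_reachable(1)[OF finE]] by metis
      then show ?thesis using E_le by simp
    qed
    have "short_loop E None (\<alpha> (a i))" if i: "i \<in> I" for i
    proof -
      have "count_list (map fst (c i)) e \<le> 3" for e
      proof -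
        let ?J = "{j. j < length (w i) \<and> petal i j = e}"
        have "count_list (map fst (c i)) e = card ?J"
          by (auto simp: count_list_eq_length_filter length_filter_conv_card c_def intro!: arg_cong[where f = card])
        moreover have "card ?J \<le> 3"
        proof (cases "\<exists>j0. Some (i, j0) \<in> {source e, target e}")
          case True
          then obtain j0 where j0: "Some (i, j0) \<in> {source e, target e}" by blast
          \<comment> \<open>The edge starts or ends at the point \<open>j0\<close> of the petal.\<close>
          have "?J \<subseteq> {j0, j0 - 1}"
            using j0 by (auto simp: petal_def vert_def split: if_splits)
          then have "card ?J \<le> card {j0, j0 - 1}" by (intro card_mono) auto
          also have "\<dots> \<le> 3" by (simp add: card_insert_if)
          finally show ?thesis .
        next
          case False
          \<comment> \<open>Both ends are the base vertex, so the petal has a single edge.\<close>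
          have "?J \<subseteq> {0}"
            using False by (force simp: petal_def vert_def split: if_splits)
          then have "card ?J \<le> card {0 :: nat}" by (intro card_mono) auto
          then show ?thesis by simp
        qed
        ultimately show ?thesis by simp
      qed
      moreover have "walk_val (c i) = \<alpha> (a i)"
      proof -
        have "map (\<lambda>(e, b). (lab e, b)) (c i) = w i"
          by (rule nth_equalityI) (auto simp: c_def petal_def prod_eq_iff)
        then show ?thesis using word_val_map[of F a lab "c i"] w(2)[OF i] by (simp add: comp_def)
      qed
      ultimately show ?thesis using closed[OF i] by (auto simp: short_loop_def)
    qed
    moreover have "infinite (UNIV :: ('i \<times> nat) option set)"
      by (simp add: finite_prod)
    ultimately show ?thesis
      by (intro short_loops_generated[OF finI _ finE l src euler \<alpha>])
  qed
  moreover have "?\<Psi> \<subseteq> auto F" by (auto simp: bounded_autos_def)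
  moreover have "generate (AutoGroup F) ?\<Psi> \<subseteq> auto F"
    using G.generate_incl[of ?\<Psi>] \<open>?\<Psi> \<subseteq> auto F\<close> by (simp add: carrier_AutoGroup)
  ultimately have "finite_generating_set (AutoGroup F) ?\<Psi>"
    using finite_bounded_autos[OF finI] by (auto simp: finite_generating_set_def carrier_AutoGroup)
  then show ?thesis by (auto simp: finitely_generated_def)
qed

end

section \<open>Coset graphs\<close>

context free_group
begin

text \<open>The vertices are right cosets, so that walks starting at \<open>B\<close> and words in the basis match: such a
  walk ends at \<open>B\<close> exactly if its value is in \<open>B\<close>.\<close>

definition coset_graph :: "'a set \<Rightarrow> ('a set, 'i) edge set" where
  "coset_graph B = {(C, i, C #> a i) | C i. C \<in> rcosets B \<and> i \<in> I}"

fun coset_walk :: "'a set \<Rightarrow> ('i \<times> bool) list \<Rightarrow> (('a set, 'i) edge \<times> bool) list" where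
  "coset_walk C [] = []"
| "coset_walk C ((i, True) # w) = ((C, i, C #> a i), True) # coset_walk (C #> a i) w"
| "coset_walk C ((i, False) # w) = ((C #> inv (a i), i, C), False) # coset_walk (C #> inv (a i)) w"

lemma length_coset_walk [simp]: "length (coset_walk C w) = length w"
  by (induction C w rule: coset_walk.induct) auto

lemma coset_graph_labels: "lab ` coset_graph B \<subseteq> I"
  by (auto simp: coset_graph_def)

lemma step_from_coset_walk:
  assumes "C \<subseteq> carrier F" "fst ` set w \<subseteq> I" "m < length w"
  shows "step_from (coset_walk C w ! m) = C #> word_val F a (take m w)"
  using assms
proof (induction C w arbitrary: m rule: coset_walk.induct)
  case (2 C i w)
  then have i: "a i \<in> carrier F" and w: "fst ` set w \<subseteq> I" by auto
  show ?case
  proof (cases m)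
    case 0
    then show ?thesis using 2 by simp
  next
    case (Suc k)
    have "fst ` set (take k w) \<subseteq> I" using w set_take_subset[of k w] by fastforce
    then have "(C #> a i) #> word_val F a (take k w) = C #> (a i \<otimes> word_val F a (take k w))"
      using coset_mult_assoc[OF 2(2) i] by blast
    then show ?thesis using 2 Suc i by (simp add: r_coset_subset_G)
  qed
next
  case (3 C i w)
  then have i: "inv (a i) \<in> carrier F" and w: "fst ` set w \<subseteq> I" by auto
  show ?case
  proof (cases m)
    case 0
    then show ?thesis using 3 by simp
  next
    case (Suc k)
    have "fst ` set (take k w) \<subseteq> I" using w set_take_subset[of k w] by fastforce
    then have "(C #> inv (a i)) #> word_val F a (take k w) = C #> (inv (a i) \<otimes> word_val F a (take k w))"
      using coset_mult_assoc[OF 3(2) i] by blast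
    then show ?thesis using 3 Suc i by (simp add: r_coset_subset_G)
  qed
qed simp

lemma walk_val_coset_walk: "walk_val (coset_walk C w) = word_val F a w"
  by (induction C w rule: coset_walk.induct) auto

lemma rcoset_subset: "subgroup B F \<Longrightarrow> C \<in> rcosets B \<Longrightarrow> C \<subseteq> carrier F"
  using rcosets_part_G by blast

lemma rcoset_mult: "subgroup B F \<Longrightarrow> C \<in> rcosets B \<Longrightarrow> x \<in> carrier F \<Longrightarrow> C #> x \<in> rcosets B"
  by (auto simp: RCOSETS_def coset_mult_assoc subgroup.subset)

lemma rcoset_mult_cancel:
  "C \<subseteq> carrier F \<Longrightarrow> x \<in> carrier F \<Longrightarrow> (C #> x) #> inv x = C"
  "C \<subseteq> carrier F \<Longrightarrow> x \<in> carrier F \<Longrightarrow> (C #> inv x) #> x = C"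
  by (simp_all add: coset_mult_assoc)

lemma base_rcoset: "subgroup B F \<Longrightarrow> B \<in> rcosets B"
  using rcosetsI[of B \<one>] subgroup.subset[of B F] by simp

lemma coset_graphE:
  assumes "subgroup B F" "e \<in> coset_graph B"
  obtains "source e \<in> rcosets B" "lab e \<in> I" "target e = source e #> a (lab e)"
    "target e \<in> rcosets B"
  using assms rcoset_mult[OF assms(1)] by (auto simp: coset_graph_def)

lemma walk_coset_walk:
  assumes "subgroup B F" "C \<in> rcosets B" "fst ` set w \<subseteq> I"
  shows "walk (coset_graph B) C (coset_walk C w) (C #> word_val F a w)"
  using assms(2,3)
proof (induction C w rule: coset_walk.induct)
  case (1 C)
  then show ?case using rcoset_subset[OF assms(1)] by simp
next
  case (2 C i w)
  then have i: "i \<in> I" "a i \<in> carrier F" and w: "word_val F a w \<in> carrier F" by auto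
  have C: "C \<subseteq> carrier F" "C #> a i \<in> rcosets B"
    using 2 i rcoset_subset[OF assms(1)] rcoset_mult[OF assms(1)] by auto
  have "(C, i, C #> a i) \<in> coset_graph B" using 2 i by (auto simp: coset_graph_def)
  then show ?case using 2 C i w by (simp add: coset_mult_assoc)
next
  case (3 C i w)
  then have i: "i \<in> I" "a i \<in> carrier F" and w: "word_val F a w \<in> carrier F" by auto
  have C: "C \<subseteq> carrier F" "C #> inv (a i) \<in> rcosets B"
    using 3 i rcoset_subset[OF assms(1)] rcoset_mult[OF assms(1)] by auto
  have "(C #> inv (a i), i, C) \<in> coset_graph B"
    using C i by (auto simp: coset_graph_def rcoset_mult_cancel)
  then show ?case using 3 C i w by (simp add: coset_mult_assoc)
qed

lemma walk_coset_graph_end: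
  assumes "subgroup B F" "walk (coset_graph B) C c C'" "C \<in> rcosets B"
  shows "C' = C #> walk_val c"
  using assms(2,3)
proof (induction c arbitrary: C)
  case Nil
  then show ?case using rcoset_subset[OF assms(1)] by simp
next
  case (Cons s c)
  obtain e b where s: "s = (e, b)" by fastforce
  have e: "e \<in> coset_graph B" and C: "C = step_from s" and c: "walk (coset_graph B) (step_to s) c C'"
    using Cons.prems s by auto
  obtain se: "source e \<in> rcosets B" "lab e \<in> I" "target e = source e #> a (lab e)" "target e \<in> rcosets B"
    using coset_graphE[OF assms(1) e] .
  have sub: "source e \<subseteq> carrier F" using rcoset_subset[OF assms(1) se(1)] .
  have i: "a (lab e) \<in> carrier F" using se(2) by simp
  have wc: "walk_val c \<in> carrier F" using walk_val_closed[OF c coset_graph_labels] .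
  have m: "step_to s \<in> rcosets B" using se s by (cases b) auto
  have IH: "C' = step_to s #> walk_val c" using Cons.IH[OF c m] .
  have C_sub: "C \<subseteq> carrier F" using Cons.prems(2) rcoset_subset[OF assms(1)] by simp
  have "step_to s = C #> letter_val F (\<lambda>e. a (lab e)) s"
    using s C se(3) sub i by (cases b) (simp_all add: letter_val_def rcoset_mult_cancel)
  moreover have "letter_val F (\<lambda>e. a (lab e)) s \<in> carrier F"
    using s i by (auto intro: letter_val_closed)
  ultimately show ?case using IH wc C_sub by (simp add: word_val_Cons coset_mult_assoc)
qed

lemma closed_walk_val_in_subgroup:
  assumes "subgroup B F" "walk (coset_graph B) B c B"
  shows "walk_val c \<in> B"
  using walk_coset_graph_end[OF assms base_rcoset[OF assms(1)]] coset_join1[of B "walk_val c"]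
    walk_val_closed[OF assms(2) coset_graph_labels] assms(1) by simp

lemma subgroup_closed_walk:
  assumes "subgroup B F" "x \<in> B"
  obtains c where "walk (coset_graph B) B c B" "walk_val c = x"
proof -
  have x: "x \<in> carrier F" using assms subgroup.mem_carrier by metis
  obtain w where w: "fst ` set w \<subseteq> I" "word_val F a w = x" using ex_word_val[OF x] by blast
  have "B #> x = B" using coset_join2[OF x assms] .
  then show ?thesis
    using that walk_coset_walk[OF assms(1) base_rcoset[OF assms(1)] w(1)] w(2)
      walk_val_coset_walk[of B w] by simp
qed

lemma coset_graph_connected:
  assumes "subgroup B F"
  shows "source ` coset_graph B \<subseteq> reachable (coset_graph B) B"
proof (rule image_subsetI)
  fix e assume "e \<in> coset_graph B"
  then have "source e \<in> rcosets B" by (auto simp: coset_graph_def)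
  then obtain x where x: "x \<in> carrier F" "source e = B #> x" by (auto simp: RCOSETS_def)
  obtain w where w: "fst ` set w \<subseteq> I" "word_val F a w = x" using ex_word_val[OF x(1)] by blast
  show "source e \<in> reachable (coset_graph B) B"
    using walk_coset_walk[OF assms base_rcoset[OF assms] w(1)] w(2) x(2) by (auto simp: reachable_def)
qed

section \<open>The rank of a coset graph\<close>

definition parity :: "('v, 'i) edge set \<Rightarrow> (('v, 'i) edge \<times> bool) list \<Rightarrow> bool" where
  "parity f c \<longleftrightarrow> odd (length (filter (\<lambda>s. fst s \<in> f) c))"

lemma parity_simps [simp]:
  "parity f [] = False" "parity f (s # c) = (parity f c \<noteq> (fst s \<in> f))"
  "parity f (c @ d) = (parity f c \<noteq> parity f d)"
  by (auto simp: parity_def)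

lemma parity_inv_word [simp]: "parity f (inv_word c) = parity f c"
  by (induction c) (auto simp: inv_word_def split_def)

text \<open>Counting crossings of \<open>f\<close> modulo 2 is holonomy in the double cover of the coset graph in which
  the edges of \<open>f\<close> switch sheets. The free group acts on the vertices of this cover, so the
  holonomy depends on the value of a closed walk only.\<close>

lemma parity_depends_on_value:
  assumes B: "subgroup B F" and f: "f \<subseteq> coset_graph B"
    and c: "walk (coset_graph B) B c B" and d: "walk (coset_graph B) B d B"
    and eq: "walk_val c = walk_val d"
  shows "parity f c = parity f d"
proof -
  let ?E = "coset_graph B" and ?V = "(rcosets B) \<times> (UNIV :: bool set)"
  define cover where "cover =
    {((p, b), i, (q, b \<noteq> ((p, i, q) \<in> f))) | p i q b. (p, i, q) \<in> ?E}"
  define act where "act i = (\<lambda>(q, b)\<in>?V. (q #> inv (a i), b \<noteq> ((q #> inv (a i), i, q) \<in> f)))" for i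
  define act' where "act' i = (\<lambda>(p, b). (p #> a i, b \<noteq> ((p, i, p #> a i) \<in> f)))" for i
  note cancel = rcoset_mult_cancel[OF rcoset_subset[OF B]]
  have bij: "act i \<in> Bij ?V" if i: "i \<in> I" for i
  proof -
    have "bij_betw (act i) ?V ?V"
      by (rule bij_betw_byWitness[where f' = "act' i"])
         (use i in \<open>auto simp: act_def act'_def cancel rcoset_mult[OF B]\<close>)
    then show ?thesis by (simp add: Bij_def act_def)
  qed
  then have "act ` I \<subseteq> carrier (BijGroup ?V)" by (auto simp: carrier_BijGroup)
  then obtain h where h: "h \<in> hom F (BijGroup ?V)" "\<And>i. i \<in> I \<Longrightarrow> h (a i) = act i"
    using hom_extension[OF group_BijGroup] by metis
  have cover_sub: "cover \<subseteq> ?V \<times> I \<times> ?V"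
    using rcoset_mult[OF B] by (auto simp: cover_def coset_graph_def)
  have trace: "h (a i) q = p" if "(p, i, q) \<in> cover" for p i q
    using that h(2) rcoset_mult[OF B]
    by (auto simp: cover_def coset_graph_def act_def cancel)
  have lift: "\<exists>c'. walk cover (u, b) c' (v, b \<noteq> parity f c) \<and> walk_val c' = walk_val c"
    if "walk ?E u c v" for u v b c
    using that
  proof (induction c arbitrary: u b)
    case Nil
    show ?case using Nil by (intro exI[of _ "[]"]) simp
  next
    case (Cons s c)
    obtain p i q \<beta> where s: "s = ((p, i, q), \<beta>)" by (cases s) auto
    let ?fl = "(p, i, q) \<in> f"
    define b0 where "b0 = (if \<beta> then b else b \<noteq> ?fl)"
    let ?s = "(((p, b0), i, (q, b0 \<noteq> ?fl)), \<beta>)"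
    have "(p, i, q) \<in> ?E" and rest: "walk ?E (step_to s) c v" using Cons.prems s by auto
    obtain c' where c': "walk cover (step_to s, b \<noteq> ?fl) c' (v, (b \<noteq> ?fl) \<noteq> parity f c)"
      "walk_val c' = walk_val c" using Cons.IH[OF rest, of "b \<noteq> ?fl"] by (elim exE conjE)
    have "fst ?s \<in> cover" using \<open>(p, i, q) \<in> ?E\<close> by (auto simp: cover_def)
    moreover have "step_from ?s = (u, b)" "step_to ?s = (step_to s, b \<noteq> ?fl)"
      using Cons.prems s by (cases \<beta>; auto simp: b0_def)+
    ultimately have "walk cover (u, b) (?s # c') (v, (b \<noteq> ?fl) \<noteq> parity f c)"
      using c'(1) by simp
    moreover have "((b \<noteq> ?fl) \<noteq> parity f c) = (b \<noteq> parity f (s # c))" using s by auto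
    moreover have "walk_val (?s # c') = walk_val (s # c)"
      using c'(2) s by (simp add: word_val_Cons letter_val_def)
    ultimately show ?case by (intro exI[of _ "?s # c'"]) simp
  qed
  have holonomy: "h (walk_val c) (B, False \<noteq> parity f c) = (B, False)" if c: "walk ?E B c B" for c
  proof -
    obtain c' where c': "walk cover (B, False) c' (B, False \<noteq> parity f c)" "walk_val c' = walk_val c"
      using lift[OF c, of False] by (elim exE conjE)
    have "h (walk_val c') (B, False \<noteq> parity f c) = (B, False)"
      by (rule walk_val_acts[OF h(1) cover_sub trace c'(1)]) (simp_all add: base_rcoset[OF B])
    then show ?thesis by (simp only: c'(2))
  qed
  have "h (walk_val c) \<in> Bij ?V"
    using hom_in_carrier[OF h(1) walk_val_closed[OF c coset_graph_labels]] by (simp add: carrier_BijGroup)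
  then have inj: "inj_on (h (walk_val c)) ?V" by (simp add: Bij_def bij_betw_def)
  have "(B, False \<noteq> parity f c) = (B, False \<noteq> parity f d)"
  proof (rule inj_onD[OF inj])
    show "h (walk_val c) (B, False \<noteq> parity f c) = h (walk_val c) (B, False \<noteq> parity f d)"
      by (simp only: holonomy[OF c] holonomy[OF d, folded eq])
  qed (simp_all add: base_rcoset[OF B])
  then show ?thesis by simp
qed

lemma parity_tree_loop:
  assumes "spanning_tree E v0 P T" "e \<in> E - P" "source e \<in> reachable E v0" "f \<inter> P = {}"
  shows "parity f (tree_loop T e) \<longleftrightarrow> e \<in> f"
proof -
  have "target e \<in> reachable E v0"
    using assms reachable_ends[of "source e" "lab e" "target e" E v0] by simp
  then have "fst ` set (T (source e)) \<subseteq> P" "fst ` set (T (target e)) \<subseteq> P"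
    using assms by (auto simp: spanning_tree_def)
  then have "filter (\<lambda>s. fst s \<in> f) (T (source e)) = []" "filter (\<lambda>s. fst s \<in> f) (T (target e)) = []"
    using assms(4) by (auto simp: filter_empty_conv)
  then have "\<not> parity f (T (source e))" "\<not> parity f (T (target e))" by (simp_all add: parity_def)
  then show ?thesis by (simp add: tree_loop_def)
qed

lemma parity_subst_walk:
  assumes "\<And>j. j \<in> fst ` set w \<Longrightarrow> parity f (c j) = parity g (c j)"
  shows "parity f (subst_walk c w) = parity g (subst_walk c w)"
  using assms
proof (induction w)
  case (Cons l w)
  obtain j b where "l = (j, b)" by fastforce
  then have "parity h (subst_walk c (l # w)) = (parity h (c j) \<noteq> parity h (subst_walk c w))" for h
    by (cases b) (simp_all add: subst_walk_def)
  then show ?case using Cons \<open>l = (j, b)\<close> by simp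
qed (simp add: subst_walk_def)

text \<open>Every set \<open>f\<close> of edges outside the tree is determined by the parities of its crossings with the
  loops of the tree, and these by the parities for \<open>card J\<close> closed walks that represent the generators
  \<open>x j\<close>. So a finite set of edges outside the tree has at most \<open>2 ^ card J\<close> subsets.\<close>

theorem coset_graph_rank_le:
  assumes B: "subgroup B F" and x: "x ` J \<subseteq> carrier F" "generate F (x ` J) = B" and "finite J"
    and st: "spanning_tree (coset_graph B) B P T"
  shows "finite (coset_graph B - P)" "card (coset_graph B - P) \<le> card J"
proof -
  let ?E = "coset_graph B"
  have "\<forall>j\<in>J. \<exists>c. walk ?E B c B \<and> walk_val c = x j"
  proof
    fix j assume "j \<in> J"
    then have "x j \<in> B" using x(2) generate.incl[of "x j" "x ` J" F] by auto
    then show "\<exists>c. walk ?E B c B \<and> walk_val c = x j"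
      by (rule subgroup_closed_walk[OF B]) blast
  qed
  then obtain c where c: "\<And>j. j \<in> J \<Longrightarrow> walk ?E B (c j) B" "\<And>j. j \<in> J \<Longrightarrow> walk_val (c j) = x j"
    using bchoice[of J "\<lambda>j c. walk ?E B c B \<and> walk_val c = x j"] by blast
  have "card Q \<le> card J" if Q: "Q \<subseteq> ?E - P" "finite Q" for Q
  proof -
    let ?\<chi> = "\<lambda>f. {j \<in> J. parity f (c j)}"
    have "inj_on ?\<chi> (Pow Q)"
    proof (rule inj_onI)
      fix f g assume fg: "f \<in> Pow Q" "g \<in> Pow Q" "?\<chi> f = ?\<chi> g"
      then have sub: "f \<subseteq> ?E" "g \<subseteq> ?E" "f \<inter> P = {}" "g \<inter> P = {}" using Q by auto
      have "e \<in> f \<longleftrightarrow> e \<in> g" if e: "e \<in> Q" for e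
      proof -
        have eE: "e \<in> ?E - P" "source e \<in> reachable ?E B"
          using e Q coset_graph_connected[OF B] by auto
        have loop: "walk ?E B (tree_loop T e) B" using walk_tree_loop[OF st _ eE(2)] eE(1) by simp
        then have "walk_val (tree_loop T e) \<in> generate F (x ` J)"
          using closed_walk_val_in_subgroup[OF B] x(2) by simp
        then obtain w where w: "fst ` set w \<subseteq> J" "word_val F x w = walk_val (tree_loop T e)"
          using generate_word_val[OF x(1)] by blast
        have "word_val F (\<lambda>j. walk_val (c j)) w = word_val F x w"
          using w(1) c(2) by (intro word_val_cong) auto
        then have sw: "walk ?E B (subst_walk c w) B" "walk_val (tree_loop T e) = walk_val (subst_walk c w)"
          using subst_walk_closed[OF coset_graph_labels c(1) w(1)] w(2) by auto
        have "parity f (subst_walk c w) = parity g (subst_walk c w)"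
          using fg(3) w(1) by (intro parity_subst_walk) blast
        then have "parity f (tree_loop T e) = parity g (tree_loop T e)"
          using parity_depends_on_value[OF B sub(1) loop sw] parity_depends_on_value[OF B sub(2) loop sw] by simp
        then show ?thesis
          using parity_tree_loop[OF st eE sub(3)] parity_tree_loop[OF st eE sub(4)] by simp
      qed
      then show "f = g" using fg by blast
    qed
    moreover have "?\<chi> ` Pow Q \<subseteq> Pow J" by auto
    ultimately have "card (Pow Q) \<le> card (Pow J)" using \<open>finite J\<close> by (intro card_inj_on_le) auto
    then show ?thesis using \<open>finite J\<close> Q(2) by (simp add: card_Pow)
  qed
  then show "finite (?E - P)" "card (?E - P) \<le> card J"
    using finite_if_finite_subsets_card_bdd[of "?E - P" "card J"] by blast+
qed

lemma short_tuple_cong: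
  assumes "\<And>j. j \<in> J \<Longrightarrow> \<beta> j = \<gamma> j"
  shows "short_tuple E v0 J \<beta> \<longleftrightarrow> short_tuple E v0 J \<gamma>"
proof -
  have "word_val F \<beta> w = word_val F \<gamma> w" if "fst ` set w \<subseteq> J" for w
    using that assms by (intro word_val_cong) auto
  then show ?thesis unfolding short_tuple_def using assms by (simp cong: conj_cong)
qed

section \<open>The retraction\<close>

definition factor :: "'i set \<Rightarrow> 'a set" where
  "factor J = generate F (a ` J)"

text \<open>The stabilizer of a free factor with the complementary basis elements fixed, for a factor spanned by
  an arbitrary part \<open>J\<close> of the basis.\<close>

definition factor_autos :: "'i set \<Rightarrow> ('a \<Rightarrow> 'a) set" where
  "factor_autos J = {\<phi> \<in> auto F. \<phi> ` factor J = factor J \<and> (\<forall>i\<in>I - J. \<phi> (a i) = a i)}"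

definition preimage :: "('a \<Rightarrow> 'a) \<Rightarrow> 'a set \<Rightarrow> 'a set" where
  "preimage \<phi> B = {x \<in> carrier F. \<phi> x \<in> B}"

lemma factor_subgroup: "J \<subseteq> I \<Longrightarrow> subgroup (factor J) F"
  unfolding factor_def by (rule generate_is_subgroup) auto

lemma subgroup_factor_autos: "J \<subseteq> I \<Longrightarrow> subgroup (factor_autos J) (AutoGroup F)"
proof -
  assume J: "J \<subseteq> I"
  interpret G: group "AutoGroup F" by (rule group_AutoGroup)
  have fc: "factor J \<subseteq> carrier F" using subgroup.subset[OF factor_subgroup[OF J]] .
  show ?thesis
  proof (rule G.subgroupI)
    show "factor_autos J \<subseteq> carrier (AutoGroup F)"
      by (auto simp: factor_autos_def carrier_AutoGroup)
    have "\<one>\<^bsub>AutoGroup F\<^esub> \<in> auto F" using G.one_closed by (simp only: carrier_AutoGroup)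
    moreover have "\<one>\<^bsub>AutoGroup F\<^esub> ` factor J = factor J"
      using fc AutoGroup_one_apply by (force simp: subset_iff)
    ultimately have "\<one>\<^bsub>AutoGroup F\<^esub> \<in> factor_autos J"
      by (simp add: factor_autos_def AutoGroup_one_apply)
    then show "factor_autos J \<noteq> {}" by blast
  next
    fix \<phi> assume \<phi>: "\<phi> \<in> factor_autos J"
    then have p: "\<phi> \<in> auto F" "\<phi> ` factor J = factor J" "\<And>i. i \<in> I - J \<Longrightarrow> \<phi> (a i) = a i"
      by (auto simp: factor_autos_def)
    have "(inv\<^bsub>AutoGroup F\<^esub> \<phi>) ` \<phi> ` factor J = factor J"
      unfolding image_image using fc AutoGroup_inv_apply(1)[OF p(1)] by (force simp: subset_iff)
    then have "(inv\<^bsub>AutoGroup F\<^esub> \<phi>) ` factor J = factor J" by (simp only: p(2))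
    moreover have "(inv\<^bsub>AutoGroup F\<^esub> \<phi>) (a i) = a i" if "i \<in> I - J" for i
      using AutoGroup_inv_apply(1)[OF p(1), of "a i"] p(3)[OF that] that by simp
    ultimately show "inv\<^bsub>AutoGroup F\<^esub> \<phi> \<in> factor_autos J"
      using p(1) by (simp add: factor_autos_def)
  next
    fix \<phi> \<psi> assume "\<phi> \<in> factor_autos J" "\<psi> \<in> factor_autos J"
    then have p: "\<phi> \<in> auto F" "\<phi> ` factor J = factor J" "\<And>i. i \<in> I - J \<Longrightarrow> \<phi> (a i) = a i"
      and q: "\<psi> \<in> auto F" "\<psi> ` factor J = factor J" "\<And>i. i \<in> I - J \<Longrightarrow> \<psi> (a i) = a i"
      by (auto simp: factor_autos_def)
    have "(\<phi> \<otimes>\<^bsub>AutoGroup F\<^esub> \<psi>) ` factor J = \<phi> ` \<psi> ` factor J"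
      unfolding image_image using fc AutoGroup_mult_apply[OF p(1) q(1)] by (intro image_cong) auto
    then have "(\<phi> \<otimes>\<^bsub>AutoGroup F\<^esub> \<psi>) ` factor J = factor J" by (simp only: p(2) q(2))
    then show "\<phi> \<otimes>\<^bsub>AutoGroup F\<^esub> \<psi> \<in> factor_autos J"
      using p q AutoGroup_mult_apply[OF p(1) q(1)] by (simp add: factor_autos_def)
  qed
qed

lemma preimage_subgroup:
  assumes "\<phi> \<in> auto F" "subgroup B F"
  shows "subgroup (preimage \<phi> B) F"
proof -
  interpret group_hom F F \<phi>
    using assms by (auto simp: auto_def group_hom_def group_hom_axioms_def)
  show ?thesis
  proof (rule subgroupI)
    show "preimage \<phi> B \<noteq> {}"
      using subgroup.one_closed[OF assms(2)] by (auto simp: preimage_def intro: exI[of _ \<one>])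
  qed (use assms(2) in \<open>auto simp: preimage_def subgroup.m_closed subgroup.m_inv_closed\<close>)
qed

lemma generate_preimage_factor:
  assumes \<phi>: "\<phi> \<in> auto F" and J: "J \<subseteq> I"
  shows "generate F ((\<lambda>j. (inv\<^bsub>AutoGroup F\<^esub> \<phi>) (a j)) ` J) = preimage \<phi> (factor J)"
proof
  let ?\<theta> = "inv\<^bsub>AutoGroup F\<^esub> \<phi>"
  have \<theta>: "?\<theta> \<in> auto F" using \<phi> by simp
  have cl: "(\<lambda>j. ?\<theta> (a j)) ` J \<subseteq> carrier F" using J \<theta> by auto
  have "?\<theta> (a j) \<in> preimage \<phi> (factor J)" if "j \<in> J" for j
    using that J \<theta> AutoGroup_inv_apply(2)[OF \<phi>, of "a j"]
    by (auto simp: preimage_def factor_def intro: generate.incl)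
  then show "generate F ((\<lambda>j. ?\<theta> (a j)) ` J) \<subseteq> preimage \<phi> (factor J)"
    by (intro generate_subgroup_incl preimage_subgroup[OF \<phi> factor_subgroup[OF J]]) auto
  show "preimage \<phi> (factor J) \<subseteq> generate F ((\<lambda>j. ?\<theta> (a j)) ` J)"
  proof
    fix x assume "x \<in> preimage \<phi> (factor J)"
    then have x: "x \<in> carrier F" "\<phi> x \<in> generate F (a ` J)" by (auto simp: preimage_def factor_def)
    have aJ: "a ` J \<subseteq> carrier F" using J by auto
    obtain w where w: "fst ` set w \<subseteq> J" "word_val F a w = \<phi> x"
      using x(2) generate_word_val[OF aJ] by blast
    have "a ` fst ` set w \<subseteq> carrier F" using w(1) aJ by blast
    then have "word_val F (\<lambda>j. ?\<theta> (a j)) w = x"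
      using automorphism_word_val[OF \<theta>, of a w] w(2) AutoGroup_inv_apply(1)[OF \<phi> x(1)]
      by (simp add: comp_def)
    then show "x \<in> generate F ((\<lambda>j. ?\<theta> (a j)) ` J)"
      using generate_word_val[OF cl] w(1) by blast
  qed
qed

text \<open>\<open>\<psi>\<close> is an admissible value of the retraction at \<open>\<phi>\<close>: it fixes the basis outside \<open>J\<close> and takes the
  basis of the factor to the image under \<open>\<phi>\<close> of some short tuple of the preimage of the factor. No
  particular tree is singled out, so \<open>\<phi>\<close> itself is admissible if it is in the subgroup.\<close>

definition shadow :: "'i set \<Rightarrow> ('a \<Rightarrow> 'a) \<Rightarrow> ('a \<Rightarrow> 'a) \<Rightarrow> bool" where
  "shadow J \<phi> \<psi> \<longleftrightarrow> \<psi> \<in> factor_autos J \<and>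
     short_tuple (coset_graph (preimage \<phi> (factor J))) (preimage \<phi> (factor J)) J
       (\<lambda>j. (inv\<^bsub>AutoGroup F\<^esub> \<phi>) (\<psi> (a j)))"

text \<open>The coset graph of the factor has a loop at the base vertex for each of its basis elements, and the
  rank bound leaves no other edge outside a tree.\<close>

lemma shadow_self:
  assumes J: "J \<subseteq> I" "finite J" and \<phi>: "\<phi> \<in> factor_autos J"
  shows "shadow J \<phi> \<phi>"
proof -
  let ?B = "factor J"
  note B = factor_subgroup[OF J(1)]
  have p: "\<phi> \<in> auto F" "\<phi> ` ?B = ?B" using \<phi> by (auto simp: factor_autos_def)
  have "preimage \<phi> ?B = ?B"
  proof
    show "preimage \<phi> ?B \<subseteq> ?B"
    proof
      fix x assume "x \<in> preimage \<phi> ?B"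
      then have x: "x \<in> carrier F" "\<phi> x \<in> \<phi> ` ?B" by (auto simp: preimage_def p(2))
      then obtain y where "y \<in> ?B" "\<phi> x = \<phi> y" by blast
      moreover have "inj_on \<phi> (carrier F)" using p(1) by (auto simp: auto_def Bij_def bij_betw_def)
      ultimately show "x \<in> ?B" using x(1) subgroup.mem_carrier[OF B] by (metis inj_onD)
    qed
    show "?B \<subseteq> preimage \<phi> ?B" using p(2) subgroup.subset[OF B] by (auto simp: preimage_def)
  qed
  moreover have "short_tuple (coset_graph ?B) ?B J a"
  proof -
    obtain P T where st: "spanning_tree (coset_graph ?B) ?B P T"
      using ex_spanning_tree[of "coset_graph ?B" ?B] by blast
    have aJ: "a ` J \<subseteq> carrier F" using J by auto
    have "(\<lambda>j. (?B, j, ?B)) ` J \<subseteq> coset_graph ?B"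
    proof (rule image_subsetI)
      fix j assume j: "j \<in> J"
      then have "a j \<in> ?B" by (auto simp: factor_def intro: generate.incl)
      then have "?B #> a j = ?B" using coset_join2[OF _ B] j J by auto
      then show "(?B, j, ?B) \<in> coset_graph ?B"
        using j J base_rcoset[OF B] unfolding coset_graph_def by auto
    qed
    then show ?thesis
      using short_tuple_loops[OF st coset_graph_labels coset_graph_connected[OF B]
          coset_graph_rank_le[OF B aJ factor_def[symmetric] J(2) st] J(1)] by blast
  qed
  moreover have "(inv\<^bsub>AutoGroup F\<^esub> \<phi>) (\<phi> (a j)) = a j" if "j \<in> J" for j
    using AutoGroup_inv_apply(1)[OF p(1)] that J by auto
  ultimately show ?thesis
    unfolding shadow_def using \<phi> by (simp add: short_tuple_cong[of J "\<lambda>j. (inv\<^bsub>AutoGroup F\<^esub> \<phi>) (\<phi> (a j))" a])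
qed

text \<open>The images under \<open>\<phi>\<close> of a short tuple of the preimage generate the factor; together with the
  remaining basis elements they generate \<open>F\<close>, so they are the images of the basis under an
  automorphism.\<close>

lemma ex_shadow:
  assumes finI: "finite I" and J: "J \<subseteq> I" and \<phi>: "\<phi> \<in> auto F"
  obtains \<psi> where "shadow J \<phi> \<psi>"
proof -
  let ?A = "factor J" and ?B = "preimage \<phi> (factor J)" and ?\<theta> = "inv\<^bsub>AutoGroup F\<^esub> \<phi>"
  have finJ: "finite J" using J finI finite_subset by blast
  note A = factor_subgroup[OF J]
  note B = preimage_subgroup[OF \<phi> A]
  obtain P T where st: "spanning_tree (coset_graph ?B) ?B P T"
    using ex_spanning_tree[of "coset_graph ?B" ?B] by blast
  have cl: "(\<lambda>j. ?\<theta> (a j)) ` J \<subseteq> carrier F" using J \<phi> by auto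
  note rank = coset_graph_rank_le[OF B cl generate_preimage_factor[OF \<phi> J] finJ st]
  obtain \<beta> where \<beta>: "short_tuple (coset_graph ?B) ?B J \<beta>"
    by (rule ex_short_tuple[OF st coset_graph_labels coset_graph_connected[OF B] rank(1) finJ rank(2)])
  have \<beta>B: "\<beta> j \<in> ?B" if j: "j \<in> J" for j
  proof -
    have "short_loop (coset_graph ?B) ?B (\<beta> j)" using \<beta> j unfolding short_tuple_def by blast
    then obtain c where "walk (coset_graph ?B) ?B c ?B" "walk_val c = \<beta> j"
      unfolding short_loop_def by blast
    then show ?thesis using closed_walk_val_in_subgroup[OF B] by metis
  qed
  then have \<beta>F: "\<beta> j \<in> carrier F" if "j \<in> J" for j using that by (auto simp: preimage_def)
  define g where "g i = (if i \<in> J then \<phi> (\<beta> i) else a i)" for i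
  have gI: "g ` I \<subseteq> carrier F" using \<beta>F \<phi> by (auto simp: g_def)
  have A_words: "\<exists>w. fst ` set w \<subseteq> J \<and> word_val F g w = x" if x: "x \<in> ?A" for x
  proof -
    have xF: "x \<in> carrier F" using x subgroup.mem_carrier[OF A] by simp
    then have "?\<theta> x \<in> ?B" using \<phi> x AutoGroup_inv_apply(2)[OF \<phi> xF] by (simp add: preimage_def)
    then obtain c where c: "walk (coset_graph ?B) ?B c ?B" "walk_val c = ?\<theta> x"
      by (rule subgroup_closed_walk[OF B])
    obtain w where w: "fst ` set w \<subseteq> J" "word_val F \<beta> w = walk_val c"
      using \<beta> c(1) unfolding short_tuple_def by blast
    have "\<beta> ` fst ` set w \<subseteq> carrier F" using w(1) \<beta>F by blast
    then have "word_val F (\<phi> \<circ> \<beta>) w = x"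
      using automorphism_word_val[OF \<phi>] w(2) c(2) AutoGroup_inv_apply(2)[OF \<phi> xF] by metis
    moreover have "word_val F (\<phi> \<circ> \<beta>) w = word_val F g w"
      using w(1) by (intro word_val_cong) (auto simp: g_def)
    ultimately show ?thesis using w(1) by auto
  qed
  have "a i \<in> generate F (g ` I)" if i: "i \<in> I" for i
  proof (cases "i \<in> J")
    case True
    then have "a i \<in> ?A" by (auto simp: factor_def intro: generate.incl)
    then obtain w where "fst ` set w \<subseteq> J" "word_val F g w = a i" using A_words by blast
    then show ?thesis using generate_word_val[OF gI] J by blast
  next
    case False
    then have "a i = g i" by (simp add: g_def)
    then show ?thesis using i by (auto intro: generate.incl)
  qed
  then have "generate F (a ` I) \<subseteq> generate F (g ` I)"
    by (intro generate_subgroup_incl[OF _ generate_is_subgroup[OF gI]]) auto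
  then have "generate F (g ` I) = carrier F" using generate_basis generate_incl[OF gI] by auto
  then obtain \<psi> where \<psi>: "\<psi> \<in> auto F" "\<And>i. i \<in> I \<Longrightarrow> \<psi> (a i) = g i"
    using generating_tuple_automorphism[OF finI gI] by blast
  have \<psi>_word: "\<psi> (word_val F a w) = word_val F g w" if w: "fst ` set w \<subseteq> J" for w
  proof -
    have "a ` fst ` set w \<subseteq> carrier F" using w J by auto
    then have "\<psi> (word_val F a w) = word_val F (\<psi> \<circ> a) w" by (rule automorphism_word_val[OF \<psi>(1)])
    also have "\<dots> = word_val F g w" using w J \<psi>(2) by (intro word_val_cong) auto
    finally show ?thesis .
  qed
  have aJ: "a ` J \<subseteq> carrier F" using J by auto
  have "\<psi> ` ?A = ?A"
  proof
    show "?A \<subseteq> \<psi> ` ?A"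
    proof
      fix x assume "x \<in> ?A"
      then obtain w where w: "fst ` set w \<subseteq> J" "word_val F g w = x" using A_words by blast
      then show "x \<in> \<psi> ` ?A"
        using \<psi>_word[OF w(1)] word_val_in_generate[OF w(1), of a] unfolding factor_def by (metis imageI)
    qed
    show "\<psi> ` ?A \<subseteq> ?A"
    proof (rule image_subsetI)
      fix x assume "x \<in> ?A"
      then obtain w where w: "fst ` set w \<subseteq> J" "word_val F a w = x"
        using generate_word_val[OF aJ] by (auto simp: factor_def)
      have "g ` J \<subseteq> ?A" using \<beta>B by (auto simp: g_def preimage_def)
      then have "generate F (g ` J) \<subseteq> ?A" by (rule generate_subgroup_incl[OF _ A])
      then show "\<psi> x \<in> ?A" using \<psi>_word[OF w(1)] w(2) word_val_in_generate[OF w(1), of g] by auto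
    qed
  qed
  then have "\<psi> \<in> factor_autos J" using \<psi> by (auto simp: factor_autos_def g_def)
  moreover have "?\<theta> (\<psi> (a j)) = \<beta> j" if j: "j \<in> J" for j
    using \<psi>(2)[of j] j J AutoGroup_inv_apply(1)[OF \<phi> \<beta>F[OF j]] by (auto simp: g_def)
  ultimately have "shadow J \<phi> \<psi>"
    unfolding shadow_def using \<beta> by (simp add: short_tuple_cong[of J "\<lambda>j. ?\<theta> (\<psi> (a j))" \<beta>])
  then show ?thesis using that by blast
qed

text \<open>\<open>\<sigma>\<close> replaces an edge with label \<open>i\<close> by the walk that spells \<open>W i\<close>, and \<open>D\<close> collects the edges whose
  walk meets \<open>N\<close>. Since \<open>\<sigma>\<close> is injective on cosets, such an edge can be recovered from the edge in \<open>N\<close>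
  that is met, the direction in which it is crossed, the label \<open>i\<close> and the position in \<open>W i\<close>.\<close>

lemma automorphism_coset_graph_crossings:
  assumes finI: "finite I" and \<sigma>: "\<sigma> \<in> auto F" and B: "subgroup B F"
    and N: "finite N" and W: "\<And>i. i \<in> I \<Longrightarrow> fst ` set (W i) \<subseteq> I" "\<And>i. i \<in> I \<Longrightarrow> length (W i) \<le> L"
    and D: "D = {e \<in> coset_graph (preimage \<sigma> B).
      \<exists>t\<in>set (coset_walk (\<sigma> ` source e) (W (lab e))). fst t \<in> N}"
  shows "finite D" "card D \<le> card N * (2 * (card I * L))"
proof -
  note B' = preimage_subgroup[OF \<sigma> B]
  define G where "G = (\<lambda>(e :: ('a set, 'i) edge, b, i, m).
    let p = preimage \<sigma> (step_from (e, b) #> inv (word_val F a (take m (W i)))) in (p, i, p #> a i))"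
  let ?S = "N \<times> (UNIV :: bool set) \<times> I \<times> {..<L}"
  have sub: "D \<subseteq> G ` ?S"
  proof
    fix e assume "e \<in> D"
    then obtain t where e: "e \<in> coset_graph (preimage \<sigma> B)"
      and t: "t \<in> set (coset_walk (\<sigma> ` source e) (W (lab e)))" "fst t \<in> N" using D by blast
    obtain se: "source e \<in> rcosets (preimage \<sigma> B)" "lab e \<in> I" "target e = source e #> a (lab e)"
      using coset_graphE[OF B' e] by metis
    let ?p = "source e" and ?i = "lab e"
    have p: "?p \<subseteq> carrier F" by (rule rcoset_subset[OF B' se(1)])
    then have sp: "\<sigma> ` ?p \<subseteq> carrier F" using \<sigma> by auto
    obtain m where m: "m < length (W ?i)" "t = coset_walk (\<sigma> ` ?p) (W ?i) ! m"
      using t(1) by (auto simp: in_set_conv_nth)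
    have "fst ` set (take m (W ?i)) \<subseteq> I" using W(1)[OF se(2)] set_take_subset[of m "W ?i"] by blast
    then have v: "word_val F a (take m (W ?i)) \<in> carrier F" by auto
    have "step_from t #> inv (word_val F a (take m (W ?i))) = \<sigma> ` ?p"
      using step_from_coset_walk[OF sp W(1)[OF se(2)] m(1)] m(2) rcoset_mult_cancel(1)[OF sp v] by simp
    moreover have "preimage \<sigma> (\<sigma> ` ?p) = ?p"
    proof -
      have "inj_on \<sigma> (carrier F)" using \<sigma> by (auto simp: auto_def Bij_def bij_betw_def)
      then show ?thesis using p by (auto simp: preimage_def inj_on_def subset_iff)
    qed
    ultimately have "e = G (fst t, snd t, ?i, m)"
      using se(3) by (simp add: G_def Let_def prod_eq_iff)
    moreover have "m < L" using m(1) W(2)[OF se(2)] by simp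
    ultimately show "e \<in> G ` ?S" using t(2) se(2) by (intro image_eqI) auto
  qed
  have fin: "finite ?S" using finI N by simp
  show "finite D" using finite_subset[OF sub] fin by simp
  have "card D \<le> card (G ` ?S)" using fin by (intro card_mono[OF _ sub]) simp
  also have "\<dots> \<le> card ?S" by (rule card_image_le[OF fin])
  also have "\<dots> = card N * (2 * (card I * L))" by (simp add: card_cartesian_product)
  finally show "card D \<le> card N * (2 * (card I * L))" .
qed

text \<open>Applying \<open>\<sigma>\<close> edge by edge turns the short loop into a closed walk at \<open>B\<close>. Its crossings of the set
  \<open>N\<close> of the tuple come from at most \<open>card D\<close> edges, each crossed at most three times and replaced by a
  walk of length at most \<open>L\<close>.\<close>

lemma automorphism_short_loop:
  assumes finI: "finite I" and \<sigma>: "\<sigma> \<in> auto F" and B: "subgroup B F"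
    and W: "\<And>i. i \<in> I \<Longrightarrow> fst ` set (W i) \<subseteq> I" "\<And>i. i \<in> I \<Longrightarrow> length (W i) \<le> L"
      "\<And>i. i \<in> I \<Longrightarrow> word_val F a (W i) = \<sigma> (a i)"
    and \<beta>: "short_tuple (coset_graph B) B J \<beta>"
    and x: "short_loop (coset_graph (preimage \<sigma> B)) (preimage \<sigma> B) x"
  shows "\<exists>w. length w \<le> 3 * (card J * (2 * (card I * L))) * L \<and> fst ` set w \<subseteq> J \<and>
    word_val F \<beta> w = \<sigma> x"
proof -
  let ?B' = "preimage \<sigma> B"
  let ?E = "coset_graph B" and ?E' = "coset_graph ?B'"
  note B' = preimage_subgroup[OF \<sigma> B]
  interpret \<sigma>: group_hom F F \<sigma>
    using \<sigma> by (auto simp: auto_def group_hom_def group_hom_axioms_def)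
  have surj: "\<sigma> ` carrier F = carrier F" using \<sigma> by (auto simp: auto_def Bij_def bij_betw_def)
  have im_coset: "\<sigma> ` (C #> y) = \<sigma> ` C #> \<sigma> y" if "C \<subseteq> carrier F" "y \<in> carrier F" for C y
    using that by (force simp: r_coset_def)
  have im_B': "\<sigma> ` ?B' = B"
    using surj subgroup.subset[OF B] by (auto simp: preimage_def)
  have im_rcoset: "\<sigma> ` C \<in> rcosets B" if C: "C \<in> rcosets ?B'" for C
  proof -
    obtain y where y: "y \<in> carrier F" "C = ?B' #> y" using C by (auto simp: RCOSETS_def)
    then have "\<sigma> ` C = B #> \<sigma> y" using im_coset[OF subgroup.subset[OF B'] y(1)] im_B' by simp
    then show ?thesis using y(1) rcosetsI[OF subgroup.subset[OF B]] by simp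
  qed
  define f where "f s = (let v = coset_walk (\<sigma> ` source (fst s)) (W (lab (fst s)))
    in if snd s then v else inv_word v)" for s :: "('a set, 'i) edge \<times> bool"
  have f: "walk ?E (\<sigma> ` u) (concat (map f c)) (\<sigma> ` v) \<and> walk_val (concat (map f c)) = \<sigma> (walk_val c)"
    if "walk ?E' u c v" for u c v
    using that
  proof (induction c arbitrary: u)
    case (Cons s c)
    obtain e b where s: "s = (e, b)" by fastforce
    have e: "e \<in> ?E'" and c: "walk ?E' (step_to s) c v" and u: "u = step_from s" using Cons.prems s by auto
    obtain se: "source e \<in> rcosets ?B'" "lab e \<in> I" "target e = source e #> a (lab e)"
      using coset_graphE[OF B' e] by metis
    let ?v = "coset_walk (\<sigma> ` source e) (W (lab e))"
    have "walk ?E (\<sigma> ` source e) ?v (\<sigma> ` source e #> word_val F a (W (lab e)))"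
      by (rule walk_coset_walk[OF B im_rcoset[OF se(1)] W(1)[OF se(2)]])
    moreover have "\<sigma> ` target e = \<sigma> ` source e #> word_val F a (W (lab e))"
      using se im_coset[OF rcoset_subset[OF B' se(1)]] W(3)[OF se(2)] by simp
    ultimately have v: "walk ?E (\<sigma> ` source e) ?v (\<sigma> ` target e)" by simp
    have vv: "walk_val ?v = \<sigma> (a (lab e))" using walk_val_coset_walk W(3)[OF se(2)] by metis
    have fs: "walk ?E (\<sigma> ` u) (f s) (\<sigma> ` step_to s)"
      using v walk_inv_word[OF v] u s by (cases b) (simp_all add: f_def Let_def)
    have fv: "walk_val (f s) = \<sigma> (letter_val F (\<lambda>e. a (lab e)) s)"
      using vv walk_val_inv_word[OF v coset_graph_labels] se(2) s
      by (cases b) (simp_all add: f_def Let_def letter_val_def)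
    have IH: "walk ?E (\<sigma> ` step_to s) (concat (map f c)) (\<sigma> ` v)"
      "walk_val (concat (map f c)) = \<sigma> (walk_val c)" using Cons.IH[OF c] by auto
    have "walk_val (f s @ concat (map f c)) = \<sigma> (letter_val F (\<lambda>e. a (lab e)) s \<otimes> walk_val c)"
      using walk_val_append[OF fs IH(1) coset_graph_labels] fv IH(2) se(2) s
        walk_val_closed[OF c coset_graph_labels] by (simp add: letter_val_closed)
    then show ?case using fs IH(1) by (auto simp: walk_append word_val_Cons)
  qed simp
  obtain c where c: "walk ?E' ?B' c ?B'" "\<And>e. count_list (map fst c) e \<le> 3" "walk_val c = x"
    using x unfolding short_loop_def by blast
  let ?c = "concat (map f c)"
  have fc: "walk ?E B ?c B" "walk_val ?c = \<sigma> x" using f[OF c(1)] im_B' c(3) by auto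
  obtain N where N: "finite N" "card N \<le> card J" "\<And>c. walk ?E B c B \<Longrightarrow>
      \<exists>w. length w = length (filter (\<lambda>s. fst s \<in> N) c) \<and> fst ` set w \<subseteq> J \<and> word_val F \<beta> w = walk_val c"
    using \<beta> unfolding short_tuple_def by blast
  define D where "D = {e \<in> ?E'. \<exists>t\<in>set (coset_walk (\<sigma> ` source e) (W (lab e))). fst t \<in> N}"
  note card_D = automorphism_coset_graph_crossings[OF finI \<sigma> B N(1) W(1,2) D_def]
  have "length (filter (\<lambda>t. fst t \<in> N) ?c) \<le> 3 * card D * L"
  proof (rule crossings_of_image[OF c(2) card_D(1)])
    fix s assume s: "s \<in> set c"
    then have sE: "fst s \<in> ?E'" using walk_edges[OF c(1)] by auto
    then have "lab (fst s) \<in> I" using coset_graph_labels by auto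
    then show "length (f s) \<le> L" using W(2) by (simp add: f_def Let_def inv_word_def)
    fix t assume t: "fst s \<notin> D" "t \<in> set (f s)"
    have "fst ` set (f s) = fst ` set (coset_walk (\<sigma> ` source (fst s)) (W (lab (fst s))))"
      by (simp add: f_def Let_def)
    moreover have "fst t \<in> fst ` set (f s)" using t(2) by (rule imageI)
    ultimately obtain t' where "fst t = fst t'"
      "t' \<in> set (coset_walk (\<sigma> ` source (fst s)) (W (lab (fst s))))"
      by (auto simp only: image_iff)
    then show "fst t \<notin> N" using t(1) sE unfolding D_def by auto
  qed
  also have "\<dots> \<le> 3 * (card J * (2 * (card I * L))) * L"
    using card_D(2) N(2) by (meson le_trans mult_le_mono mult_le_mono1 order_refl)
  finally show ?thesis using N(3)[OF fc(1)] fc(2) by metis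
qed

text \<open>An admissible value at \<open>\<phi> \<sigma>\<close> comes from short loops in the coset graph of \<open>\<sigma>\<inverse>(B)\<close>, where \<open>B\<close> is
  the preimage of the factor under \<open>\<phi>\<close>; \<open>\<sigma>\<close> takes them to bounded words in any short tuple of \<open>B\<close>, and
  \<open>\<phi>\<close> takes these to bounded words in the images of the basis under an admissible value at \<open>\<phi>\<close>.
  The bound depends on \<open>\<sigma>\<close> only.\<close>

lemma shadow_increments_bounded:
  assumes finI: "finite I" and J: "J \<subseteq> I" and \<sigma>: "\<sigma> \<in> auto F"
  obtains M where "\<And>\<phi> \<psi> \<psi>'. \<phi> \<in> auto F \<Longrightarrow> shadow J \<phi> \<psi> \<Longrightarrow>
    shadow J (\<phi> \<otimes>\<^bsub>AutoGroup F\<^esub> \<sigma>) \<psi>' \<Longrightarrow> inv\<^bsub>AutoGroup F\<^esub> \<psi> \<otimes>\<^bsub>AutoGroup F\<^esub> \<psi>' \<in> bounded_autos M"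
proof -
  have "\<exists>w. fst ` set w \<subseteq> I \<and> word_val F a w = \<sigma> (a i)" if "i \<in> I" for i
    by (rule ex_word_val) (use that \<sigma> in simp)
  then obtain W where W: "\<And>i. i \<in> I \<Longrightarrow> fst ` set (W i) \<subseteq> I" "\<And>i. i \<in> I \<Longrightarrow> word_val F a (W i) = \<sigma> (a i)"
    by metis
  define L where "L = Max (insert 0 ((\<lambda>i. length (W i)) ` I))"
  have L: "length (W i) \<le> L" if "i \<in> I" for i
    unfolding L_def using finI that by (intro Max_ge) auto
  \<comment> \<open>The basis elements outside \<open>J\<close> are fixed, which takes words of length one.\<close>
  define M where "M = max 1 (3 * (card J * (2 * (card I * L))) * L)"
  have "inv\<^bsub>AutoGroup F\<^esub> \<psi> \<otimes>\<^bsub>AutoGroup F\<^esub> \<psi>' \<in> bounded_autos M"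
    if \<phi>: "\<phi> \<in> auto F" and \<psi>: "shadow J \<phi> \<psi>" and \<psi>': "shadow J (\<phi> \<otimes>\<^bsub>AutoGroup F\<^esub> \<sigma>) \<psi>'" for \<phi> \<psi> \<psi>'
  proof -
    let ?\<theta> = "inv\<^bsub>AutoGroup F\<^esub> \<phi>" and ?\<phi>' = "\<phi> \<otimes>\<^bsub>AutoGroup F\<^esub> \<sigma>"
    let ?B = "preimage \<phi> (factor J)"
    note B = preimage_subgroup[OF \<phi> factor_subgroup[OF J]]
    have p: "\<psi> \<in> auto F" "\<And>i. i \<in> I - J \<Longrightarrow> \<psi> (a i) = a i"
      and p': "\<psi>' \<in> auto F" "\<And>i. i \<in> I - J \<Longrightarrow> \<psi>' (a i) = a i"
      using \<psi> \<psi>' by (auto simp: shadow_def factor_autos_def)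
    have pre: "preimage ?\<phi>' (factor J) = preimage \<sigma> ?B"
      using AutoGroup_mult_apply[OF \<phi> \<sigma>] \<sigma> by (auto simp: preimage_def)
    show ?thesis
    proof (rule relatively_bounded[OF p'(1) p(1)])
      fix i assume i: "i \<in> I"
      show "\<exists>w. length w \<le> M \<and> fst ` set w \<subseteq> I \<and> word_val F (\<lambda>i. \<psi> (a i)) w = \<psi>' (a i)"
      proof (cases "i \<in> J")
        case False
        then show ?thesis
          using i p(2) p'(2) by (intro exI[of _ "[(i, True)]"]) (auto simp: M_def)
      next
        case True
        let ?x = "(inv\<^bsub>AutoGroup F\<^esub> ?\<phi>') (\<psi>' (a i))"
        have y: "\<psi>' (a i) \<in> carrier F" using p'(1) i by simp
        have xF: "?x \<in> carrier F" using \<phi> \<sigma> y by simp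
        have "?\<phi>' ?x = \<psi>' (a i)" using AutoGroup_inv_apply(2) \<phi> \<sigma> y by simp
        then have \<phi>\<sigma>: "\<phi> (\<sigma> ?x) = \<psi>' (a i)" using AutoGroup_mult_apply[OF \<phi> \<sigma> xF] by simp
        have "short_loop (coset_graph (preimage \<sigma> ?B)) (preimage \<sigma> ?B) ?x"
          using \<psi>' True unfolding shadow_def short_tuple_def pre by blast
        moreover have "short_tuple (coset_graph ?B) ?B J (\<lambda>j. ?\<theta> (\<psi> (a j)))"
          using \<psi> by (simp add: shadow_def)
        ultimately obtain w where w: "length w \<le> M" "fst ` set w \<subseteq> J"
          "word_val F (\<lambda>j. ?\<theta> (\<psi> (a j))) w = \<sigma> ?x"
          using automorphism_short_loop[OF finI \<sigma> B W(1) L W(2)] unfolding M_def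
          by (meson le_max_iff_disj)
        have cl: "(\<lambda>j. ?\<theta> (\<psi> (a j))) ` fst ` set w \<subseteq> carrier F"
        proof (rule image_subsetI)
          fix j assume "j \<in> fst ` set w"
          then have "j \<in> I" using w(2) J by blast
          then show "?\<theta> (\<psi> (a j)) \<in> carrier F" using \<phi> p(1) by simp
        qed
        have "\<psi>' (a i) = \<phi> (word_val F (\<lambda>j. ?\<theta> (\<psi> (a j))) w)" using \<phi>\<sigma> w(3) by simp
        also have "\<dots> = word_val F (\<phi> \<circ> (\<lambda>j. ?\<theta> (\<psi> (a j)))) w"
          by (rule automorphism_word_val[OF \<phi> cl])
        also have "\<dots> = word_val F (\<lambda>j. \<psi> (a j)) w"
        proof (rule word_val_cong)
          fix j assume "j \<in> fst ` set w"
          then have "\<psi> (a j) \<in> carrier F" using w(2) J p(1) by auto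
          then show "(\<phi> \<circ> (\<lambda>j. ?\<theta> (\<psi> (a j)))) j = \<psi> (a j)" using AutoGroup_inv_apply(2)[OF \<phi>] by simp
        qed
        finally show ?thesis using w(1,2) J by (intro exI[of _ w]) auto
      qed
    qed
  qed
  then show ?thesis using that by blast
qed

theorem factor_autos_lipschitz_retract:
  assumes finI: "finite I" and J: "J \<subseteq> I"
  obtains \<pi> where "lipschitz_retraction (AutoGroup F) (factor_autos J) \<pi>"
proof -
  have finJ: "finite J" using J finI finite_subset by blast
  define \<pi> where "\<pi> \<phi> = (if \<phi> \<in> factor_autos J then \<phi> else SOME \<psi>. shadow J \<phi> \<psi>)" for \<phi>
  have shadow: "shadow J \<phi> (\<pi> \<phi>)" if \<phi>: "\<phi> \<in> auto F" for \<phi>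
  proof (cases "\<phi> \<in> factor_autos J")
    case True
    then show ?thesis using shadow_self[OF J finJ] by (simp add: \<pi>_def)
  next
    case False
    obtain \<psi> where "shadow J \<phi> \<psi>" by (rule ex_shadow[OF finI J \<phi>])
    then show ?thesis using False someI[of "shadow J \<phi>"] by (simp add: \<pi>_def)
  qed
  have "lipschitz_retraction (AutoGroup F) (factor_autos J) \<pi>"
  proof (rule lipschitz_retraction_finite_increments)
    show "group (AutoGroup F)" by (rule group_AutoGroup)
    show "finitely_generated (AutoGroup F)" by (rule finitely_generated_AutoGroup[OF finI])
    show "subgroup (factor_autos J) (AutoGroup F)" by (rule subgroup_factor_autos[OF J])
    show "\<pi> \<in> carrier (AutoGroup F) \<rightarrow> factor_autos J"
      using shadow by (auto simp: carrier_AutoGroup shadow_def)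
    show "\<pi> \<phi> = \<phi>" if "\<phi> \<in> factor_autos J" for \<phi> using that by (simp add: \<pi>_def)
    fix \<sigma> assume "\<sigma> \<in> carrier (AutoGroup F)"
    then have \<sigma>: "\<sigma> \<in> auto F" by (simp add: carrier_AutoGroup)
    obtain M where M: "\<And>\<phi> \<psi> \<psi>'. \<phi> \<in> auto F \<Longrightarrow> shadow J \<phi> \<psi> \<Longrightarrow>
        shadow J (\<phi> \<otimes>\<^bsub>AutoGroup F\<^esub> \<sigma>) \<psi>' \<Longrightarrow> inv\<^bsub>AutoGroup F\<^esub> \<psi> \<otimes>\<^bsub>AutoGroup F\<^esub> \<psi>' \<in> bounded_autos M"
      using shadow_increments_bounded[OF finI J \<sigma>] by blast
    have "{inv\<^bsub>AutoGroup F\<^esub> \<pi> \<phi> \<otimes>\<^bsub>AutoGroup F\<^esub> \<pi> (\<phi> \<otimes>\<^bsub>AutoGroup F\<^esub> \<sigma>) | \<phi>. \<phi> \<in> carrier (AutoGroup F)}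
        \<subseteq> bounded_autos M"
      using M shadow \<sigma> by (auto simp: carrier_AutoGroup)
    then show "finite {inv\<^bsub>AutoGroup F\<^esub> \<pi> \<phi> \<otimes>\<^bsub>AutoGroup F\<^esub> \<pi> (\<phi> \<otimes>\<^bsub>AutoGroup F\<^esub> \<sigma>) | \<phi>. \<phi> \<in> carrier (AutoGroup F)}"
      using finite_bounded_autos[OF finI] finite_subset by blast
  qed
  then show ?thesis using that by blast
qed

end

theorem theorem3:
  fixes F :: "('a, 'b) monoid_scheme" and a :: "nat \<Rightarrow> 'a" and n :: nat
  assumes "n \<ge> 1"
    and "group F"
    and "free_basis F a {1..n}"
  shows "(\<exists>\<pi>. lipschitz_retraction (AutoGroup F) (factor_stabilizer F a n) \<pi>) \<and>
         undistorted (AutoGroup F) (factor_stabilizer F a n)"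
proof -
  interpret free_group F a "{1..n}"
    using assms(2,3) by (simp add: free_group_def free_group_axioms_def)
  have "{1..n} - {1..<n} = {n}" using assms(1) by auto
  then have "factor_stabilizer F a n = factor_autos {1..<n}"
    unfolding factor_stabilizer_def factor_autos_def factor_def carrier_AutoGroup by simp
  moreover obtain \<pi> where "lipschitz_retraction (AutoGroup F) (factor_autos {1..<n}) \<pi>"
    by (rule factor_autos_lipschitz_retract[of "{1..<n}"]) auto
  ultimately show ?thesis using lipschitz_retract_undistorted by metis
qed

end
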